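(* The category dual (opposite) to the category of metrizable $lc^*$-algebras is equivalent to the category of hemicompact locally compact Hausdorff spaces (equivalently, of $\sigma$-compact locally compact Hausdorff spaces).
   Context: A space $T$ is hemicompact if it is the union of a countable family of compact sets $K_i$ such that every compact subset of $T$ is contained in some $K_i$. Morphisms of spaces are all continuous maps. (The empty space is allowed.) "Algebra" means commutative associative algebra over $\mathbb{C}$ with unit (the zero algebra is allowed). An involutive algebra is an algebra with a conjugate-linear map $x\mapsto x^*$ satisfying $(x^* )^*=x$, $(xy)^*=y^*x^*$. A hermitian character is a unit-preserving algebra homomorphism $\chi\colon A\to\mathbb{C}$ with $\chi(x^* )=\overline{\chi(x)}$; $X_c^*(A)$ denotes the set of continuous hermitian characters of a topological involutive algebra $A$. A $C^*$-seminorm is a seminorm $p$ with $p(xx^* )=p(x)^2$ for all $x$; $N(p)=\{x:p(x)=0\}$ is its kernel. A $K^*$-algebra is an involutive algebra with a complete Hausdorff topology defined by a family of $C^*$-seminorms. An $lc^*$-algebra is a $K^*$-algebra $A$ such that for every $\chi\in X_c^*(A)$ there exist $a\in A$ and a continuous $C^*$-seminorm $p$ on $A$ with $\chi(a)=1$ and $a\cdot N(p)=\{0\}$. Morphisms are the continuous unit-preserving algebra homomorphisms $u$ with $u(x^* )=u(x)^*$ (full subcategory of metrizable algebras). *)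

theory Defs
  imports
    "HOL-Analysis.Analysis"
    "HOL-Algebra.Module"
    "HOL-Library.Equipollence"
begin

section \<open>Categories, functors, equivalences\<close>

text \<open>Arrow sets are indexed by their source and target and need not be disjoint;
  \<open>Comp C X Y Z g f\<close> is the composite of \<open>f \<in> Arr C X Y\<close> and \<open>g \<in> Arr C Y Z\<close>.\<close>

record ('o, 'm) category =
  Obj :: "'o set"
  Arr :: "'o \<Rightarrow> 'o \<Rightarrow> 'm set"
  Comp :: "'o \<Rightarrow> 'o \<Rightarrow> 'o \<Rightarrow> 'm \<Rightarrow> 'm \<Rightarrow> 'm"
  Ident :: "'o \<Rightarrow> 'm"

definition is_category :: "('o, 'm) category \<Rightarrow> bool" where
  "is_category C \<longleftrightarrow>
    (\<forall>X\<in>Obj C. Ident C X \<in> Arr C X X) \<and>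
    (\<forall>X\<in>Obj C. \<forall>Y\<in>Obj C. \<forall>Z\<in>Obj C. \<forall>f\<in>Arr C X Y. \<forall>g\<in>Arr C Y Z.
        Comp C X Y Z g f \<in> Arr C X Z) \<and>
    (\<forall>X\<in>Obj C. \<forall>Y\<in>Obj C. \<forall>f\<in>Arr C X Y.
        Comp C X X Y f (Ident C X) = f \<and> Comp C X Y Y (Ident C Y) f = f) \<and>
    (\<forall>W\<in>Obj C. \<forall>X\<in>Obj C. \<forall>Y\<in>Obj C. \<forall>Z\<in>Obj C.
      \<forall>f\<in>Arr C W X. \<forall>g\<in>Arr C X Y. \<forall>h\<in>Arr C Y Z.
        Comp C W Y Z h (Comp C W X Y g f) = Comp C W X Z (Comp C X Y Z h g) f)"

definition dual_category :: "('o, 'm) category \<Rightarrow> ('o, 'm) category" where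
  "dual_category C =
    \<lparr>Obj = Obj C,
     Arr = (\<lambda>X Y. Arr C Y X),
     Comp = (\<lambda>X Y Z g f. Comp C Z Y X f g),
     Ident = Ident C\<rparr>"

definition is_functor ::
  "('o, 'm) category \<Rightarrow> ('p, 'n) category \<Rightarrow> ('o \<Rightarrow> 'p) \<Rightarrow> ('o \<Rightarrow> 'o \<Rightarrow> 'm \<Rightarrow> 'n) \<Rightarrow> bool" where
  "is_functor C D F\<^sub>o F\<^sub>a \<longleftrightarrow>
    (\<forall>X\<in>Obj C. F\<^sub>o X \<in> Obj D) \<and>
    (\<forall>X\<in>Obj C. \<forall>Y\<in>Obj C. \<forall>f\<in>Arr C X Y. F\<^sub>a X Y f \<in> Arr D (F\<^sub>o X) (F\<^sub>o Y)) \<and>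
    (\<forall>X\<in>Obj C. F\<^sub>a X X (Ident C X) = Ident D (F\<^sub>o X)) \<and>
    (\<forall>X\<in>Obj C. \<forall>Y\<in>Obj C. \<forall>Z\<in>Obj C. \<forall>f\<in>Arr C X Y. \<forall>g\<in>Arr C Y Z.
        F\<^sub>a X Z (Comp C X Y Z g f) = Comp D (F\<^sub>o X) (F\<^sub>o Y) (F\<^sub>o Z) (F\<^sub>a Y Z g) (F\<^sub>a X Y f))"

definition is_iso :: "('o, 'm) category \<Rightarrow> 'o \<Rightarrow> 'o \<Rightarrow> 'm \<Rightarrow> bool" where
  "is_iso C X Y f \<longleftrightarrow> f \<in> Arr C X Y \<and>
    (\<exists>g\<in>Arr C Y X. Comp C X Y X g f = Ident C X \<and> Comp C Y X Y f g = Ident C Y)"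

definition natural_iso ::
  "('o, 'm) category \<Rightarrow> ('p, 'n) category \<Rightarrow>
   ('o \<Rightarrow> 'p) \<Rightarrow> ('o \<Rightarrow> 'o \<Rightarrow> 'm \<Rightarrow> 'n) \<Rightarrow> ('o \<Rightarrow> 'p) \<Rightarrow> ('o \<Rightarrow> 'o \<Rightarrow> 'm \<Rightarrow> 'n) \<Rightarrow>
   ('o \<Rightarrow> 'n) \<Rightarrow> bool" where
  "natural_iso C D F\<^sub>o F\<^sub>a G\<^sub>o G\<^sub>a \<eta> \<longleftrightarrow>
    (\<forall>X\<in>Obj C. is_iso D (F\<^sub>o X) (G\<^sub>o X) (\<eta> X)) \<and>
    (\<forall>X\<in>Obj C. \<forall>Y\<in>Obj C. \<forall>f\<in>Arr C X Y.
        Comp D (F\<^sub>o X) (F\<^sub>o Y) (G\<^sub>o Y) (\<eta> Y) (F\<^sub>a X Y f) =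
        Comp D (F\<^sub>o X) (G\<^sub>o X) (G\<^sub>o Y) (G\<^sub>a X Y f) (\<eta> X))"

definition equivalent_categories :: "('o, 'm) category \<Rightarrow> ('p, 'n) category \<Rightarrow> bool" where
  "equivalent_categories C D \<longleftrightarrow> is_category C \<and> is_category D \<and>
    (\<exists>F\<^sub>o F\<^sub>a G\<^sub>o G\<^sub>a \<eta> \<epsilon>.
      is_functor C D F\<^sub>o F\<^sub>a \<and> is_functor D C G\<^sub>o G\<^sub>a \<and>
      natural_iso C C (\<lambda>X. X) (\<lambda>X Y f. f) (\<lambda>X. G\<^sub>o (F\<^sub>o X)) (\<lambda>X Y f. G\<^sub>a (F\<^sub>o X) (F\<^sub>o Y) (F\<^sub>a X Y f)) \<eta> \<and>
      natural_iso D D (\<lambda>Z. F\<^sub>o (G\<^sub>o Z)) (\<lambda>Z W h. F\<^sub>a (G\<^sub>o Z) (G\<^sub>o W) (G\<^sub>a Z W h)) (\<lambda>Z. Z) (\<lambda>Z W h. h) \<epsilon>)"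


section \<open>Universes\<close>

text \<open>HOL has no proper classes, so the categories below are formed relative to a universe
  \<open>\<U>\<close> of small subsets of a type \<open>'u\<close>.  Only closure under smaller sets and countable powers
  is required, so that universes provably exist (see \<open>universe_UNIV\<close>); HOL proves of no type
  that it is large enough for closure under power sets as well.

  An algebra is small if its carrier is.  A space is small if it has a base of small
  cardinality; its points may be any elements of \<open>'u set\<close>, which restricts nothing, since a
  \<open>T\<^sub>0\<close> space is no larger than the power set of any of its bases.  Without power sets the
  asymmetry is forced: \<open>\<ell>\<^sup>\<infinity>\<close> has the cardinality of the continuum, whereas its space of
  characters \<open>\<beta>\<nat>\<close> has more points, but a base of that cardinality.  If \<open>\<U>\<close> happens to be
  closed under power sets, a Hausdorff space is small in this sense iff its set of points is
  equipotent to a member of \<open>\<U>\<close>.  In any case every space on any type has a homeomorphic copy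
  that is small for a suitable \<open>\<U>\<close> (see \<open>space_small_copy\<close>).\<close>

definition universe :: "'u set set \<Rightarrow> bool" where
  "universe \<U> \<longleftrightarrow>
    (\<exists>S\<in>\<U>. \<exists>x\<in>S. \<exists>y\<in>S. x \<noteq> y) \<and>
    (\<forall>S\<in>\<U>. \<forall>T. T \<lesssim> S \<longrightarrow> T \<in> \<U>) \<and>
    (\<forall>S\<in>\<U>. \<exists>T\<in>\<U>. {f :: nat \<Rightarrow> 'u. range f \<subseteq> S} \<lesssim> T)"

definition small_space :: "'u set set \<Rightarrow> 'p topology \<Rightarrow> bool" where
  "small_space \<U> X \<longleftrightarrow>
    (\<exists>\<B>. (\<exists>S\<in>\<U>. \<B> \<lesssim> S) \<and> (\<forall>V\<in>\<B>. openin X V) \<and>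
         (\<forall>U x. openin X U \<and> x \<in> U \<longrightarrow> (\<exists>V\<in>\<B>. x \<in> V \<and> V \<subseteq> U)))"

lemma universe_UNIV: "universe (UNIV :: (nat \<Rightarrow> 'a set) set set)"
proof -
  have "inj (\<lambda>(f :: nat \<Rightarrow> nat \<Rightarrow> 'a set) n. f (fst (prod_decode n)) (snd (prod_decode n)))"
  proof (rule injI, intro ext)
    fix f g :: "nat \<Rightarrow> nat \<Rightarrow> 'a set" and i j
    assume "(\<lambda>n. f (fst (prod_decode n)) (snd (prod_decode n))) =
            (\<lambda>n. g (fst (prod_decode n)) (snd (prod_decode n)))"
    from fun_cong [OF this, of "prod_encode (i, j)"] show "f i j = g i j" by simp
  qed
  then have "{f :: nat \<Rightarrow> nat \<Rightarrow> 'a set. range f \<subseteq> S} \<lesssim> (UNIV :: (nat \<Rightarrow> 'a set) set)" for S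
    unfolding lepoll_def by (meson inj_on_subset subset_UNIV)
  moreover have "(\<lambda>_ :: nat. {}) \<noteq> (\<lambda>_. UNIV :: 'a set)" by (auto dest: fun_cong)
  then have "\<exists>S \<in> (UNIV :: (nat \<Rightarrow> 'a set) set set). \<exists>x\<in>S. \<exists>y\<in>S. x \<noteq> y"
    by (intro bexI [of _ UNIV]) auto
  ultimately show ?thesis unfolding universe_def by (meson UNIV_I)
qed

lemma space_small_copy:
  fixes X :: "'a topology"
  shows "\<exists>Y :: (nat \<Rightarrow> 'a set) set topology.
    X homeomorphic_space Y \<and> small_space (UNIV :: (nat \<Rightarrow> 'a set) set set) Y"
proof -
  define f :: "'a \<Rightarrow> (nat \<Rightarrow> 'a set) set" where "f = (\<lambda>a. {\<lambda>_. {a}})"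
  have "inj f" by (auto simp: f_def inj_on_def dest: fun_cong)
  define g where "g = inv_into UNIV f"
  have gf: "g (f a) = a" for a using \<open>inj f\<close> by (simp add: g_def)
  define Y where "Y = pullback_topology (range f) g X"
  have opY: "openin Y U \<longleftrightarrow> (\<exists>V. openin X V \<and> U = g -` V \<inter> range f)" for U
    by (simp add: Y_def openin_pullback_topology)
  have topY: "topspace Y = g -` topspace X \<inter> range f"
    by (simp add: Y_def topspace_pullback_topology)
  have "continuous_map Y X g"
  proof -
    have "{x \<in> topspace Y. g x \<in> V} = g -` V \<inter> range f" if "openin X V" for V
      using openin_subset [OF that] by (auto simp: topY)
    then show ?thesis
      by (auto simp: continuous_map_def opY topY)
  qed
  moreover have "continuous_map X Y f"
  proof -
    have "{x \<in> topspace X. f x \<in> g -` V \<inter> range f} = V" if "openin X V" for V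
      using openin_subset [OF that] by (auto simp: gf)
    then show ?thesis
      by (auto simp: continuous_map_def opY topY gf)
  qed
  ultimately have "homeomorphic_maps X Y f g"
    by (auto simp: homeomorphic_maps_def topY gf)
  moreover have "small_space (UNIV :: (nat \<Rightarrow> 'a set) set set) Y"
  proof -
    have "{U. openin Y U} \<lesssim> (UNIV :: (nat \<Rightarrow> 'a set) set)"
    proof -
      have "inj_on (\<lambda>U (_ :: nat). g ` U) {U. openin Y U}"
      proof (rule inj_onI)
        fix U V assume U: "U \<in> {U. openin Y U}" and V: "V \<in> {U. openin Y U}"
          and eq: "(\<lambda>_ :: nat. g ` U) = (\<lambda>_. g ` V)"
        have "W = f ` (g ` W)" if "openin Y W" for W
        proof -
          have "f (g w) = w" if "w \<in> W" for w
            using openin_subset [OF \<open>openin Y W\<close>] that by (auto simp: topY gf)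
          then show ?thesis by (simp add: image_image)
        qed
        then have "U = f ` (g ` U)" "V = f ` (g ` V)" using U V by auto
        moreover have "g ` U = g ` V" using fun_cong [OF eq] .
        ultimately show "U = V" by simp
      qed
      then show ?thesis unfolding lepoll_def by (meson subset_UNIV)
    qed
    then show ?thesis unfolding small_space_def
      by (intro exI [of _ "{U. openin Y U}"] conjI bexI [of _ UNIV]) auto
  qed
  ultimately show ?thesis unfolding homeomorphic_space_def by blast
qed


section \<open>Spaces\<close>

definition hemicompact_space :: "'a topology \<Rightarrow> bool" where
  "hemicompact_space X \<longleftrightarrow>
    (\<exists>\<K>. countable \<K> \<and> (\<forall>K\<in>\<K>. compactin X K) \<and> topspace X = \<Union>\<K> \<and>
         (\<forall>C. compactin X C \<longrightarrow> (\<exists>K\<in>\<K>. C \<subseteq> K)))"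

definition sigma_compact_space :: "'a topology \<Rightarrow> bool" where
  "sigma_compact_space X \<longleftrightarrow>
    (\<exists>\<K>. countable \<K> \<and> (\<forall>K\<in>\<K>. compactin X K) \<and> topspace X = \<Union>\<K>)"

definition space_category :: "'p topology set \<Rightarrow> ('p topology, 'p \<Rightarrow> 'p) category" where
  "space_category \<X> =
    \<lparr>Obj = \<X>,
     Arr = (\<lambda>X Y. {f \<in> extensional (topspace X). continuous_map X Y f}),
     Comp = (\<lambda>X Y Z g f. compose (topspace X) g f),
     Ident = (\<lambda>X. \<lambda>x\<in>topspace X. x)\<rparr>"

definition hemicompact_lc_category ::
  "'u set set \<Rightarrow> ('u set topology, 'u set \<Rightarrow> 'u set) category" where
  "hemicompact_lc_category \<U> = space_category
    {X. small_space \<U> X \<and> Hausdorff_space X \<and> locally_compact_space X \<and> hemicompact_space X}"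

definition sigma_compact_lc_category ::
  "'u set set \<Rightarrow> ('u set topology, 'u set \<Rightarrow> 'u set) category" where
  "sigma_compact_lc_category \<U> = space_category
    {X. small_space \<U> X \<and> Hausdorff_space X \<and> locally_compact_space X \<and> sigma_compact_space X}"


section \<open>Topological involutive algebras\<close>

definition complex_ring :: "complex ring" where
  "complex_ring = \<lparr>carrier = UNIV, mult = (*), one = 1, zero = 0, add = (+)\<rparr>"

record 'a star_algebra = "(complex, 'a) module" +
  star :: "'a \<Rightarrow> 'a"
  alg_topology :: "'a topology"

text \<open>The library's \<open>algebra\<close> is commutative, associative and unital, and may be zero.\<close>

definition involutive_algebra :: "'a star_algebra \<Rightarrow> bool" where
  "involutive_algebra A \<longleftrightarrow>
    algebra complex_ring A \<and>
    (\<forall>x\<in>carrier A. star A x \<in> carrier A \<and> star A (star A x) = x) \<and>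
    (\<forall>x\<in>carrier A. \<forall>y\<in>carrier A.
        star A (x \<oplus>\<^bsub>A\<^esub> y) = star A x \<oplus>\<^bsub>A\<^esub> star A y \<and>
        star A (x \<otimes>\<^bsub>A\<^esub> y) = star A y \<otimes>\<^bsub>A\<^esub> star A x) \<and>
    (\<forall>c. \<forall>x\<in>carrier A. star A (c \<odot>\<^bsub>A\<^esub> x) = cnj c \<odot>\<^bsub>A\<^esub> star A x)"

definition seminorm :: "'a star_algebra \<Rightarrow> ('a \<Rightarrow> real) \<Rightarrow> bool" where
  "seminorm A p \<longleftrightarrow>
    (\<forall>x\<in>carrier A. 0 \<le> p x) \<and>
    (\<forall>x\<in>carrier A. \<forall>y\<in>carrier A. p (x \<oplus>\<^bsub>A\<^esub> y) \<le> p x + p y) \<and>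
    (\<forall>c. \<forall>x\<in>carrier A. p (c \<odot>\<^bsub>A\<^esub> x) = cmod c * p x)"

definition Cstar_seminorm :: "'a star_algebra \<Rightarrow> ('a \<Rightarrow> real) \<Rightarrow> bool" where
  "Cstar_seminorm A p \<longleftrightarrow>
    seminorm A p \<and> (\<forall>x\<in>carrier A. p (x \<otimes>\<^bsub>A\<^esub> star A x) = (p x)\<^sup>2)"

definition seminorm_kernel :: "'a star_algebra \<Rightarrow> ('a \<Rightarrow> real) \<Rightarrow> 'a set" where
  "seminorm_kernel A p = {x \<in> carrier A. p x = 0}"

definition seminorm_topology :: "'a star_algebra \<Rightarrow> ('a \<Rightarrow> real) set \<Rightarrow> 'a topology" where
  "seminorm_topology A P = topology_generated_by
    (insert (carrier A)
      {{y \<in> carrier A. p (y \<ominus>\<^bsub>A\<^esub> x) < e} | p x e. p \<in> P \<and> x \<in> carrier A \<and> 0 < e})"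

definition cauchy_filter_on :: "'a star_algebra \<Rightarrow> 'a filter \<Rightarrow> bool" where
  "cauchy_filter_on A F \<longleftrightarrow> F \<noteq> bot \<and> eventually (\<lambda>x. x \<in> carrier A) F \<and>
    (\<forall>U. openin (alg_topology A) U \<and> \<zero>\<^bsub>A\<^esub> \<in> U \<longrightarrow>
      (\<exists>S\<subseteq>carrier A. eventually (\<lambda>x. x \<in> S) F \<and> (\<forall>x\<in>S. \<forall>y\<in>S. x \<ominus>\<^bsub>A\<^esub> y \<in> U)))"

definition complete_algebra :: "'a star_algebra \<Rightarrow> bool" where
  "complete_algebra A \<longleftrightarrow>
    (\<forall>F. cauchy_filter_on A F \<longrightarrow> (\<exists>l. limitin (alg_topology A) (\<lambda>x. x) l F))"

definition Kstar_algebra :: "'a star_algebra \<Rightarrow> bool" where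
  "Kstar_algebra A \<longleftrightarrow> involutive_algebra A \<and>
    (\<exists>P. (\<forall>p\<in>P. Cstar_seminorm A p) \<and> alg_topology A = seminorm_topology A P) \<and>
    Hausdorff_space (alg_topology A) \<and> complete_algebra A"

definition continuous_hermitian_characters :: "'a star_algebra \<Rightarrow> ('a \<Rightarrow> complex) set" where
  "continuous_hermitian_characters A =
    {\<phi> \<in> ring_hom A complex_ring.
      (\<forall>c. \<forall>x\<in>carrier A. \<phi> (c \<odot>\<^bsub>A\<^esub> x) = c * \<phi> x) \<and>
      (\<forall>x\<in>carrier A. \<phi> (star A x) = cnj (\<phi> x)) \<and>
      continuous_map (alg_topology A) euclidean \<phi>}"

definition lcstar_algebra :: "'a star_algebra \<Rightarrow> bool" where
  "lcstar_algebra A \<longleftrightarrow> Kstar_algebra A \<and>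
    (\<forall>\<phi>\<in>continuous_hermitian_characters A.
      \<exists>a\<in>carrier A. \<exists>p. Cstar_seminorm A p \<and> continuous_map (alg_topology A) euclidean p \<and>
        \<phi> a = 1 \<and> (\<lambda>x. a \<otimes>\<^bsub>A\<^esub> x) ` seminorm_kernel A p = {\<zero>\<^bsub>A\<^esub>})"

definition star_algebra_morphisms ::
  "'a star_algebra \<Rightarrow> 'b star_algebra \<Rightarrow> ('a \<Rightarrow> 'b) set" where
  "star_algebra_morphisms A B =
    {u \<in> ring_hom A B. u \<in> extensional (carrier A) \<and>
      (\<forall>c. \<forall>x\<in>carrier A. u (c \<odot>\<^bsub>A\<^esub> x) = c \<odot>\<^bsub>B\<^esub> u x) \<and>
      (\<forall>x\<in>carrier A. u (star A x) = star B (u x)) \<and>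
      continuous_map (alg_topology A) (alg_topology B) u}"

definition metrizable_lcstar_category ::
  "'u set set \<Rightarrow> ('u star_algebra, 'u \<Rightarrow> 'u) category" where
  "metrizable_lcstar_category \<U> =
    \<lparr>Obj = {A. carrier A \<in> \<U> \<and> lcstar_algebra A \<and> metrizable_space (alg_topology A)},
     Arr = star_algebra_morphisms,
     Comp = (\<lambda>A B C v u. compose (carrier A) v u),
     Ident = (\<lambda>A. \<lambda>x\<in>carrier A. x)\<rparr>"

end

(* By polarization a C*-seminorm p on a commutative *-algebra is submultiplicative. Among the
   C*-seminorms below p that agree with p at a given x there is a minimal one, by Zorn's lemma; it
   is multiplicative, and Ostrowski's argument (an elementary Gelfand-Mazur theorem) shows that a
   multiplicative one is the modulus of a hermitian character. So p(x) is the maximum of |phi(x)|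
   over the compact set of hermitian characters phi with |phi| <= p, without any completeness.

   In the metrizable case p ranges over an increasing sequence p_n. By the Stone-Weierstrass
   theorem every continuous function on the space of characters is approximated on |phi| <= p_n by
   an element of A; these elements form a Cauchy sequence, so A consists of all continuous
   functions on its space of characters. The lc*-condition makes this space locally compact and
   bounds its compact sets by some p_n, so a continuous map of spectra induces a continuous
   morphism and the spectrum functor is fully faithful. It is essentially surjective because the
   continuous characters of C(X) are the evaluations at points of X. *)
theory Submission
  imports Defs
begin

section \<open>Fully faithful and essentially surjective functors\<close>

text \<open>The two categories live on different types, \<open>'u set\<close> for points and
  \<open>'u\<close> for algebra elements. Points of the spectrum have a canonical code, their
  kernels, but an algebra of functions must be copied into \<open>'u\<close> along an arbitrary
  injection. Hence no inverse functor is written down; it comes by choice from full faithfulness and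
  essential surjectivity. Closure of the universe under countable powers is what the cardinalities
  require: a continuous function on a sigma-compact space is recorded by countably many sequences of
  basic open sets, and conversely the sets where |\<psi> b| < 1, for \<open>b\<close> in the
  algebra, form a base of the spectrum. Metrizability lets the approximations on the sets |\<phi>|
  \<le> p_n be combined into one Cauchy sequence; with uncountably many seminorms no such sequence
  is at hand. Compactness conditions enter in both directions: the lc*-condition bounds compact sets
  of characters by one seminorm, and local compactness of X makes limits that are uniform on compact
  sets continuous, so that C(X) is complete.\<close>

lemma equivalent_categoriesI:
  assumes C: "is_category C" and D: "is_category D" and F: "is_functor C D Fo Fa"
    and ff: "\<And>X Y. X \<in> Obj C \<Longrightarrow> Y \<in> Obj C \<Longrightarrow> bij_betw (Fa X Y) (Arr C X Y) (Arr D (Fo X) (Fo Y))"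
    and ess: "\<And>Z. Z \<in> Obj D \<Longrightarrow> \<exists>X\<in>Obj C. \<exists>f. is_iso D (Fo X) Z f"
  shows "equivalent_categories C D"
proof -
  have "\<forall>Z\<in>Obj D. \<exists>X e i. X \<in> Obj C \<and> e \<in> Arr D (Fo X) Z \<and> i \<in> Arr D Z (Fo X) \<and>
      Comp D (Fo X) Z (Fo X) i e = Ident D (Fo X) \<and> Comp D Z (Fo X) Z e i = Ident D Z"
  proof
    fix Z assume "Z \<in> Obj D"
    then obtain X f where X: "X \<in> Obj C" and f: "is_iso D (Fo X) Z f" using ess by blast
    from f obtain g where "f \<in> Arr D (Fo X) Z" "g \<in> Arr D Z (Fo X)"
      "Comp D (Fo X) Z (Fo X) g f = Ident D (Fo X)" "Comp D Z (Fo X) Z f g = Ident D Z"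
      unfolding is_iso_def by blast
    with X show "\<exists>X e i. X \<in> Obj C \<and> e \<in> Arr D (Fo X) Z \<and> i \<in> Arr D Z (Fo X) \<and>
      Comp D (Fo X) Z (Fo X) i e = Ident D (Fo X) \<and> Comp D Z (Fo X) Z e i = Ident D Z"
      by (intro exI conjI)
  qed
  then obtain G e i where
    G: "\<And>Z. Z \<in> Obj D \<Longrightarrow> G Z \<in> Obj C" and
    e: "\<And>Z. Z \<in> Obj D \<Longrightarrow> e Z \<in> Arr D (Fo (G Z)) Z" and
    i: "\<And>Z. Z \<in> Obj D \<Longrightarrow> i Z \<in> Arr D Z (Fo (G Z))" and
    ie: "\<And>Z. Z \<in> Obj D \<Longrightarrow> Comp D (Fo (G Z)) Z (Fo (G Z)) (i Z) (e Z) = Ident D (Fo (G Z))" and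
    ei: "\<And>Z. Z \<in> Obj D \<Longrightarrow> Comp D Z (Fo (G Z)) Z (e Z) (i Z) = Ident D Z"
    by metis
  have Dcomp: "Comp D X Y Z g f \<in> Arr D X Z"
    if "X \<in> Obj D" "Y \<in> Obj D" "Z \<in> Obj D" "f \<in> Arr D X Y" "g \<in> Arr D Y Z" for X Y Z f g
    using D that unfolding is_category_def by simp
  have Ccomp: "Comp C X Y Z g f \<in> Arr C X Z"
    if "X \<in> Obj C" "Y \<in> Obj C" "Z \<in> Obj C" "f \<in> Arr C X Y" "g \<in> Arr C Y Z" for X Y Z f g
    using C that unfolding is_category_def by simp
  have Dassoc: "Comp D W X Z (Comp D X Y Z h g) f = Comp D W Y Z h (Comp D W X Y g f)"
    if "W \<in> Obj D" "X \<in> Obj D" "Y \<in> Obj D" "Z \<in> Obj D"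
      "f \<in> Arr D W X" "g \<in> Arr D X Y" "h \<in> Arr D Y Z" for W X Y Z f g h
    using D that unfolding is_category_def by simp
  have Did: "Ident D X \<in> Arr D X X" if "X \<in> Obj D" for X
    using D that unfolding is_category_def by simp
  have Cid: "Ident C X \<in> Arr C X X" if "X \<in> Obj C" for X
    using C that unfolding is_category_def by simp
  have Did1: "Comp D X X Y f (Ident D X) = f" and Did2: "Comp D X Y Y (Ident D Y) f = f"
    if "X \<in> Obj D" "Y \<in> Obj D" "f \<in> Arr D X Y" for X Y f
    using D that unfolding is_category_def by simp_all
  have Fobj: "Fo X \<in> Obj D" if "X \<in> Obj C" for X
    using F that unfolding is_functor_def by simp
  have Farr: "Fa X Y f \<in> Arr D (Fo X) (Fo Y)" if "X \<in> Obj C" "Y \<in> Obj C" "f \<in> Arr C X Y" for X Y f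
    using F that unfolding is_functor_def by simp
  have Fid: "Fa X X (Ident C X) = Ident D (Fo X)" if "X \<in> Obj C" for X
    using F that unfolding is_functor_def by simp
  have Fcomp: "Fa X Z (Comp C X Y Z g f) = Comp D (Fo X) (Fo Y) (Fo Z) (Fa Y Z g) (Fa X Y f)"
    if "X \<in> Obj C" "Y \<in> Obj C" "Z \<in> Obj C" "f \<in> Arr C X Y" "g \<in> Arr C Y Z" for X Y Z f g
    using F that unfolding is_functor_def by simp
  have inj: "f = g"
    if "X \<in> Obj C" "Y \<in> Obj C" "f \<in> Arr C X Y" "g \<in> Arr C X Y" "Fa X Y f = Fa X Y g" for X Y f g
    using ff[OF that(1,2)] that(3-5) by (meson bij_betw_imp_inj_on inj_onD)
  \<comment> \<open>Lift of an arrow along the bijection \<open>Fa X Y\<close>. Equations in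
    \<open>C\<close> are checked after applying the injective \<open>Fa\<close>.\<close>
  define L where "L X Y h = inv_into (Arr C X Y) (Fa X Y) h" for X Y h
  have L: "L X Y h \<in> Arr C X Y" and FL: "Fa X Y (L X Y h) = h"
    if "X \<in> Obj C" "Y \<in> Obj C" "h \<in> Arr D (Fo X) (Fo Y)" for X Y h
    using ff[OF that(1,2)] that(3) unfolding L_def
    by (auto simp: bij_betw_def inv_into_into f_inv_into_f)
  \<comment> \<open>Cancellation rules: once composites are bracketed to the right by
    \<open>Dassoc\<close>, they remove an adjacent pair of \<open>i\<close> and \<open>e\<close>
    inside a longer composite.\<close>
  have ie': "Comp D V Z (Fo (G Z)) (i Z) (Comp D V (Fo (G Z)) Z (e Z) k) = k"
    if "V \<in> Obj D" "Z \<in> Obj D" "k \<in> Arr D V (Fo (G Z))" for V Z k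
    using Dassoc[of V "Fo (G Z)" Z "Fo (G Z)" k "e Z" "i Z"] that G Fobj e i ie Did2 by simp
  have ei': "Comp D V (Fo (G Z)) Z (e Z) (Comp D V Z (Fo (G Z)) (i Z) k) = k"
    if "V \<in> Obj D" "Z \<in> Obj D" "k \<in> Arr D V Z" for V Z k
    using Dassoc[of V Z "Fo (G Z)" Z k "i Z" "e Z"] that G Fobj e i ei Did2 by simp
  \<comment> \<open>Conjugation of \<open>h\<close> with the chosen isomorphisms, lifted to
    \<open>C\<close>.\<close>
  define Ga where "Ga Z W h = L (G Z) (G W)
      (Comp D (Fo (G Z)) W (Fo (G W)) (i W) (Comp D (Fo (G Z)) Z W h (e Z)))" for Z W h
  have Ga: "Ga Z W h \<in> Arr C (G Z) (G W)" and
    FGa: "Fa (G Z) (G W) (Ga Z W h) =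
      Comp D (Fo (G Z)) W (Fo (G W)) (i W) (Comp D (Fo (G Z)) Z W h (e Z))"
    if "Z \<in> Obj D" "W \<in> Obj D" "h \<in> Arr D Z W" for Z W h
    unfolding Ga_def using that by (auto intro!: L FL Dcomp G Fobj e i)
  have GF: "is_functor D C G Ga"
    unfolding is_functor_def
  proof (intro conjI ballI)
    fix X assume X: "X \<in> Obj D"
    show "Ga X X (Ident D X) = Ident C (G X)"
      by (rule inj[of "G X" "G X"]) (use X in \<open>simp_all add: G Cid Ga Did FGa Did2 Fobj e ie Fid\<close>)
  next
    fix X Y Z f g
    assume a: "X \<in> Obj D" "Y \<in> Obj D" "Z \<in> Obj D" "f \<in> Arr D X Y" "g \<in> Arr D Y Z"
    show "Ga X Z (Comp D X Y Z g f) = Comp C (G X) (G Y) (G Z) (Ga Y Z g) (Ga X Y f)"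
    proof (rule inj[of "G X" "G Z"])
      have "Fa (G X) (G Z) (Comp C (G X) (G Y) (G Z) (Ga Y Z g) (Ga X Y f)) =
        Comp D (Fo (G X)) (Fo (G Y)) (Fo (G Z))
          (Comp D (Fo (G Y)) Z (Fo (G Z)) (i Z) (Comp D (Fo (G Y)) Y Z g (e Y)))
          (Comp D (Fo (G X)) Y (Fo (G Y)) (i Y) (Comp D (Fo (G X)) X Y f (e X)))"
        using a by (simp add: Fcomp G Ga FGa)
      also have "\<dots> = Comp D (Fo (G X)) Z (Fo (G Z)) (i Z)
          (Comp D (Fo (G X)) Y Z g (Comp D (Fo (G X)) X Y f (e X)))"
        using a by (simp add: Dassoc Dcomp G Fobj e i ei')
      finally show "Fa (G X) (G Z) (Ga X Z (Comp D X Y Z g f)) =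
          Fa (G X) (G Z) (Comp C (G X) (G Y) (G Z) (Ga Y Z g) (Ga X Y f))"
        using a by (simp add: FGa Dcomp Dassoc G Fobj e)
    qed (use a in \<open>simp_all add: G Ga Dcomp Ccomp\<close>)
  qed (simp_all add: G Ga)
  \<comment> \<open>The unit is the lift of \<open>i\<close> and its inverse the lift of
    \<open>e\<close>; the counit is \<open>e\<close> itself.\<close>
  define \<eta> where "\<eta> X = L X (G (Fo X)) (i (Fo X))" for X
  define \<eta>' where "\<eta>' X = L (G (Fo X)) X (e (Fo X))" for X
  have \<eta>: "\<eta> X \<in> Arr C X (G (Fo X))" "Fa X (G (Fo X)) (\<eta> X) = i (Fo X)"
    "\<eta>' X \<in> Arr C (G (Fo X)) X" "Fa (G (Fo X)) X (\<eta>' X) = e (Fo X)" if "X \<in> Obj C" for X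
    unfolding \<eta>_def \<eta>'_def using that by (auto intro!: L FL G Fobj e i)
  have "natural_iso C C (\<lambda>X. X) (\<lambda>X Y f. f) (\<lambda>X. G (Fo X))
      (\<lambda>X Y f. Ga (Fo X) (Fo Y) (Fa X Y f)) \<eta>"
    unfolding natural_iso_def is_iso_def
  proof (intro conjI ballI)
    fix X assume X: "X \<in> Obj C"
    have "Comp C X (G (Fo X)) X (\<eta>' X) (\<eta> X) = Ident C X"
      by (rule inj[of X X]) (use X in \<open>simp_all add: Ccomp G Fobj Cid \<eta> Fcomp ei Fid\<close>)
    moreover have "Comp C (G (Fo X)) X (G (Fo X)) (\<eta> X) (\<eta>' X) = Ident C (G (Fo X))"
      by (rule inj[of "G (Fo X)" "G (Fo X)"])
        (use X in \<open>simp_all add: Ccomp G Fobj Cid \<eta> Fcomp ie Fid\<close>)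
    ultimately show "\<exists>g\<in>Arr C (G (Fo X)) X. Comp C X (G (Fo X)) X g (\<eta> X) = Ident C X \<and>
        Comp C (G (Fo X)) X (G (Fo X)) (\<eta> X) g = Ident C (G (Fo X))"
      using \<eta>(3)[OF X] by blast
  next
    fix X Y f assume a: "X \<in> Obj C" "Y \<in> Obj C" "f \<in> Arr C X Y"
    show "Comp C X Y (G (Fo Y)) (\<eta> Y) f =
        Comp C X (G (Fo X)) (G (Fo Y)) (Ga (Fo X) (Fo Y) (Fa X Y f)) (\<eta> X)"
      by (rule inj[of X "G (Fo Y)"])
        (use a in \<open>simp_all add: Ccomp G Fobj Farr \<eta> Fcomp Ga FGa Dassoc Dcomp e i ei Did1 ei'\<close>)
  qed (simp_all add: \<eta>)
  moreover have "natural_iso D D (\<lambda>Z. Fo (G Z)) (\<lambda>Z W h. Fa (G Z) (G W) (Ga Z W h)) (\<lambda>Z. Z) (\<lambda>Z W h. h) e"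
    unfolding natural_iso_def is_iso_def
  proof (intro conjI ballI)
    fix Z assume Z: "Z \<in> Obj D"
    show "\<exists>g\<in>Arr D Z (Fo (G Z)). Comp D (Fo (G Z)) Z (Fo (G Z)) g (e Z) = Ident D (Fo (G Z)) \<and>
        Comp D Z (Fo (G Z)) Z (e Z) g = Ident D Z"
      using i[OF Z] ie[OF Z] ei[OF Z] by blast
  qed (simp_all add: e FGa ei' G Fobj Dcomp)
  ultimately show ?thesis
    unfolding equivalent_categories_def using C D F GF
    by (intro conjI exI[of _ Fo] exI[of _ Fa] exI[of _ G] exI[of _ Ga] exI[of _ \<eta>] exI[of _ e])
qed

section \<open>Separation in function spaces\<close>

text \<open>Characters are points of the product space \<open>'a \<Rightarrow> complex\<close>. The
  class \<open>t2_space\<close> is used there for the Hausdorff property of the spectrum and by the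
  locale \<open>function_ring_on\<close> of the Stone-Weierstrass theorem. Two functions are
  separated at a coordinate where they differ.\<close>

instance "fun" :: (type, t0_space) t0_space
proof
  fix x y :: "'a \<Rightarrow> 'b" assume "x \<noteq> y"
  then obtain i where i: "x i \<noteq> y i" by (auto simp: fun_eq_iff)
  obtain U where U: "open U" "\<not> (x i \<in> U \<longleftrightarrow> y i \<in> U)"
    using t0_space_class.t0_space[OF i] by blast
  then have "open ((\<lambda>f::'a \<Rightarrow> 'b. f i) -` U)"
    by (simp add: open_vimage)
  then show "\<exists>U. open U \<and> \<not> (x \<in> U \<longleftrightarrow> y \<in> U)"
    using U(2) by (intro exI[of _ "(\<lambda>f. f i) -` U"]) simp
qed

instance "fun" :: (type, t1_space) t1_space
proof
  fix x y :: "'a \<Rightarrow> 'b" assume "x \<noteq> y"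
  then obtain i where i: "x i \<noteq> y i" by (auto simp: fun_eq_iff)
  obtain U where U: "open U" "x i \<in> U" "y i \<notin> U"
    using t1_space_class.t1_space[OF i] by blast
  then have "open ((\<lambda>f::'a \<Rightarrow> 'b. f i) -` U)"
    by (simp add: open_vimage)
  then show "\<exists>U. open U \<and> x \<in> U \<and> y \<notin> U"
    using U(2,3) by (intro exI[of _ "(\<lambda>f. f i) -` U"]) simp
qed

instance "fun" :: (type, t2_space) t2_space
proof
  fix x y :: "'a \<Rightarrow> 'b" assume "x \<noteq> y"
  then obtain i where i: "x i \<noteq> y i" by (auto simp: fun_eq_iff)
  obtain U V where UV: "open U" "open V" "x i \<in> U" "y i \<in> V" "U \<inter> V = {}"
    using hausdorff[OF i] by blast
  then have "open ((\<lambda>f::'a \<Rightarrow> 'b. f i) -` U)" "open ((\<lambda>f::'a \<Rightarrow> 'b. f i) -` V)"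
    by (simp_all add: open_vimage)
  then show "\<exists>U V. open U \<and> open V \<and> x \<in> U \<and> y \<in> V \<and> U \<inter> V = {}"
    using UV by (intro exI[of _ "(\<lambda>f. f i) -` U"] exI[of _ "(\<lambda>f. f i) -` V"]) auto
qed

section \<open>Commutative algebras with involution and their seminorms\<close>

lemma le_of_two_powers_le:
  fixes s t C :: real
  assumes le: "\<And>n. t ^ (2 ^ n) \<le> C * s ^ (2 ^ n)" and s: "0 \<le> s"
  shows "t \<le> s"
proof (rule ccontr)
  assume "\<not> t \<le> s"
  then have ts: "s < t" by simp
  show False
  proof (cases "s = 0")
    case True
    have "t ^ (2 ^ 0) \<le> C * s ^ (2 ^ 0)" by (rule le)
    with True ts show False by simp
  next
    case False
    with s have s: "0 < s" by simp
    have "1 < t / s" using ts s by simp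
    then obtain m where m: "C < (t / s) ^ m" using real_arch_pow by blast
    have "m \<le> 2 ^ m" by (rule less_imp_le[OF less_exp])
    then have "(t / s) ^ m \<le> (t / s) ^ (2 ^ m)"
      using \<open>1 < t / s\<close> by (intro power_increasing) simp_all
    with m have "C < t ^ (2 ^ m) / s ^ (2 ^ m)" by (simp add: power_divide)
    then have "C * s ^ (2 ^ m) < t ^ (2 ^ m)" using s by (simp add: pos_less_divide_eq)
    with le[of m] show False by simp
  qed
qed

text \<open>Building on \<open>cring\<close> makes the ring rules and the \<open>algebra\<close>
  method available for \<open>A\<close>.\<close>

locale star_alg = cring A for A :: "'a star_algebra" (structure) +
  assumes involutive: "involutive_algebra A"

lemma star_algI: "involutive_algebra A \<Longrightarrow> star_alg A"
  by (simp add: star_alg_def star_alg_axioms_def involutive_algebra_def algebra_def)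

context star_alg
begin

lemma algebra: "algebra complex_ring A"
  using involutive by (simp add: involutive_algebra_def)

text \<open>The module axioms are restated with \<open>complex_ring\<close> unfolded, so that
  scalars are plain complex numbers.\<close>

lemma smult_closed [simp, intro]: "x \<in> carrier A \<Longrightarrow> c \<odot> x \<in> carrier A"
  using module.smult_closed[OF algebra.axioms(1)[OF algebra]] by (simp add: complex_ring_def)

lemma smult_add_left: "x \<in> carrier A \<Longrightarrow> (c + d) \<odot> x = c \<odot> x \<oplus> d \<odot> x"
  using module.smult_l_distr[OF algebra.axioms(1)[OF algebra], of c d x]
  by (simp add: complex_ring_def)

lemma smult_add_right:
  "x \<in> carrier A \<Longrightarrow> y \<in> carrier A \<Longrightarrow> c \<odot> (x \<oplus> y) = c \<odot> x \<oplus> c \<odot> y"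
  using module.smult_r_distr[OF algebra.axioms(1)[OF algebra], of c x y]
  by (simp add: complex_ring_def)

lemma smult_smult: "x \<in> carrier A \<Longrightarrow> c \<odot> (d \<odot> x) = (c * d) \<odot> x"
  using module.smult_assoc1[OF algebra.axioms(1)[OF algebra], of c d x]
  by (simp add: complex_ring_def)

lemma smult_1 [simp]: "x \<in> carrier A \<Longrightarrow> 1 \<odot> x = x"
  using module.smult_one[OF algebra.axioms(1)[OF algebra], of x] by (simp add: complex_ring_def)

lemma smult_mult_left:
  "x \<in> carrier A \<Longrightarrow> y \<in> carrier A \<Longrightarrow> (c \<odot> x) \<otimes> y = c \<odot> (x \<otimes> y)"
  using algebra.smult_assoc2[OF algebra, of c x y] by (simp add: complex_ring_def)

lemma smult_mult_right:
  "x \<in> carrier A \<Longrightarrow> y \<in> carrier A \<Longrightarrow> x \<otimes> (c \<odot> y) = c \<odot> (x \<otimes> y)"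
  using smult_mult_left[of y x c] by (simp add: m_comm)

lemma smult_0 [simp]: "x \<in> carrier A \<Longrightarrow> 0 \<odot> x = \<zero>"
  using module.smult_l_null[OF algebra.axioms(1)[OF algebra], of x]
  by (simp add: complex_ring_def)

lemma smult_minus_1: "x \<in> carrier A \<Longrightarrow> \<ominus> x = (-1) \<odot> x"
  using smult_add_left[of x "-1" 1] by (simp add: minus_equality)

lemma smult_diff_left: "x \<in> carrier A \<Longrightarrow> (c - d) \<odot> x = c \<odot> x \<ominus> d \<odot> x"
  using smult_add_left[of x c "-d"] by (simp add: smult_minus_1 smult_smult minus_eq)

lemma star_closed [simp, intro]: "x \<in> carrier A \<Longrightarrow> star A x \<in> carrier A"
  and star_star [simp]: "x \<in> carrier A \<Longrightarrow> star A (star A x) = x"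
  and star_add: "x \<in> carrier A \<Longrightarrow> y \<in> carrier A \<Longrightarrow> star A (x \<oplus> y) = star A x \<oplus> star A y"
  and star_smult: "x \<in> carrier A \<Longrightarrow> star A (c \<odot> x) = cnj c \<odot> star A x"
  using involutive by (simp_all add: involutive_algebra_def)

lemma star_mult: "x \<in> carrier A \<Longrightarrow> y \<in> carrier A \<Longrightarrow> star A (x \<otimes> y) = star A x \<otimes> star A y"
  using involutive by (simp add: involutive_algebra_def m_comm)

lemma star_one [simp]: "star A \<one> = \<one>"
proof -
  have "star A \<one> = star A (star A \<one> \<otimes> \<one>)" by (subst star_mult) simp_all
  also have "\<dots> = \<one>" by simp
  finally show ?thesis .
qed

lemma star_minus:
  "x \<in> carrier A \<Longrightarrow> y \<in> carrier A \<Longrightarrow> star A (x \<ominus> y) = star A x \<ominus> star A y"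
  by (simp add: minus_eq smult_minus_1 star_add star_smult)

lemma star_pow: "x \<in> carrier A \<Longrightarrow> star A (x [^] (n::nat)) = star A x [^] n"
  by (induction n) (simp_all add: star_mult)

text \<open>The second factor is written with the scalar - c, so that both factors are again
  \<open>h\<close> minus a scalar and the factorization can be iterated.\<close>

lemma minus_smult_one_mult:
  assumes "h \<in> carrier A"
  shows "h \<otimes> h \<ominus> (c * c) \<odot> \<one> = (h \<ominus> c \<odot> \<one>) \<otimes> (h \<ominus> (- c) \<odot> \<one>)"
proof -
  have "(c * c) \<odot> \<one> = (c \<odot> \<one>) \<otimes> (c \<odot> \<one>)"
    by (simp add: smult_mult_left smult_smult)
  moreover have "(- c) \<odot> \<one> = \<ominus> (c \<odot> \<one>)"
    by (simp add: smult_minus_1 smult_smult)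
  moreover define k where "k = c \<odot> \<one>"
  moreover have "k \<in> carrier A" by (simp add: k_def)
  then have "h \<otimes> h \<ominus> k \<otimes> k = (h \<ominus> k) \<otimes> (h \<ominus> (\<ominus> k))"
    using assms by algebra
  ultimately show ?thesis by simp
qed

lemma polarization:
  assumes "h \<in> carrier A" "k \<in> carrier A"
  shows "4 \<odot> (h \<otimes> k) = (h \<oplus> k) \<otimes> (h \<oplus> k) \<ominus> (h \<ominus> k) \<otimes> (h \<ominus> k)"
proof -
  have "4 \<odot> (h \<otimes> k) = (h \<otimes> k \<oplus> h \<otimes> k) \<oplus> (h \<otimes> k \<oplus> h \<otimes> k)"
    using smult_add_left[of "h \<otimes> k" 2 2] smult_add_left[of "h \<otimes> k" 1 1] assms by simp
  also have "\<dots> = (h \<oplus> k) \<otimes> (h \<oplus> k) \<ominus> (h \<ominus> k) \<otimes> (h \<ominus> k)"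
    using assms by algebra
  finally show ?thesis .
qed

section \<open>Seminorms, and submultiplicativity of C*-seminorms\<close>

lemma seminorm_nonneg: "seminorm A p \<Longrightarrow> x \<in> carrier A \<Longrightarrow> 0 \<le> p x"
  and seminorm_add: "seminorm A p \<Longrightarrow> x \<in> carrier A \<Longrightarrow> y \<in> carrier A \<Longrightarrow> p (x \<oplus> y) \<le> p x + p y"
  and seminorm_smult: "seminorm A p \<Longrightarrow> x \<in> carrier A \<Longrightarrow> p (c \<odot> x) = cmod c * p x"
  by (simp_all add: seminorm_def)

lemma seminorm_zero: "seminorm A p \<Longrightarrow> p \<zero> = 0"
  using seminorm_smult[of p \<zero> 0] by simp

lemma seminorm_uminus: "seminorm A p \<Longrightarrow> x \<in> carrier A \<Longrightarrow> p (\<ominus> x) = p x"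
  by (simp add: smult_minus_1 seminorm_smult)

lemma seminorm_minus:
  "seminorm A p \<Longrightarrow> x \<in> carrier A \<Longrightarrow> y \<in> carrier A \<Longrightarrow> p (x \<ominus> y) \<le> p x + p y"
  using seminorm_add[of p x "\<ominus> y"] by (simp add: minus_eq seminorm_uminus)

lemma seminorm_minus_commute:
  assumes "seminorm A p" "x \<in> carrier A" "y \<in> carrier A"
  shows "p (x \<ominus> y) = p (y \<ominus> x)"
proof -
  have "x \<ominus> y = \<ominus> (y \<ominus> x)" using assms(2,3) by algebra
  then show ?thesis using assms by (simp add: seminorm_uminus)
qed

lemma seminorm_triangle:
  assumes "seminorm A p" "x \<in> carrier A" "y \<in> carrier A" "z \<in> carrier A"
  shows "p (x \<ominus> z) \<le> p (x \<ominus> y) + p (y \<ominus> z)"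
proof -
  have "x \<ominus> z = (x \<ominus> y) \<oplus> (y \<ominus> z)" using assms(2-) by algebra
  then show ?thesis using assms seminorm_add[of p "x \<ominus> y" "y \<ominus> z"] by simp
qed

lemma seminorm_minus_ge:
  assumes "seminorm A p" "x \<in> carrier A" "y \<in> carrier A"
  shows "p x - p y \<le> p (x \<ominus> y)"
proof -
  have "x = (x \<ominus> y) \<oplus> y" using assms(2-) by algebra
  then show ?thesis using assms seminorm_add[of p "x \<ominus> y" y] by simp
qed

lemma Cstar_seminormD:
  assumes "Cstar_seminorm A p"
  shows "seminorm A p" and "x \<in> carrier A \<Longrightarrow> p (x \<otimes> star A x) = (p x)\<^sup>2"
  using assms by (simp_all add: Cstar_seminorm_def)

lemma Cstar_star:
  assumes p: "Cstar_seminorm A p" and x: "x \<in> carrier A"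
  shows "p (star A x) = p x"
proof -
  have "(p (star A x))\<^sup>2 = (p x)\<^sup>2"
    using Cstar_seminormD(2)[OF p, of x] Cstar_seminormD(2)[OF p, of "star A x"] x
    by (simp add: m_comm)
  then show ?thesis
    using x Cstar_seminormD(1)[OF p] by (simp add: seminorm_nonneg)
qed

lemma Cstar_square:
  "Cstar_seminorm A p \<Longrightarrow> h \<in> carrier A \<Longrightarrow> star A h = h \<Longrightarrow> p (h \<otimes> h) = (p h)\<^sup>2"
  using Cstar_seminormD(2)[of p h] by simp

text \<open>Polarization writes 4 u v as a difference of two hermitian squares, on which the
  C*-identity gives 4 p (u v) \<le> 2 (p u + p v)^2. For equal seminorms of \<open>u\<close> and
  \<open>v\<close> this is the claim, and rescaling makes them nearly equal.\<close>

lemma Cstar_mult_hermitian_2: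
  assumes p: "Cstar_seminorm A p"
    and h: "h \<in> carrier A" "star A h = h" and k: "k \<in> carrier A" "star A k = k"
  shows "p (h \<otimes> k) \<le> 2 * (p h * p k)"
proof -
  note sn = Cstar_seminormD(1)[OF p]
  have key: "4 * p (u \<otimes> v) \<le> 2 * (p u + p v)\<^sup>2"
    if u: "u \<in> carrier A" "star A u = u" and v: "v \<in> carrier A" "star A v = v" for u v
  proof -
    have "4 * p (u \<otimes> v) = p (4 \<odot> (u \<otimes> v))" using u v by (simp add: seminorm_smult[OF sn])
    also have "\<dots> \<le> p ((u \<oplus> v) \<otimes> (u \<oplus> v)) + p ((u \<ominus> v) \<otimes> (u \<ominus> v))"
      using u v by (simp add: polarization seminorm_minus[OF sn])
    also have "\<dots> = (p (u \<oplus> v))\<^sup>2 + (p (u \<ominus> v))\<^sup>2"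
      using u v by (simp add: Cstar_square[OF p] star_add star_minus)
    also have "\<dots> \<le> (p u + p v)\<^sup>2 + (p u + p v)\<^sup>2"
      using u v by (intro add_mono power_mono)
        (auto simp: seminorm_add[OF sn] seminorm_minus[OF sn] seminorm_nonneg[OF sn])
    finally show ?thesis by simp
  qed
  \<comment> \<open>Only the first factor is rescaled; t = p k / p h would be the optimal
    choice.\<close>
  have scaled: "4 * (t * p (h \<otimes> k)) \<le> 2 * (t * p h + p k)\<^sup>2" if "0 < t" for t :: real
    using key[of "complex_of_real t \<odot> h" k] h k that
    by (simp add: star_smult smult_mult_left seminorm_smult[OF sn])
  have nn: "0 \<le> p h" "0 \<le> p k" using h k by (auto simp: seminorm_nonneg[OF sn])
  show ?thesis
  proof (rule field_le_epsilon)
    fix e :: real assume e: "0 < e"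
    \<comment> \<open>The bound 2 (p h + d) (p k + d) exceeds 2 p h p k by 2 d (d + p h + p k),
      which is at most \<open>e\<close> for this \<open>d\<close>. The shift by \<open>d\<close>
      also keeps the ratio of the factors defined if \<open>p h\<close> is 0.\<close>
    define d where "d = min 1 (e / (2 * (1 + p h + p k)))"
    have pos: "0 < 2 * (1 + p h + p k)" using nn by simp
    have d: "0 < d" "d \<le> 1" using e pos by (auto simp: d_def)
    have "d \<le> e / (2 * (1 + p h + p k))" by (simp add: d_def)
    with pos have de: "d * (2 * (1 + p h + p k)) \<le> e" by (simp add: pos_le_divide_eq)
    let ?a = "p h + d" and ?b = "p k + d"
    have ab: "0 < ?a" "0 < ?b" using nn d by auto
    have "4 * (?b / ?a * p (h \<otimes> k)) \<le> 2 * (?b / ?a * p h + p k)\<^sup>2"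
      using ab by (intro scaled) simp
    also have "\<dots> \<le> 2 * (?b + ?b)\<^sup>2"
    proof -
      have "?b / ?a * p h \<le> ?b" using ab nn d by (simp add: field_simps)
      then show ?thesis using ab nn d
        by (intro mult_left_mono power_mono add_mono) auto
    qed
    also have "\<dots> = 4 * (2 * ?b\<^sup>2)" by (simp add: power2_eq_square algebra_simps)
    finally have "?b * p (h \<otimes> k) / ?a \<le> 2 * ?b\<^sup>2" by simp
    then have "?b * p (h \<otimes> k) \<le> ?b * (2 * (?a * ?b))"
      using ab by (simp only: pos_divide_le_eq power2_eq_square ac_simps)
    then have "p (h \<otimes> k) \<le> 2 * (?a * ?b)"
      using ab by (simp only: mult_le_cancel_left_pos)
    also have "\<dots> = 2 * (p h * p k) + d * (2 * (d + p h + p k))" by (simp add: algebra_simps)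
    also have "\<dots> \<le> 2 * (p h * p k) + d * (2 * (1 + p h + p k))"
      using d nn by (intro add_left_mono mult_left_mono) auto
    finally show "p (h \<otimes> k) \<le> 2 * (p h * p k) + e" using de by linarith
  qed
qed

text \<open>The constant \<open>2\<close> is removed by passing to the powers \<open>h\<^sup>m\<close>, \<open>k\<^sup>m\<close> with \<open>m = 2\<^sup>n\<close>.\<close>

lemma Cstar_mult_hermitian:
  assumes p: "Cstar_seminorm A p"
    and hk: "h \<in> carrier A" "star A h = h" "k \<in> carrier A" "star A k = k"
  shows "p (h \<otimes> k) \<le> p h * p k"
proof (rule le_of_two_powers_le)
  note sn = Cstar_seminormD(1)[OF p]
  show "p (h \<otimes> k) ^ (2 ^ n) \<le> 2 * (p h * p k) ^ (2 ^ n)" for n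
    using hk
  proof (induction n arbitrary: h k)
    case 0
    then show ?case using Cstar_mult_hermitian_2[OF p] by simp
  next
    case (Suc n)
    have "(h \<otimes> k) \<otimes> (h \<otimes> k) = (h \<otimes> h) \<otimes> (k \<otimes> k)" using Suc.prems by algebra
    then have "(p (h \<otimes> k))\<^sup>2 = p ((h \<otimes> h) \<otimes> (k \<otimes> k))"
      using Suc.prems Cstar_square[OF p, of "h \<otimes> k"] by (simp add: star_mult)
    then have "p (h \<otimes> k) ^ (2 ^ Suc n) = p ((h \<otimes> h) \<otimes> (k \<otimes> k)) ^ (2 ^ n)"
      by (simp add: power_mult)
    also have "\<dots> \<le> 2 * (p (h \<otimes> h) * p (k \<otimes> k)) ^ (2 ^ n)"
      using Suc.prems by (intro Suc.IH) (auto simp: star_mult)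
    also have "\<dots> = 2 * (p h * p k) ^ (2 ^ Suc n)"
      using Suc.prems by (simp add: Cstar_square[OF p] power_mult power_mult_distrib)
    finally show ?case .
  qed
qed (use assms Cstar_seminormD(1)[OF p] in \<open>simp add: seminorm_nonneg\<close>)

text \<open>The square of p (x y) is p of the product of the hermitian elements x star x and y star
  y, to which the hermitian case applies.\<close>

lemma Cstar_mult:
  assumes p: "Cstar_seminorm A p" and x: "x \<in> carrier A" and y: "y \<in> carrier A"
  shows "p (x \<otimes> y) \<le> p x * p y"
proof -
  note sn = Cstar_seminormD(1)[OF p]
  have "(x \<otimes> y) \<otimes> star A (x \<otimes> y) = (x \<otimes> star A x) \<otimes> (y \<otimes> star A y)"
  proof -
    have "star A x \<in> carrier A" "star A y \<in> carrier A" using x y by auto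
    then have "(x \<otimes> y) \<otimes> (star A x \<otimes> star A y) = (x \<otimes> star A x) \<otimes> (y \<otimes> star A y)"
      using x y by algebra
    then show ?thesis using x y by (simp add: star_mult)
  qed
  then have "(p (x \<otimes> y))\<^sup>2 = p ((x \<otimes> star A x) \<otimes> (y \<otimes> star A y))"
    using Cstar_seminormD(2)[OF p, of "x \<otimes> y"] x y by simp
  also have "\<dots> \<le> p (x \<otimes> star A x) * p (y \<otimes> star A y)"
    using x y by (intro Cstar_mult_hermitian[OF p]) (auto simp: star_mult m_comm)
  also have "\<dots> = (p x * p y)\<^sup>2"
    using x y by (simp add: Cstar_seminormD(2)[OF p] power_mult_distrib)
  finally show ?thesis
    by (rule power2_le_imp_le) (use x y in \<open>simp add: seminorm_nonneg[OF sn]\<close>)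
qed

text \<open>For hermitian \<open>h\<close> and N = 2^n both seminorms of h^N are N-th powers, so the
  constant disappears. Continuity bounds, which come with a constant, thereby become plain
  inequalities.\<close>

lemma Cstar_le_of_bound:
  assumes p: "Cstar_seminorm A p" and q: "Cstar_seminorm A q"
    and le: "\<And>x. x \<in> carrier A \<Longrightarrow> p x \<le> C * q x" and x: "x \<in> carrier A"
  shows "p x \<le> q x"
proof -
  note qn = Cstar_seminormD(1)[OF q]
  have herm: "p h \<le> q h" if h: "h \<in> carrier A" "star A h = h" for h
  proof (rule le_of_two_powers_le)
    show "p h ^ (2 ^ n) \<le> C * q h ^ (2 ^ n)" for n
      using h
    proof (induction n arbitrary: h)
      case 0
      then show ?case using le by simp
    next
      case (Suc n)
      have "p (h \<otimes> h) ^ (2 ^ n) \<le> C * q (h \<otimes> h) ^ (2 ^ n)"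
        using Suc.prems by (intro Suc.IH) (auto simp: star_mult)
      then show ?case
        using Suc.prems by (simp add: Cstar_square[OF p] Cstar_square[OF q] power_mult)
    qed
  qed (use h in \<open>simp add: seminorm_nonneg[OF qn]\<close>)
  have "(p x)\<^sup>2 \<le> (q x)\<^sup>2"
    using herm[of "x \<otimes> star A x"] x
    by (simp add: Cstar_seminormD(2)[OF p] Cstar_seminormD(2)[OF q] star_mult m_comm)
  then show ?thesis
    by (rule power2_le_imp_le) (use x in \<open>simp add: seminorm_nonneg[OF qn]\<close>)
qed

text \<open>For exponents 2^n this is the C*-identity; any other power is a factor of such a power,
  and submultiplicativity squeezes its seminorm to 1.\<close>

lemma Cstar_pow_hermitian:
  assumes q: "Cstar_seminorm A q" and h: "h \<in> carrier A" "star A h = h" "q h = 1"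
  shows "q (h [^] (n::nat)) = 1"
proof -
  have q1: "q (h [^] (2 ^ n :: nat)) = 1" for n
  proof (induction n)
    case (Suc n)
    have "h [^] (2 ^ Suc n :: nat) = h [^] (2 ^ n :: nat) \<otimes> h [^] (2 ^ n :: nat)"
      using h by (simp add: nat_pow_mult mult_2)
    then show ?case using Suc h by (simp add: Cstar_square[OF q] star_pow)
  qed (use h in simp)
  \<comment> \<open>\<open>q \<one>\<close> is equal to its own square, and 0 is excluded because
    \<open>h\<close> is a multiple of \<one>.\<close>
  have "0 \<noteq> (q (\<one> \<otimes> h))" using h by simp
  then have "q \<one> \<noteq> 0" using Cstar_mult[OF q, of \<one> h] h by auto
  moreover have "q \<one> = (q \<one>)\<^sup>2" using Cstar_square[OF q, of \<one>] by simp
  ultimately have one: "q \<one> = 1" by (simp add: power2_eq_square)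
  have le: "q (h [^] (n::nat)) \<le> 1" for n
  proof (induction n)
    case (Suc n)
    then show ?case using Cstar_mult[OF q, of "h [^] n" h] h by simp
  qed (simp add: one)
  have n: "n \<le> 2 ^ n" by (rule less_imp_le[OF less_exp])
  have nn: "0 \<le> q (h [^] n)" using h seminorm_nonneg[OF Cstar_seminormD(1)[OF q]] by simp
  have "1 = q (h [^] n \<otimes> h [^] (2 ^ n - n))"
    using h n by (simp add: nat_pow_mult q1)
  also have "\<dots> \<le> q (h [^] n) * q (h [^] (2 ^ n - n))"
    using h by (intro Cstar_mult[OF q]) auto
  also have "\<dots> \<le> q (h [^] n)"
    using mult_left_mono[OF le[of "2 ^ n - n"] nn] by simp
  finally show ?thesis using le[of n] by simp
qed

end

section \<open>Existence of hermitian characters\<close>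

text \<open>Continuity is left out: characters are produced from a single C*-seminorm, before any
  topology is considered.\<close>

definition hermitian_character :: "'a star_algebra \<Rightarrow> ('a \<Rightarrow> complex) \<Rightarrow> bool" where
  "hermitian_character A \<phi> \<longleftrightarrow> \<phi> \<in> ring_hom A complex_ring \<and>
    (\<forall>c. \<forall>x\<in>carrier A. \<phi> (c \<odot>\<^bsub>A\<^esub> x) = c * \<phi> x) \<and>
    (\<forall>x\<in>carrier A. \<phi> (star A x) = cnj (\<phi> x))"

lemma continuous_hermitian_characters_eq:
  "continuous_hermitian_characters A =
    {\<phi>. hermitian_character A \<phi> \<and> continuous_map (alg_topology A) euclidean \<phi>}"
  by (auto simp: continuous_hermitian_characters_def hermitian_character_def)

context star_alg
begin

lemma hermitian_characterI:
  assumes "\<And>x y. x \<in> carrier A \<Longrightarrow> y \<in> carrier A \<Longrightarrow> \<phi> (x \<otimes> y) = \<phi> x * \<phi> y"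
    and "\<And>x y. x \<in> carrier A \<Longrightarrow> y \<in> carrier A \<Longrightarrow> \<phi> (x \<oplus> y) = \<phi> x + \<phi> y"
    and "\<phi> \<one> = 1"
    and "\<And>c x. x \<in> carrier A \<Longrightarrow> \<phi> (c \<odot> x) = c * \<phi> x"
    and "\<And>x. x \<in> carrier A \<Longrightarrow> \<phi> (star A x) = cnj (\<phi> x)"
  shows "hermitian_character A \<phi>"
  using assms by (simp add: hermitian_character_def ring_hom_def complex_ring_def)

lemma character_mult:
    "hermitian_character A \<phi> \<Longrightarrow> x \<in> carrier A \<Longrightarrow> y \<in> carrier A \<Longrightarrow> \<phi> (x \<otimes> y) = \<phi> x * \<phi> y"
  and character_add:
    "hermitian_character A \<phi> \<Longrightarrow> x \<in> carrier A \<Longrightarrow> y \<in> carrier A \<Longrightarrow> \<phi> (x \<oplus> y) = \<phi> x + \<phi> y"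
  and character_one: "hermitian_character A \<phi> \<Longrightarrow> \<phi> \<one> = 1"
  and character_smult: "hermitian_character A \<phi> \<Longrightarrow> x \<in> carrier A \<Longrightarrow> \<phi> (c \<odot> x) = c * \<phi> x"
  and character_star: "hermitian_character A \<phi> \<Longrightarrow> x \<in> carrier A \<Longrightarrow> \<phi> (star A x) = cnj (\<phi> x)"
  by (simp_all add: hermitian_character_def ring_hom_def complex_ring_def)

lemma character_zero: "hermitian_character A \<phi> \<Longrightarrow> \<phi> \<zero> = 0"
  using character_smult[of \<phi> \<zero> 0] by simp

lemma character_minus:
  "hermitian_character A \<phi> \<Longrightarrow> x \<in> carrier A \<Longrightarrow> y \<in> carrier A \<Longrightarrow> \<phi> (x \<ominus> y) = \<phi> x - \<phi> y"
  by (simp add: minus_eq smult_minus_1 character_add character_smult)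

lemmas character_simps = character_mult character_add character_one character_smult
  character_star character_zero character_minus

lemma Cstar_seminorm_character:
  assumes "hermitian_character A \<phi>"
  shows "Cstar_seminorm A (\<lambda>x. cmod (\<phi> x))"
  using assms
  by (auto simp: Cstar_seminorm_def seminorm_def character_simps norm_triangle_ineq norm_mult
      power2_eq_square)

section \<open>Localized and minimal C*-seminorms\<close>

text \<open>The sequence decreases because q k = 1. In terms of characters its limit is the maximum
  of |\<phi> z| over those \<phi> below \<open>q\<close> with |\<phi> k| = 1, but it is available
  before any character is known to exist.\<close>

lemma localized_seminorm:
  assumes q: "Cstar_seminorm A q" and k: "k \<in> carrier A" "star A k = k" "q k = 1"
  obtains r where "Cstar_seminorm A r" "\<And>z. z \<in> carrier A \<Longrightarrow> r z \<le> q z"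
    "\<And>z. z \<in> carrier A \<Longrightarrow> (\<lambda>n. q (z \<otimes> k [^] (n::nat))) \<longlonglongrightarrow> r z"
proof
  note sn = Cstar_seminormD(1)[OF q]
  define r where "r z = lim (\<lambda>n. q (z \<otimes> k [^] (n::nat)))" for z
  have dec: "decseq (\<lambda>n. q (z \<otimes> k [^] (n::nat)))" if z: "z \<in> carrier A" for z
  proof (rule decseq_SucI)
    fix n
    have "z \<otimes> k [^] Suc n = (z \<otimes> k [^] n) \<otimes> k" using z k by (simp add: m_assoc)
    then show "q (z \<otimes> k [^] Suc n) \<le> q (z \<otimes> k [^] n)"
      using Cstar_mult[OF q, of "z \<otimes> k [^] n" k] z k by simp
  qed
  show lim: "(\<lambda>n. q (z \<otimes> k [^] (n::nat))) \<longlonglongrightarrow> r z" if z: "z \<in> carrier A" for z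
  proof -
    obtain L where "(\<lambda>n. q (z \<otimes> k [^] (n::nat))) \<longlonglongrightarrow> L"
      by (rule decseq_convergent[OF dec[OF z], of 0]) (use z k seminorm_nonneg[OF sn] in auto)
    then show ?thesis unfolding r_def by (metis limI)
  qed
  show "r z \<le> q z" if z: "z \<in> carrier A" for z
    using decseq_ge[OF dec[OF z] lim[OF z], of 0] z by simp
  show "Cstar_seminorm A r"
    unfolding Cstar_seminorm_def seminorm_def
  proof (intro conjI ballI allI)
    fix x assume x: "x \<in> carrier A"
    show "0 \<le> r x"
      by (rule LIMSEQ_le_const[OF lim[OF x]]) (use x k seminorm_nonneg[OF sn] in auto)
    show "r (c \<odot> x) = cmod c * r x" for c
    proof -
      have "(\<lambda>n. q ((c \<odot> x) \<otimes> k [^] (n::nat))) = (\<lambda>n. cmod c * q (x \<otimes> k [^] n))"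
        using x k by (simp add: smult_mult_left seminorm_smult[OF sn])
      then show ?thesis
        using LIMSEQ_unique[OF lim[of "c \<odot> x"]] tendsto_mult_left[OF lim[OF x]] x by simp
    qed
    show "r (x \<oplus> y) \<le> r x + r y" if y: "y \<in> carrier A" for y
    proof (rule LIMSEQ_le[OF lim tendsto_add[OF lim[OF x] lim[OF y]]])
      have "q ((x \<oplus> y) \<otimes> k [^] n) \<le> q (x \<otimes> k [^] n) + q (y \<otimes> k [^] n)" for n :: nat
        using x y k seminorm_add[OF sn, of "x \<otimes> k [^] n" "y \<otimes> k [^] n"] by (simp add: l_distr)
      then show "\<exists>N. \<forall>n::nat\<ge>N. q ((x \<oplus> y) \<otimes> k [^] n) \<le> q (x \<otimes> k [^] n) + q (y \<otimes> k [^] n)"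
        by blast
    qed (use x y in simp)
    show "r (x \<otimes> star A x) = (r x)\<^sup>2"
    proof (rule LIMSEQ_unique)
      show "(\<lambda>n. (q (x \<otimes> k [^] (n::nat)))\<^sup>2) \<longlonglongrightarrow> (r x)\<^sup>2"
        by (intro tendsto_intros lim x)
      \<comment> \<open>Squaring doubles the exponent of \<open>k\<close>, so the squares are the
        even terms of the sequence for x star x.\<close>
      have "(q (x \<otimes> k [^] n))\<^sup>2 = q ((x \<otimes> star A x) \<otimes> k [^] (2 * n))" for n :: nat
      proof -
        have kn: "k [^] (2 * n) = k [^] n \<otimes> k [^] n" using k by (simp add: nat_pow_mult mult_2)
        have "star A x \<in> carrier A" "k [^] n \<in> carrier A" using x k by auto
        then have "(x \<otimes> k [^] n) \<otimes> (star A x \<otimes> k [^] n) = (x \<otimes> star A x) \<otimes> (k [^] n \<otimes> k [^] n)"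
          using x by algebra
        then show ?thesis
          using Cstar_seminormD(2)[OF q, of "x \<otimes> k [^] n"] x k kn by (simp add: star_mult star_pow)
      qed
      moreover have "(\<lambda>n. q ((x \<otimes> star A x) \<otimes> k [^] (2 * n))) \<longlonglongrightarrow> r (x \<otimes> star A x)"
        using LIMSEQ_subseq_LIMSEQ[OF lim[of "x \<otimes> star A x"], of "\<lambda>n. 2 * n"] x
        by (simp add: strict_mono_def o_def)
      ultimately show "(\<lambda>n. (q (x \<otimes> k [^] (n::nat)))\<^sup>2) \<longlonglongrightarrow> r (x \<otimes> star A x)"
        by simp
    qed
  qed
qed

text \<open>This provides the bounds of chains in Zorn's lemma. Comparability enters in the triangle
  inequality: of two members that are nearly minimal at \<open>x\<close> and at \<open>y\<close>,
  the smaller one serves for both.\<close>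

lemma Cstar_seminorm_INF_chain:
  assumes S: "S \<noteq> {}" "\<And>q. q \<in> S \<Longrightarrow> Cstar_seminorm A q"
    and chain: "\<And>q q'. q \<in> S \<Longrightarrow> q' \<in> S \<Longrightarrow>
      (\<forall>x\<in>carrier A. q x \<le> q' x) \<or> (\<forall>x\<in>carrier A. q' x \<le> q x)"
  shows "Cstar_seminorm A (\<lambda>x. INF q\<in>S. q x)"
proof -
  note sn = Cstar_seminormD(1)[OF S(2)]
  have bdd: "bdd_below ((\<lambda>q. q x) ` S)" if "x \<in> carrier A" for x
    by (rule bdd_belowI2[of _ 0]) (use that seminorm_nonneg[OF sn] in auto)
  have below: "(INF q\<in>S. q x) \<le> q x" if "x \<in> carrier A" "q \<in> S" for x q
    using bdd[OF that(1)] that(2) by (rule cINF_lower)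
  have nonneg: "0 \<le> (INF q\<in>S. q x)" if "x \<in> carrier A" for x
    by (rule cINF_greatest[OF S(1)]) (use that seminorm_nonneg[OF sn] in auto)
  have near: "\<exists>q\<in>S. q x < (INF q\<in>S. q x) + e" if "x \<in> carrier A" "0 < e" for x e
    using cINF_less_iff[OF S(1) bdd[OF that(1)], of "(INF q\<in>S. q x) + e"] that(2) by simp
  show ?thesis
    unfolding Cstar_seminorm_def seminorm_def
  proof (intro conjI ballI allI nonneg)
    fix x assume x: "x \<in> carrier A"
    show "(INF q\<in>S. q (c \<odot> x)) = cmod c * (INF q\<in>S. q x)" for c
    proof (rule antisym)
      have "(INF q\<in>S. q (c \<odot> x)) \<le> cmod c * ((INF q\<in>S. q x) + e)" if e: "0 < e" for e
      proof -
        obtain q where q: "q \<in> S" "q x < (INF q\<in>S. q x) + e" using near[OF x e] by blast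
        have "(INF q\<in>S. q (c \<odot> x)) \<le> q (c \<odot> x)" using x q(1) by (intro below) auto
        also have "\<dots> = cmod c * q x" using x q(1) by (simp add: seminorm_smult[OF sn])
        also have "\<dots> \<le> cmod c * ((INF q\<in>S. q x) + e)" using q(2) by (intro mult_left_mono) auto
        finally show ?thesis .
      qed
      then have le: "(INF q\<in>S. q (c \<odot> x)) \<le> cmod c * (INF q\<in>S. q x) + cmod c * e" if "0 < e" for e
        using that by (simp add: distrib_left)
      show "(INF q\<in>S. q (c \<odot> x)) \<le> cmod c * (INF q\<in>S. q x)"
      \<comment> \<open>The error in \<open>le\<close> is a multiple of \<open>cmod c\<close> and
        can be adjusted to any given size unless \<open>c\<close> is 0.\<close>
      proof (cases "c = 0")
        case False
        show ?thesis
        proof (rule field_le_epsilon)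
          fix e :: real assume "0 < e"
          then show "(INF q\<in>S. q (c \<odot> x)) \<le> cmod c * (INF q\<in>S. q x) + e"
            using le[of "e / cmod c"] False by simp
        qed
      qed (use le[of 1] in simp)
      show "cmod c * (INF q\<in>S. q x) \<le> (INF q\<in>S. q (c \<odot> x))"
      proof (rule cINF_greatest[OF S(1)])
        fix q assume "q \<in> S"
        then show "cmod c * (INF q\<in>S. q x) \<le> q (c \<odot> x)"
          using x below[OF x] by (simp add: seminorm_smult[OF sn] mult_left_mono)
      qed
    qed
    show "(INF q\<in>S. q (x \<oplus> y)) \<le> (INF q\<in>S. q x) + (INF q\<in>S. q y)" if y: "y \<in> carrier A" for y
    proof (rule field_le_epsilon)
      fix e :: real assume e: "0 < e"
      obtain q where q: "q \<in> S" "q x < (INF q\<in>S. q x) + e / 2" using near[OF x, of "e / 2"] e by auto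
      obtain q' where q': "q' \<in> S" "q' y < (INF q\<in>S. q y) + e / 2"
        using near[OF y, of "e / 2"] e by auto
      obtain s where s: "s \<in> S" "s x \<le> q x" "s y \<le> q' y"
        using chain[OF q(1) q'(1)] q(1) q'(1) x y by auto
      have "(INF q\<in>S. q (x \<oplus> y)) \<le> s (x \<oplus> y)" using x y s(1) by (intro below) auto
      also have "\<dots> \<le> s x + s y" using x y s(1) by (simp add: seminorm_add[OF sn])
      finally show "(INF q\<in>S. q (x \<oplus> y)) \<le> (INF q\<in>S. q x) + (INF q\<in>S. q y) + e"
        using s q q' by linarith
    qed
    show "(INF q\<in>S. q (x \<otimes> star A x)) = (INF q\<in>S. q x)\<^sup>2"
    proof (rule antisym)
      have le: "sqrt (INF q\<in>S. q (x \<otimes> star A x)) \<le> q x" if q: "q \<in> S" for q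
      proof (rule real_le_lsqrt)
        show "(INF q\<in>S. q (x \<otimes> star A x)) \<le> (q x)\<^sup>2"
          using below[of "x \<otimes> star A x" q] x q by (simp add: Cstar_seminormD(2)[OF S(2)])
      qed (use x q seminorm_nonneg[OF sn] in auto)
      have "sqrt (INF q\<in>S. q (x \<otimes> star A x)) \<le> (INF q\<in>S. q x)"
        by (rule cINF_greatest[OF S(1) le])
      then show "(INF q\<in>S. q (x \<otimes> star A x)) \<le> (INF q\<in>S. q x)\<^sup>2"
        by (rule sqrt_le_D)
      show "(INF q\<in>S. q x)\<^sup>2 \<le> (INF q\<in>S. q (x \<otimes> star A x))"
      proof (rule cINF_greatest[OF S(1)])
        fix q assume q: "q \<in> S"
        then show "(INF q\<in>S. q x)\<^sup>2 \<le> q (x \<otimes> star A x)"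
          using below[OF x q] nonneg[OF x] x
          by (simp add: Cstar_seminormD(2)[OF S(2)] power_mono)
      qed
    qed
  qed
qed

lemma Cstar_seminorm_cong:
  "(\<And>x. x \<in> carrier A \<Longrightarrow> p x = q x) \<Longrightarrow> Cstar_seminorm A p \<longleftrightarrow> Cstar_seminorm A q"
  by (simp add: Cstar_seminorm_def seminorm_def)

lemma ex_minimal_Cstar_seminorm:
  assumes p: "Cstar_seminorm A p" and x: "x \<in> carrier A"
  obtains q where "Cstar_seminorm A q" "\<And>y. y \<in> carrier A \<Longrightarrow> q y \<le> p y" "q x = p x"
    "\<And>r y. Cstar_seminorm A r \<Longrightarrow> (\<And>y. y \<in> carrier A \<Longrightarrow> r y \<le> q y) \<Longrightarrow> r x = q x \<Longrightarrow>
      y \<in> carrier A \<Longrightarrow> r y = q y"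
proof -
  \<comment> \<open>Values off the carrier are fixed to be 0; left free, they could decrease without
    bound. The order \<open>P\<close> below is reversed because Zorn's lemma yields maximal
    elements.\<close>
  define Q where "Q = {q. Cstar_seminorm A q \<and> q x = p x \<and> (\<forall>y\<in>carrier A. q y \<le> p y) \<and>
    (\<forall>y. y \<notin> carrier A \<longrightarrow> q y = 0)}"
  define P where "P q q' \<longleftrightarrow> (\<forall>y. q' y \<le> q y)" for q q' :: "'a \<Rightarrow> real"
  have "\<exists>m\<in>Q. \<forall>q\<in>Q. P m q \<longrightarrow> q = m"
  proof (rule predicate_Zorn)
    show "partial_order_on Q (relation_of P Q)"
    proof (rule partial_order_on_relation_ofI)
      show "P a c" if "P a b" "P b c" for a b c
        using that unfolding P_def by (meson order_trans)
      show "a = b" if "P a b" "P b a" for a b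
        using that unfolding P_def by (intro ext antisym) auto
    qed (simp add: P_def)
  next
    fix S assume "S \<in> Chains (relation_of P Q)"
    then have SQ: "S \<subseteq> Q" and ch: "\<And>q q'. q \<in> S \<Longrightarrow> q' \<in> S \<Longrightarrow> P q q' \<or> P q' q"
      by (auto simp: Chains_def relation_of_def)
    show "\<exists>u\<in>Q. \<forall>q\<in>S. P q u"
    proof (cases "S = {}")
      case True
      \<comment> \<open>The empty chain is bounded by \<open>p\<close> itself, normalized off the
        carrier.\<close>
      have "(\<lambda>y. if y \<in> carrier A then p y else 0) \<in> Q"
        using p x Cstar_seminorm_cong[of p "\<lambda>y. if y \<in> carrier A then p y else 0"]
        by (simp add: Q_def)
      with True show ?thesis by blast
    next
      case False
      have CS: "Cstar_seminorm A q" if "q \<in> S" for q using that SQ by (auto simp: Q_def)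
      have INF: "Cstar_seminorm A (\<lambda>y. INF q\<in>S. q y)"
        by (rule Cstar_seminorm_INF_chain[OF False CS]) (use ch in \<open>auto simp: P_def\<close>)
      have bdd: "bdd_below ((\<lambda>q. q y) ` S)" for y
      proof (rule bdd_belowI2[of _ 0])
        show "0 \<le> q y" if "q \<in> S" for q
          using that SQ seminorm_nonneg[OF Cstar_seminormD(1)[OF CS[OF that]]]
          by (cases "y \<in> carrier A") (auto simp: Q_def)
      qed
      have below: "(INF q\<in>S. q y) \<le> q y" if "q \<in> S" for q y
        using bdd that by (rule cINF_lower)
      obtain q0 where q0: "q0 \<in> S" using False by blast
      have const: "(INF q\<in>S. q y) = c" if "\<And>q. q \<in> S \<Longrightarrow> q y = c" for y c
      proof -
        have "(\<lambda>q. q y) ` S = {c}" using that False by auto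
        then show ?thesis by simp
      qed
      have "(\<lambda>y. INF q\<in>S. q y) \<in> Q"
        unfolding Q_def mem_Collect_eq
      proof (intro conjI ballI allI impI INF const)
        fix y assume "y \<in> carrier A"
        then show "(INF q\<in>S. q y) \<le> p y" using below[OF q0, of y] q0 SQ by (force simp: Q_def)
      qed (use SQ in \<open>auto simp: Q_def\<close>)
      then show ?thesis
        by (rule bexI[rotated]) (use below in \<open>simp add: P_def\<close>)
    qed
  qed
  then obtain m where m: "m \<in> Q" "\<And>q. q \<in> Q \<Longrightarrow> P m q \<Longrightarrow> q = m" by blast
  show thesis
  proof (rule that[of m])
    fix r y assume r: "Cstar_seminorm A r" "\<And>y. y \<in> carrier A \<Longrightarrow> r y \<le> m y" "r x = m x"
      and y: "y \<in> carrier A"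
    define r' where "r' = (\<lambda>y. if y \<in> carrier A then r y else 0)"
    have "r' \<in> Q"
      using r x m(1) Cstar_seminorm_cong[of r r']
      by (auto simp: Q_def r'_def intro: order_trans[OF r(2)])
    moreover have "P m r'" using r m(1) by (auto simp: P_def r'_def Q_def)
    ultimately have "r' = m" by (rule m(2))
    then show "r y = m y" using y by (metis r'_def)
  qed (use m(1) in \<open>auto simp: Q_def\<close>)
qed

text \<open>A minimal \<open>q\<close> agrees with each of its localizations at \<open>k = y y\<^sup>*\<close>, on which
  multiplication by \<open>k\<close> is isometric.\<close>

lemma ex_multiplicative_seminorm:
  assumes p: "Cstar_seminorm A p" and x: "x \<in> carrier A" "p x = 1"
  obtains q where "Cstar_seminorm A q" "\<And>y. y \<in> carrier A \<Longrightarrow> q y \<le> p y" "q x = 1"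
    "\<And>y z. y \<in> carrier A \<Longrightarrow> z \<in> carrier A \<Longrightarrow> q (y \<otimes> z) = q y * q z"
proof -
  obtain q where q: "Cstar_seminorm A q" "\<And>y. y \<in> carrier A \<Longrightarrow> q y \<le> p y" "q x = p x"
    and min: "\<And>r y. Cstar_seminorm A r \<Longrightarrow> (\<And>y. y \<in> carrier A \<Longrightarrow> r y \<le> q y) \<Longrightarrow> r x = q x \<Longrightarrow>
      y \<in> carrier A \<Longrightarrow> r y = q y"
    using ex_minimal_Cstar_seminorm[OF p x(1)] by blast
  note sn = Cstar_seminormD(1)[OF q(1)]
  have qx: "q x = 1" using q(3) x(2) by simp
  \<comment> \<open>The localization \<open>r\<close> at \<open>k\<close> satisfies r (z k) = r z,
    since the factor \<open>k\<close> only shifts the sequence. The premise \<open>lim\<close> says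
    that r (x star x) = 1, hence r x = q x, and minimality gives r = q.\<close>
  have isometric: "q (z \<otimes> k) = q z"
    if k: "k \<in> carrier A" "star A k = k" "q k = 1" and z: "z \<in> carrier A"
      and lim: "(\<lambda>n. q ((x \<otimes> star A x) \<otimes> k [^] (n::nat))) \<longlonglongrightarrow> 1" for k z
  proof -
    obtain r where r: "Cstar_seminorm A r" "\<And>z. z \<in> carrier A \<Longrightarrow> r z \<le> q z"
      and rl: "\<And>z. z \<in> carrier A \<Longrightarrow> (\<lambda>n. q (z \<otimes> k [^] (n::nat))) \<longlonglongrightarrow> r z"
      using localized_seminorm[OF q(1) k] by blast
    have "(r x)\<^sup>2 = 1"
      using LIMSEQ_unique[OF rl lim] x Cstar_seminormD(2)[OF r(1), of x] by simp
    then have "r x = q x"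
      using qx x seminorm_nonneg[OF Cstar_seminormD(1)[OF r(1)], of x]
      by (simp add: power2_eq_1_iff)
    then have rq: "r y = q y" if "y \<in> carrier A" for y
      using min[OF r(1) r(2)] that by blast
    have "(\<lambda>n. q (z \<otimes> k [^] (Suc n))) \<longlonglongrightarrow> r z"
      using LIMSEQ_Suc[OF rl[OF z]] by simp
    moreover have "z \<otimes> k [^] Suc n = (z \<otimes> k) \<otimes> k [^] n" for n
    proof -
      have "k [^] n \<in> carrier A" using k by simp
      then have "z \<otimes> (k [^] n \<otimes> k) = (z \<otimes> k) \<otimes> k [^] n" using z k(1) by algebra
      then show ?thesis by simp
    qed
    ultimately have "(\<lambda>n. q ((z \<otimes> k) \<otimes> k [^] n)) \<longlonglongrightarrow> r z" by simp
    with rl[of "z \<otimes> k"] z k have "r (z \<otimes> k) = r z" by (simp add: LIMSEQ_unique)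
    with rq z k show ?thesis by simp
  qed
  let ?h = "x \<otimes> star A x"
  have h: "?h \<in> carrier A" "star A ?h = ?h" "q ?h = 1"
    using x by (simp_all add: star_mult m_comm Cstar_seminormD(2)[OF q(1)] qx)
  \<comment> \<open>For k = x star x the premise \<open>lim\<close> is a statement about powers of
    one hermitian element. Once this \<open>k\<close> is isometric, \<open>lim\<close> follows for
    every hermitian \<open>k\<close> of seminorm 1.\<close>
  have iso_h: "q (z \<otimes> ?h) = q z" if "z \<in> carrier A" for z
  proof (rule isometric[OF h that])
    have "?h \<otimes> ?h [^] n = ?h [^] Suc n" for n :: nat
      using h(1) by (simp add: m_comm)
    then have "q (?h \<otimes> ?h [^] n) = 1" for n :: nat
      using Cstar_pow_hermitian[OF q(1) h] by presburger
    then show "(\<lambda>n. q (?h \<otimes> ?h [^] (n::nat))) \<longlonglongrightarrow> 1" by simp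
  qed
  have iso: "q (z \<otimes> k) = q z"
    if k: "k \<in> carrier A" "star A k = k" "q k = 1" and z: "z \<in> carrier A" for k z
  proof (rule isometric[OF k z])
    have "q (?h \<otimes> k [^] n) = 1" for n :: nat
      using iso_h[of "k [^] n"] k h(1) Cstar_pow_hermitian[OF q(1) k] by (simp add: m_comm)
    then show "(\<lambda>n. q (?h \<otimes> k [^] (n::nat))) \<longlonglongrightarrow> 1" by simp
  qed
  \<comment> \<open>The C*-identity passes from hermitian \<open>k\<close> to arbitrary
    \<open>y\<close> of seminorm 1 through k = y star y.\<close>
  have norm1: "q (z \<otimes> y) = q z" if y: "y \<in> carrier A" "q y = 1" and z: "z \<in> carrier A" for y z
  proof -
    have "star A y \<in> carrier A" "star A z \<in> carrier A" using y z by auto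
    then have "(z \<otimes> y) \<otimes> (star A z \<otimes> star A y) = (z \<otimes> star A z) \<otimes> (y \<otimes> star A y)"
      using y z by algebra
    then have "(q (z \<otimes> y))\<^sup>2 = q ((z \<otimes> star A z) \<otimes> (y \<otimes> star A y))"
      using Cstar_seminormD(2)[OF q(1), of "z \<otimes> y"] y z by (simp add: star_mult)
    also have "\<dots> = q (z \<otimes> star A z)"
      using y z by (intro iso) (simp_all add: star_mult m_comm Cstar_seminormD(2)[OF q(1)])
    also have "\<dots> = (q z)\<^sup>2" using z by (simp add: Cstar_seminormD(2)[OF q(1)])
    finally show ?thesis using y z by (simp add: seminorm_nonneg[OF sn])
  qed
  have "q (y \<otimes> z) = q y * q z" if y: "y \<in> carrier A" and z: "z \<in> carrier A" for y z
  proof (cases "q z = 0")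
    case True
    then have "q (y \<otimes> z) \<le> 0" using Cstar_mult[OF q(1) y z] by simp
    then show ?thesis using True y z seminorm_nonneg[OF sn, of "y \<otimes> z"] by simp
  next
    case False
    let ?c = "complex_of_real (1 / q z)"
    have pos: "0 < q z" using False seminorm_nonneg[OF sn z] by simp
    have "q (y \<otimes> (?c \<odot> z)) = q y"
      using y z pos by (intro norm1) (simp_all add: seminorm_smult[OF sn] norm_divide)
    then show ?thesis
      using y z pos by (simp add: smult_mult_right seminorm_smult[OF sn] norm_divide field_simps)
  qed
  then show thesis using that[of q] q qx by blast
qed

section \<open>The elementary Gelfand-Mazur theorem\<close>

lemma smult_one_diff:
  assumes "h \<in> carrier A"
  shows "(h \<ominus> c \<odot> \<one>) \<ominus> d \<odot> \<one> = h \<ominus> (c + d) \<odot> \<one>"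
proof -
  define u v where "u = c \<odot> \<one>" and "v = d \<odot> \<one>"
  have "u \<in> carrier A" "v \<in> carrier A" by (simp_all add: u_def v_def)
  then have "(h \<ominus> u) \<ominus> v = h \<ominus> (u \<oplus> v)" using assms by algebra
  then show ?thesis by (simp add: smult_add_left u_def v_def)
qed

text \<open>Ostrowski's argument: if the distance \<open>m\<close> from \<open>h\<close> to the scalars were positive, then
  factoring \<open>h\<^sup>N - c\<^sup>N\<close> for \<open>N = 2\<^sup>n\<close> shows that the scalars at minimal distance from \<open>h\<close> form
  an open set; they also form a closed set, hence all of \<open>\<complex>\<close>.\<close>

lemma multiplicative_seminorm_scalar:
  assumes q: "seminorm A q" and mult: "\<And>y z. y \<in> carrier A \<Longrightarrow> z \<in> carrier A \<Longrightarrow> q (y \<otimes> z) = q y * q z"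
    and one: "q \<one> = 1" and h: "h \<in> carrier A"
  shows "\<exists>c. q (h \<ominus> c \<odot> \<one>) = 0"
proof (rule ccontr)
  assume neg: "\<nexists>c. q (h \<ominus> c \<odot> \<one>) = 0"
  define f where "f c = q (h \<ominus> c \<odot> \<one>)" for c
  have f_diff: "f c \<le> f d + cmod (d - c)" for c d
  proof -
    have "f c = q ((h \<ominus> d \<odot> \<one>) \<ominus> (c - d) \<odot> \<one>)"
      using h by (simp add: f_def smult_one_diff)
    also have "\<dots> \<le> f d + q ((c - d) \<odot> \<one>)"
      unfolding f_def using h by (intro seminorm_minus[OF q]) auto
    finally show ?thesis by (simp add: seminorm_smult[OF q] one norm_minus_commute)
  qed
  have dist_f: "dist (f c) (f d) \<le> dist c d" for c d
    using f_diff[of c d] f_diff[of d c]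
    by (simp add: dist_norm abs_le_iff norm_minus_commute)
  have contf: "continuous_on UNIV f"
    unfolding continuous_on_iff using dist_f by (meson UNIV_I le_less_trans)
  have f_ge: "cmod c - q h \<le> f c" for c
  proof -
    have "cmod c - q h = q (c \<odot> \<one>) - q h" by (simp add: seminorm_smult[OF q] one)
    also have "\<dots> \<le> q (c \<odot> \<one> \<ominus> h)" using h by (intro seminorm_minus_ge[OF q]) auto
    also have "\<dots> = f c" unfolding f_def using h by (simp add: seminorm_minus_commute[OF q])
    finally show ?thesis .
  qed
  have f0: "f 0 = q h" using h by (simp add: f_def minus_eq)
  have qh: "0 \<le> q h" using h by (rule seminorm_nonneg[OF q])
  \<comment> \<open>Outside the disc of radius 2 q h the value \<open>f c\<close> is at least q h =
    f 0, so the minimum over the disc is global.\<close>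
  obtain c0 where c0: "c0 \<in> cball 0 (2 * q h)" "\<And>c. c \<in> cball 0 (2 * q h) \<Longrightarrow> f c0 \<le> f c"
    using continuous_attains_inf[of "cball 0 (2 * q h)" f] qh contf
    by (metis cball_eq_empty compact_cball continuous_on_subset not_le subset_UNIV
        mult_nonneg_nonneg zero_le_numeral)
  define m where "m = f c0"
  have m: "m \<le> f c" for c
  proof (cases "c \<in> cball 0 (2 * q h)")
    case False
    then have "q h \<le> f c" using f_ge[of c] by simp
    moreover have "m \<le> f 0" unfolding m_def using qh by (intro c0(2)) simp
    ultimately show ?thesis using f0 by simp
  qed (use c0 m_def in auto)
  have mpos: "0 < m"
  proof -
    have "0 \<le> m" "m \<noteq> 0"
      using h neg seminorm_nonneg[OF q] by (auto simp: m_def f_def)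
    then show ?thesis by simp
  qed
  have step: "f (c + \<mu>) = m" if c: "f c = m" and \<mu>: "cmod \<mu> < m" for c \<mu>
  proof -
    define g where "g = h \<ominus> c \<odot> \<one>"
    have g: "g \<in> carrier A" using h by (simp add: g_def)
    have gf: "q (g \<ominus> d \<odot> \<one>) = f (c + d)" for d
      using h by (simp add: g_def f_def smult_one_diff)
    \<comment> \<open>\<open>G n\<close> is g^(2^n), formed by repeated squaring because a square
      minus a scalar splits into two factors of the same kind.\<close>
    define G where "G n = ((\<lambda>z. z \<otimes> z) ^^ n) g" for n
    have G0: "G 0 = g" and GS: "G (Suc n) = G n \<otimes> G n" for n by (simp_all add: G_def)
    have Gc [simp]: "G n \<in> carrier A" for n by (induction n) (simp_all add: G0 GS g)
    have qG: "q (G n) = m ^ (2 ^ n)" for n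
    proof (induction n)
      case 0
      then show ?case using c by (simp add: G0 g_def f_def)
    qed (simp add: GS mult power_mult power2_eq_square flip: power_mult_distrib)
    \<comment> \<open>Complex square roots split G n minus a scalar into 2^n factors of the form g
      minus a scalar, each of seminorm at least \<open>m\<close>.\<close>
    have lower: "m ^ (2 ^ n) \<le> q (G n \<ominus> w \<odot> \<one>)" for n w
    proof (induction n arbitrary: w)
      case 0
      then show ?case using m by (simp add: G0 gf)
    next
      case (Suc n)
      have "q (G (Suc n) \<ominus> w \<odot> \<one>) =
          q ((G n \<ominus> csqrt w \<odot> \<one>) \<otimes> (G n \<ominus> (- csqrt w) \<odot> \<one>))"
        using minus_smult_one_mult[of "G n" "csqrt w"]
        by (simp add: GS flip: power2_eq_square)
      also have "\<dots> = q (G n \<ominus> csqrt w \<odot> \<one>) * q (G n \<ominus> (- csqrt w) \<odot> \<one>)"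
        by (simp add: mult)
      also have "\<dots> \<ge> m ^ (2 ^ n) * m ^ (2 ^ n)"
        using mpos by (intro mult_mono Suc.IH) (auto simp: seminorm_nonneg[OF q])
      finally show ?case by (simp add: power_mult power2_eq_square flip: power_mult_distrib)
    qed
    \<comment> \<open>With N = 2^n, the factor g - \<mu> of g^N - \<mu>^N is kept and the other N -
      1 factors are bounded below by \<open>m\<close>. The extra \<open>m\<close> on the right
      avoids the exponent N - 1.\<close>
    have prod: "f (c + \<mu>) * m ^ (2 ^ n) \<le> m * q (G n \<ominus> (\<mu> ^ (2 ^ n)) \<odot> \<one>)" for n
    proof (induction n)
      case 0
      then show ?case by (simp add: G0 gf)
    next
      case (Suc n)
      have "\<mu> ^ (2 ^ Suc n) = \<mu> ^ (2 ^ n) * \<mu> ^ (2 ^ n)"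
        by (simp add: power_mult power2_eq_square flip: power_mult_distrib)
      then have "m * q (G (Suc n) \<ominus> (\<mu> ^ (2 ^ Suc n)) \<odot> \<one>) =
          (m * q (G n \<ominus> (\<mu> ^ (2 ^ n)) \<odot> \<one>)) * q (G n \<ominus> (- (\<mu> ^ (2 ^ n))) \<odot> \<one>)"
        by (simp add: GS minus_smult_one_mult mult)
      also have "\<dots> \<ge> (f (c + \<mu>) * m ^ (2 ^ n)) * m ^ (2 ^ n)"
        using mpos by (intro mult_mono Suc.IH lower) (auto simp: seminorm_nonneg[OF q])
      also have "(f (c + \<mu>) * m ^ (2 ^ n)) * m ^ (2 ^ n) = f (c + \<mu>) * m ^ (2 ^ Suc n)"
        using power_add[of m "2 ^ n" "2 ^ n"] by (simp add: mult_2 [symmetric] mult.assoc)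
      finally show ?case .
    qed
    have "f (c + \<mu>) \<le> m * (1 + (cmod \<mu> / m) ^ n)" for n
    proof -
      have "q (G n \<ominus> (\<mu> ^ (2 ^ n)) \<odot> \<one>) \<le> m ^ (2 ^ n) + cmod \<mu> ^ (2 ^ n)"
        using seminorm_minus[OF q, of "G n" "(\<mu> ^ (2 ^ n)) \<odot> \<one>"]
        by (simp add: qG seminorm_smult[OF q] one norm_power)
      then have "f (c + \<mu>) * m ^ (2 ^ n) \<le> m * (m ^ (2 ^ n) + cmod \<mu> ^ (2 ^ n))"
        using prod[of n] mpos by (meson mult_left_mono order_trans less_imp_le)
      then have "f (c + \<mu>) \<le> m * (1 + (cmod \<mu> / m) ^ (2 ^ n))"
        using mpos by (simp add: power_divide field_simps)
      \<comment> \<open>The exponent is weakened to \<open>n\<close> so that the limit of a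
        geometric sequence applies.\<close>
      also have "(cmod \<mu> / m) ^ (2 ^ n) \<le> (cmod \<mu> / m) ^ n"
        using mpos \<mu> by (intro power_decreasing less_imp_le[OF less_exp]) auto
      finally show ?thesis using mpos by simp
    qed
    moreover have "(\<lambda>n. m * (1 + (cmod \<mu> / m) ^ n)) \<longlonglongrightarrow> m * (1 + 0)"
      using mpos \<mu> by (intro tendsto_intros LIMSEQ_realpow_zero) auto
    ultimately have "f (c + \<mu>) \<le> m"
      by (intro LIMSEQ_le_const[of "\<lambda>n. m * (1 + (cmod \<mu> / m) ^ n)" m]) auto
    then show ?thesis using m[of "c + \<mu>"] by simp
  qed
  let ?S = "{c. f c = m}"
  have "closed ?S" by (rule closed_Collect_eq[OF contf continuous_on_const])
  moreover have "open ?S"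
    unfolding open_contains_ball
  proof
    fix c assume c: "c \<in> ?S"
    have "ball c m \<subseteq> ?S"
    proof
      fix d assume "d \<in> ball c m"
      then show "d \<in> ?S" using step[of c "d - c"] c by (simp add: dist_norm norm_minus_commute)
    qed
    then show "\<exists>e>0. ball c e \<subseteq> ?S" using mpos by blast
  qed
  ultimately have "?S = {} \<or> ?S = UNIV" using clopen[of ?S] by iprover
  moreover have "c0 \<in> ?S" by (simp add: m_def)
  ultimately have all: "f c = m" for c by (metis (mono_tags) UNIV_I empty_iff mem_Collect_eq)
  \<comment> \<open>A constant distance contradicts its growth: at this scalar the lower bound |c| -
    q h equals m + 1.\<close>
  let ?r = "m + q h + 1"
  have "cmod (complex_of_real ?r) - q h \<le> m"
    using f_ge[of "complex_of_real ?r"] unfolding all .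
  moreover have "cmod (complex_of_real ?r) = ?r"
    unfolding norm_of_real using mpos qh by (intro abs_of_nonneg) linarith
  ultimately show False by linarith
qed

section \<open>Characters attaining a C*-seminorm\<close>

text \<open>With respect to a multiplicative \<open>q\<close> every element is a scalar up to a
  \<open>q\<close>-null element, and the character reads off this scalar. The scalar is unique since
  q \<one> = 1, so each law of a character amounts to a difference being
  \<open>q\<close>-null.\<close>

lemma ex_hermitian_character_normalized:
  assumes p: "Cstar_seminorm A p" and x: "x \<in> carrier A" "p x = 1"
  obtains \<phi> where "hermitian_character A \<phi>" "\<And>y. y \<in> carrier A \<Longrightarrow> cmod (\<phi> y) \<le> p y" "cmod (\<phi> x) = 1"
proof -
  obtain q where q: "Cstar_seminorm A q" "\<And>y. y \<in> carrier A \<Longrightarrow> q y \<le> p y" "q x = 1"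
    and mult: "\<And>y z. y \<in> carrier A \<Longrightarrow> z \<in> carrier A \<Longrightarrow> q (y \<otimes> z) = q y * q z"
    using ex_multiplicative_seminorm[OF p x] by blast
  note sn = Cstar_seminormD(1)[OF q(1)]
  have one: "q \<one> = 1" using mult[of x \<one>] x q(3) by simp
  define \<phi> where "\<phi> a = (SOME c. q (a \<ominus> c \<odot> \<one>) = 0)" for a
  have \<phi>: "q (a \<ominus> \<phi> a \<odot> \<one>) = 0" if "a \<in> carrier A" for a
    unfolding \<phi>_def using multiplicative_seminorm_scalar[OF sn mult one that] by (rule someI_ex)
  have eq: "\<phi> a = c" if a: "a \<in> carrier A" and c: "q (a \<ominus> c \<odot> \<one>) \<le> 0" for a c
  proof -
    have "cmod (\<phi> a - c) = q ((\<phi> a - c) \<odot> \<one>)" by (simp add: seminorm_smult[OF sn] one)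
    also have "(\<phi> a - c) \<odot> \<one> = \<phi> a \<odot> \<one> \<ominus> c \<odot> \<one>" by (simp add: smult_diff_left)
    also have "q \<dots> \<le> q (\<phi> a \<odot> \<one> \<ominus> a) + q (a \<ominus> c \<odot> \<one>)"
      using a by (intro seminorm_triangle[OF sn]) auto
    also have "\<dots> \<le> 0"
      using \<phi>[OF a] a c seminorm_minus_commute[OF sn, of "\<phi> a \<odot> \<one>" a] by simp
    finally show ?thesis by simp
  qed
  have norm: "cmod (\<phi> a) = q a" if a: "a \<in> carrier A" for a
  proof -
    have "q a - q (\<phi> a \<odot> \<one>) \<le> q (a \<ominus> \<phi> a \<odot> \<one>)" "q (\<phi> a \<odot> \<one>) - q a \<le> q (\<phi> a \<odot> \<one> \<ominus> a)"
      using a by (auto intro!: seminorm_minus_ge[OF sn])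
    then show ?thesis
      using \<phi>[OF a] a seminorm_minus_commute[OF sn, of "\<phi> a \<odot> \<one>" a]
      by (simp add: seminorm_smult[OF sn] one)
  qed
  have "hermitian_character A \<phi>"
  proof (rule hermitian_characterI)
    fix a b assume a: "a \<in> carrier A" and b: "b \<in> carrier A"
    define u v where "u = \<phi> a \<odot> \<one>" and "v = \<phi> b \<odot> \<one>"
    have uv: "u \<in> carrier A" "v \<in> carrier A" by (simp_all add: u_def v_def)
    have z: "q (a \<ominus> u) = 0" "q (b \<ominus> v) = 0" using \<phi> a b by (simp_all add: u_def v_def)
    show "\<phi> (a \<otimes> b) = \<phi> a * \<phi> b"
    proof (rule eq)
      have "a \<otimes> b \<ominus> u \<otimes> v = (a \<ominus> u) \<otimes> b \<oplus> u \<otimes> (b \<ominus> v)" using a b uv by algebra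
      moreover have "(\<phi> a * \<phi> b) \<odot> \<one> = u \<otimes> v"
        by (simp add: u_def v_def smult_mult_left smult_smult)
      ultimately show "q (a \<otimes> b \<ominus> (\<phi> a * \<phi> b) \<odot> \<one>) \<le> 0"
        using seminorm_add[OF sn, of "(a \<ominus> u) \<otimes> b" "u \<otimes> (b \<ominus> v)"] a b uv z by (simp add: mult)
    qed (use a b in simp)
    show "\<phi> (a \<oplus> b) = \<phi> a + \<phi> b"
    proof (rule eq)
      have "(a \<oplus> b) \<ominus> (u \<oplus> v) = (a \<ominus> u) \<oplus> (b \<ominus> v)" using a b uv by algebra
      then show "q ((a \<oplus> b) \<ominus> (\<phi> a + \<phi> b) \<odot> \<one>) \<le> 0"
        using seminorm_add[OF sn, of "a \<ominus> u" "b \<ominus> v"] a b uv z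
        by (simp add: smult_add_left u_def v_def)
    qed (use a b in simp)
  next
    show "\<phi> \<one> = 1" by (rule eq) (simp_all add: minus_eq r_neg seminorm_zero[OF sn])
  next
    fix c a assume a: "a \<in> carrier A"
    show "\<phi> (c \<odot> a) = c * \<phi> a"
    proof (rule eq)
      have "c \<odot> a \<ominus> (c * \<phi> a) \<odot> \<one> = c \<odot> (a \<ominus> \<phi> a \<odot> \<one>)"
        using a by (simp add: minus_eq smult_minus_1 smult_add_right smult_smult)
      then show "q (c \<odot> a \<ominus> (c * \<phi> a) \<odot> \<one>) \<le> 0"
        using a \<phi>[OF a] by (simp add: seminorm_smult[OF sn])
    qed (use a in simp)
    show "\<phi> (star A a) = cnj (\<phi> a)"
    proof (rule eq)
      have "star A a \<ominus> cnj (\<phi> a) \<odot> \<one> = star A (a \<ominus> \<phi> a \<odot> \<one>)"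
        using a by (simp add: star_minus star_smult)
      then show "q (star A a \<ominus> cnj (\<phi> a) \<odot> \<one>) \<le> 0"
        using a \<phi>[OF a] by (simp add: Cstar_star[OF q(1)])
    qed (use a in simp)
  qed
  then show thesis using that norm q x by metis
qed

lemma ex_hermitian_character:
  assumes p: "Cstar_seminorm A p" and x: "x \<in> carrier A" and px: "p x \<noteq> 0"
  obtains \<phi> where "hermitian_character A \<phi>" "\<And>y. y \<in> carrier A \<Longrightarrow> cmod (\<phi> y) \<le> p y" "cmod (\<phi> x) = p x"
proof -
  note sn = Cstar_seminormD(1)[OF p]
  have pos: "0 < p x" using px seminorm_nonneg[OF sn x] by simp
  define c where "c = complex_of_real (1 / p x)"
  have c: "cmod c = 1 / p x" using pos by (simp add: c_def norm_divide)
  obtain \<phi> where \<phi>: "hermitian_character A \<phi>" "\<And>y. y \<in> carrier A \<Longrightarrow> cmod (\<phi> y) \<le> p y"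
      "cmod (\<phi> (c \<odot> x)) = 1"
    using ex_hermitian_character_normalized[OF p, of "c \<odot> x"] x c pos
    by (auto simp: seminorm_smult[OF sn])
  have "cmod (\<phi> x) = p x" using \<phi>(3) x c pos by (simp add: character_smult[OF \<phi>(1)] norm_mult)
  with that \<phi> show thesis by blast
qed

end

section \<open>Metrizable K*-algebras\<close>

context star_alg
begin

lemma openin_seminorm_ball:
  assumes "finite F" "F \<subseteq> P" "x \<in> carrier A" "0 < e"
  shows "openin (seminorm_topology A P) {y \<in> carrier A. \<forall>q\<in>F. q (y \<ominus> x) < e}"
  using assms(1,2)
proof (induction F rule: finite_induct)
  case empty
  have "openin (seminorm_topology A P) (carrier A)"
    unfolding seminorm_topology_def by (rule topology_generated_by_Basis) simp
  then show ?case by simp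
next
  case (insert q F)
  have "openin (seminorm_topology A P) {y \<in> carrier A. q (y \<ominus> x) < e}"
    unfolding seminorm_topology_def
    by (rule topology_generated_by_Basis) (use insert.prems assms(3,4) in auto)
  moreover have "{y \<in> carrier A. \<forall>q\<in>insert q F. q (y \<ominus> x) < e} =
      {y \<in> carrier A. q (y \<ominus> x) < e} \<inter> {y \<in> carrier A. \<forall>q\<in>F. q (y \<ominus> x) < e}" by auto
  ultimately show ?case using insert by (simp add: openin_Int)
qed

lemma topspace_seminorm_topology: "topspace (seminorm_topology A P) = carrier A"
  by (auto simp: seminorm_topology_def)

text \<open>The definition provides a subbase of balls with arbitrary centres. The triangle
  inequality recentres a ball, and intersecting two neighbourhoods unites their finite sets of
  seminorms.\<close>

lemma openin_seminorm_topology: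
  assumes P: "\<And>q. q \<in> P \<Longrightarrow> seminorm A q"
  shows "openin (seminorm_topology A P) U \<longleftrightarrow> U \<subseteq> carrier A \<and>
    (\<forall>x\<in>U. \<exists>F e. finite F \<and> F \<subseteq> P \<and> 0 < e \<and> {y \<in> carrier A. \<forall>q\<in>F. q (y \<ominus> x) < e} \<subseteq> U)"
    (is "_ \<longleftrightarrow> _ \<and> (\<forall>x\<in>U. ?nbhd x U)")
proof
  assume U: "openin (seminorm_topology A P) U"
  then have "U \<subseteq> carrier A" using openin_subset topspace_seminorm_topology by metis
  moreover
  from U have "generate_topology_on (insert (carrier A)
      {{y \<in> carrier A. p (y \<ominus> x) < e} | p x e. p \<in> P \<and> x \<in> carrier A \<and> 0 < e}) U"
    unfolding seminorm_topology_def by (rule openin_topology_generated_by)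
  \<comment> \<open>The induction does not record that the generated sets lie in the carrier, hence
    the separate premise on \<open>x\<close>.\<close>
  then have "\<forall>x\<in>U. x \<in> carrier A \<longrightarrow> ?nbhd x U"
  proof (induction rule: generate_topology_on.induct)
    case (Int a b)
    show ?case
    proof (intro ballI impI)
      fix x assume x: "x \<in> a \<inter> b" "x \<in> carrier A"
      obtain F e where F: "finite F" "F \<subseteq> P" "0 < e" "{y \<in> carrier A. \<forall>q\<in>F. q (y \<ominus> x) < e} \<subseteq> a"
        using bspec[OF Int.IH(1), of x] x by auto
      obtain G d where G: "finite G" "G \<subseteq> P" "0 < d" "{y \<in> carrier A. \<forall>q\<in>G. q (y \<ominus> x) < d} \<subseteq> b"
        using bspec[OF Int.IH(2), of x] x by auto
      show "?nbhd x (a \<inter> b)"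
        by (rule exI[of _ "F \<union> G"], rule exI[of _ "min e d"]) (use F G in auto)
    qed
  next
    case (UN K)
    then show ?case by (meson Union_iff Union_upper order_trans)
  next
    case (Basis s)
    show ?case
    proof (intro ballI impI)
      fix x assume x: "x \<in> s" "x \<in> carrier A"
      show "?nbhd x s"
      proof (cases "s = carrier A")
        case True
        then show ?thesis by (intro exI[of _ "{}"] exI[of _ 1]) simp
      next
        case False
        then obtain q z e where q: "s = {y \<in> carrier A. q (y \<ominus> z) < e}" "q \<in> P" "z \<in> carrier A" "0 < e"
          using Basis by auto
        have "{y \<in> carrier A. \<forall>q'\<in>{q}. q' (y \<ominus> x) < e - q (x \<ominus> z)} \<subseteq> s"
        proof
          fix y assume y: "y \<in> {y \<in> carrier A. \<forall>q'\<in>{q}. q' (y \<ominus> x) < e - q (x \<ominus> z)}"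
          then have "q (y \<ominus> z) \<le> q (y \<ominus> x) + q (x \<ominus> z)"
            using x q P by (intro seminorm_triangle) auto
          with y q show "y \<in> s" by auto
        qed
        moreover have "0 < e - q (x \<ominus> z)" using x q by simp
        ultimately show ?thesis using q(2)
          by (intro exI[of _ "{q}"] exI[of _ "e - q (x \<ominus> z)"]) simp
      qed
    qed
  qed simp
  ultimately show "U \<subseteq> carrier A \<and> (\<forall>x\<in>U. ?nbhd x U)" by blast
next
  assume U: "U \<subseteq> carrier A \<and> (\<forall>x\<in>U. ?nbhd x U)"
  show "openin (seminorm_topology A P) U"
  proof (subst openin_subopen, intro ballI)
    fix x assume x: "x \<in> U"
    with U have xc: "x \<in> carrier A" by blast
    obtain F e where F: "finite F" "F \<subseteq> P" "0 < e" "{y \<in> carrier A. \<forall>q\<in>F. q (y \<ominus> x) < e} \<subseteq> U"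
      using U x by blast
    have "q (x \<ominus> x) < e" if "q \<in> F" for q
      using subsetD[OF F(2) that] F(3) xc seminorm_zero[OF P, of q] by (simp add: minus_eq r_neg)
    then have "x \<in> {y \<in> carrier A. \<forall>q\<in>F. q (y \<ominus> x) < e}" using xc by blast
    then show "\<exists>T. openin (seminorm_topology A P) T \<and> x \<in> T \<and> T \<subseteq> U"
      using openin_seminorm_ball[OF F(1,2) xc F(3)] F(4) by blast
  qed
qed

lemma Cstar_seminorm_max:
  assumes p: "Cstar_seminorm A p" and q: "Cstar_seminorm A q"
  shows "Cstar_seminorm A (\<lambda>x. max (p x) (q x))"
proof -
  note sp = Cstar_seminormD(1)[OF p] and sq = Cstar_seminormD(1)[OF q]
  have "max (p (x \<oplus> y)) (q (x \<oplus> y)) \<le> max (p x) (q x) + max (p y) (q y)"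
    if "x \<in> carrier A" "y \<in> carrier A" for x y
    using seminorm_add[OF sp that] seminorm_add[OF sq that] by linarith
  moreover have "max ((p x)\<^sup>2) ((q x)\<^sup>2) = (max (p x) (q x))\<^sup>2" if "x \<in> carrier A" for x
    using seminorm_nonneg[OF sp that] seminorm_nonneg[OF sq that]
    by (auto simp: max_def dest: power2_le_imp_le)
  ultimately show ?thesis
    by (auto simp: Cstar_seminorm_def seminorm_def seminorm_smult[OF sp] seminorm_smult[OF sq]
        Cstar_seminormD(2)[OF p] Cstar_seminormD(2)[OF q] seminorm_nonneg[OF sp] max_mult_distrib_left
        le_max_iff_disj)
qed

text \<open>Maxima preserve the C*-identity; running maxima will turn a sequence of seminorms into
  an increasing one.\<close>

lemma Cstar_seminorm_Max:
  "finite I \<Longrightarrow> I \<noteq> {} \<Longrightarrow> (\<And>i. i \<in> I \<Longrightarrow> Cstar_seminorm A (q i)) \<Longrightarrow>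
    Cstar_seminorm A (\<lambda>x. MAX i\<in>I. q i x)"
proof (induction I rule: finite_ne_induct)
  case (insert i I)
  then show ?case using Cstar_seminorm_max[of "q i" "\<lambda>x. MAX i\<in>I. q i x"] by simp
qed simp

lemma Cstar_seminorm_0: "Cstar_seminorm A (\<lambda>_. 0)"
  by (simp add: Cstar_seminorm_def seminorm_def)

end

text \<open>Metrizability in the form used below: one increasing sequence of C*-seminorms whose
  balls form a neighbourhood base at each point.\<close>

locale seq_Kstar_algebra = star_alg +
  fixes p :: "nat \<Rightarrow> 'a \<Rightarrow> real"
  assumes Cstar_p: "Cstar_seminorm A (p n)"
    and p_mono: "x \<in> carrier A \<Longrightarrow> m \<le> n \<Longrightarrow> p m x \<le> p n x"
    and openin_iff: "openin (alg_topology A) U \<longleftrightarrow>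
      U \<subseteq> carrier A \<and> (\<forall>x\<in>U. \<exists>n. \<exists>e>0. {y \<in> carrier A. p n (y \<ominus> x) < e} \<subseteq> U)"
    and Hausdorff: "Hausdorff_space (alg_topology A)"
    and complete: "complete_algebra A"
begin

lemma open_nbhd:
  assumes "openin (alg_topology A) U" "x \<in> U"
  obtains n e where "0 < e" "{y \<in> carrier A. p n (y \<ominus> x) < e} \<subseteq> U"
  using bspec[OF conjunct2[OF iffD1[OF openin_iff assms(1)]] assms(2)] that by (elim exE conjE)

end

text \<open>First countability at \<zero> suffices. Each set of a countable neighbourhood base
  contains a ball of finitely many members of \<open>P\<close>, and the countably many seminorms
  collected in this way generate the topology.\<close>

lemma metrizable_Kstar_algebra:
  assumes K: "Kstar_algebra A" and met: "metrizable_space (alg_topology A)"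
  obtains p where "seq_Kstar_algebra A p"
proof -
  interpret star_alg A using K by (intro star_algI) (simp add: Kstar_algebra_def)
  obtain P where PC: "\<And>q. q \<in> P \<Longrightarrow> Cstar_seminorm A q" and top: "alg_topology A = seminorm_topology A P"
    using K unfolding Kstar_algebra_def by blast
  have P: "seminorm A q" if "q \<in> P" for q using PC[OF that] by (rule Cstar_seminormD(1))
  have op: "openin (alg_topology A) U \<longleftrightarrow> U \<subseteq> carrier A \<and> (\<forall>x\<in>U. \<exists>F e. finite F \<and> F \<subseteq> P \<and>
      0 < e \<and> {y \<in> carrier A. \<forall>q\<in>F. q (y \<ominus>\<^bsub>A\<^esub> x) < e} \<subseteq> U)" for U
    unfolding top using P by (rule openin_seminorm_topology)
  have nbhd: "\<exists>F e. finite F \<and> F \<subseteq> P \<and> 0 < e \<and> {y \<in> carrier A. \<forall>q\<in>F. q (y \<ominus>\<^bsub>A\<^esub> x) < e} \<subseteq> U"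
    if "openin (alg_topology A) U" "x \<in> U" for U x
    using bspec[OF conjunct2[OF iffD1[OF op that(1)]] that(2)] .
  obtain \<B> where \<B>: "countable \<B>" "\<And>V. V \<in> \<B> \<Longrightarrow> openin (alg_topology A) V"
    "\<And>U. openin (alg_topology A) U \<Longrightarrow> \<zero>\<^bsub>A\<^esub> \<in> U \<Longrightarrow> \<exists>V\<in>\<B>. \<zero>\<^bsub>A\<^esub> \<in> V \<and> V \<subseteq> U"
    using metrizable_imp_first_countable[OF met] zero_closed
    unfolding first_countable_def top topspace_seminorm_topology by metis
  define \<B>' where "\<B>' = {V \<in> \<B>. \<zero>\<^bsub>A\<^esub> \<in> V}"
  define nb where "nb V F e \<longleftrightarrow> finite F \<and> F \<subseteq> P \<and> 0 < e \<and>
    {y \<in> carrier A. \<forall>q\<in>F. q (y \<ominus>\<^bsub>A\<^esub> \<zero>\<^bsub>A\<^esub>) < e} \<subseteq> V" for V F and e :: real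
  have "\<forall>V\<in>\<B>'. \<exists>F e. nb V F e"
    unfolding nb_def by (intro ballI nbhd \<B>(2)) (auto simp: \<B>'_def)
  then obtain F e where "\<And>V. V \<in> \<B>' \<Longrightarrow> nb V (F V) (e V)" by metis
  then have F: "\<And>V. V \<in> \<B>' \<Longrightarrow> finite (F V)" "\<And>V. V \<in> \<B>' \<Longrightarrow> F V \<subseteq> P"
    "\<And>V. V \<in> \<B>' \<Longrightarrow> 0 < e V"
    "\<And>V. V \<in> \<B>' \<Longrightarrow> {y \<in> carrier A. \<forall>q\<in>F V. q (y \<ominus>\<^bsub>A\<^esub> \<zero>\<^bsub>A\<^esub>) < e V} \<subseteq> V"
    unfolding nb_def by simp_all
  \<comment> \<open>The zero seminorm makes \<open>Q\<close> non-empty and thus enumerable. It may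
    lie outside \<open>P\<close>, which is why \<open>P\<close> is intersected with further
    down.\<close>
  define Q where "Q = insert (\<lambda>_. 0) (\<Union>V\<in>\<B>'. F V)"
  have "countable \<B>'" using \<B>(1) by (simp add: \<B>'_def)
  then have Q: "countable Q" "Q \<noteq> {}" "Q \<subseteq> insert (\<lambda>_. 0) P"
    using F by (auto simp: Q_def countable_finite)
  define r where "r = from_nat_into Q"
  have r: "range r = Q" using Q unfolding r_def by (intro range_from_nat_into)
  \<comment> \<open>Running maxima of the enumeration are increasing and remain
    C*-seminorms.\<close>
  define p where "p n x = (MAX i\<in>{..n}. r i x)" for n :: nat and x
  have p_less: "p n x < d \<longleftrightarrow> (\<forall>i\<le>n. r i x < d)" for n x d
    unfolding p_def by (subst Max_less_iff) auto
  have open_iff: "openin (alg_topology A) U \<longleftrightarrow>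
      U \<subseteq> carrier A \<and> (\<forall>x\<in>U. \<exists>n. \<exists>e>0. {y \<in> carrier A. p n (y \<ominus>\<^bsub>A\<^esub> x) < e} \<subseteq> U)" for U
  proof
    assume U: "openin (alg_topology A) U"
    then have Uc: "U \<subseteq> carrier A" using openin_subset top topspace_seminorm_topology by metis
    have "\<exists>n. \<exists>e>0. {y \<in> carrier A. p n (y \<ominus>\<^bsub>A\<^esub> x) < e} \<subseteq> U" if x: "x \<in> U" for x
    proof -
      have xc: "x \<in> carrier A" using x Uc by blast
      obtain G d where G: "finite G" "G \<subseteq> P" "0 < d" "{y \<in> carrier A. \<forall>q\<in>G. q (y \<ominus>\<^bsub>A\<^esub> x) < d} \<subseteq> U"
        using nbhd[OF U x] by (elim exE conjE)
      have "\<zero>\<^bsub>A\<^esub> \<in> {y \<in> carrier A. \<forall>q\<in>G. q (y \<ominus>\<^bsub>A\<^esub> \<zero>\<^bsub>A\<^esub>) < d}"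
      proof -
        have "q (\<zero>\<^bsub>A\<^esub> \<ominus>\<^bsub>A\<^esub> \<zero>\<^bsub>A\<^esub>) < d" if "q \<in> G" for q
          using subsetD[OF G(2) that] G(3) seminorm_zero[OF P, of q] by (simp add: minus_eq)
        then show ?thesis by blast
      qed
      \<comment> \<open>The chosen base sits at \<zero>; a point \<open>y\<close> near
        \<open>x\<close> is treated through the difference of \<open>y\<close> and \<open>x\<close>,
        which lies in \<open>V\<close>.\<close>
      then obtain V where V: "V \<in> \<B>" "\<zero>\<^bsub>A\<^esub> \<in> V" "V \<subseteq> {y \<in> carrier A. \<forall>q\<in>G. q (y \<ominus>\<^bsub>A\<^esub> \<zero>\<^bsub>A\<^esub>) < d}"
        using \<B>(3)[OF openin_seminorm_ball[OF G(1,2) zero_closed G(3), folded top]] by blast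
      then have V': "V \<in> \<B>'" by (simp add: \<B>'_def)
      have "F V \<subseteq> range r" using r V' by (auto simp: Q_def)
      then obtain I where I: "finite I" "F V = r ` I"
        using finite_subset_image[OF F(1)[OF V'], of r UNIV] by blast
      obtain n where n: "\<forall>i\<in>I. i \<le> n" using I(1) finite_nat_set_iff_bounded_le[of I] by auto
      have "{y \<in> carrier A. p n (y \<ominus>\<^bsub>A\<^esub> x) < e V} \<subseteq> U"
      proof
        fix y assume "y \<in> {y \<in> carrier A. p n (y \<ominus>\<^bsub>A\<^esub> x) < e V}"
        then have y: "y \<in> carrier A" "\<forall>q\<in>F V. q (y \<ominus>\<^bsub>A\<^esub> x) < e V"
          using n by (auto simp: p_less I(2))
        have z: "(y \<ominus>\<^bsub>A\<^esub> x) \<ominus>\<^bsub>A\<^esub> \<zero>\<^bsub>A\<^esub> = y \<ominus>\<^bsub>A\<^esub> x" using y xc by (simp add: minus_eq)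
        have "y \<ominus>\<^bsub>A\<^esub> x \<in> V"
          by (rule subsetD[OF F(4)[OF V']]) (use y xc z in simp)
        then have "\<forall>q\<in>G. q (y \<ominus>\<^bsub>A\<^esub> x) < d" using subsetD[OF V(3)] z by force
        then show "y \<in> U" by (intro subsetD[OF G(4)]) (use y(1) in simp)
      qed
      then show ?thesis using F(3)[OF V'] by blast
    qed
    with Uc show "U \<subseteq> carrier A \<and> (\<forall>x\<in>U. \<exists>n. \<exists>e>0. {y \<in> carrier A. p n (y \<ominus>\<^bsub>A\<^esub> x) < e} \<subseteq> U)"
      by blast
  next
    assume U: "U \<subseteq> carrier A \<and> (\<forall>x\<in>U. \<exists>n. \<exists>e>0. {y \<in> carrier A. p n (y \<ominus>\<^bsub>A\<^esub> x) < e} \<subseteq> U)"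
    show "openin (alg_topology A) U"
      unfolding op
    proof (intro conjI ballI)
      fix x assume "x \<in> U"
      then obtain n d where nd: "0 < d" "{y \<in> carrier A. p n (y \<ominus>\<^bsub>A\<^esub> x) < d} \<subseteq> U" using U by blast
      have "{y \<in> carrier A. \<forall>q\<in>r ` {..n} \<inter> P. q (y \<ominus>\<^bsub>A\<^esub> x) < d} \<subseteq> {y \<in> carrier A. p n (y \<ominus>\<^bsub>A\<^esub> x) < d}"
      proof
        fix y assume y: "y \<in> {y \<in> carrier A. \<forall>q\<in>r ` {..n} \<inter> P. q (y \<ominus>\<^bsub>A\<^esub> x) < d}"
        have "r i (y \<ominus>\<^bsub>A\<^esub> x) < d" if "i \<le> n" for i
        proof (cases "r i \<in> P")
          case False
          then have "r i = (\<lambda>_. 0)" using r Q(3) by blast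
          then show ?thesis using nd(1) by simp
        qed (use y that in auto)
        then show "y \<in> {y \<in> carrier A. p n (y \<ominus>\<^bsub>A\<^esub> x) < d}" using y by (simp add: p_less)
      qed
      with nd show "\<exists>F e. finite F \<and> F \<subseteq> P \<and> 0 < e \<and> {y \<in> carrier A. \<forall>q\<in>F. q (y \<ominus>\<^bsub>A\<^esub> x) < e} \<subseteq> U"
        by (intro exI[of _ "r ` {..n} \<inter> P"] exI[of _ d]) auto
    qed (use U in blast)
  qed
  have "seq_Kstar_algebra A p"
  proof
    have "r i \<in> insert (\<lambda>_. 0) P" for i
      using r Q(3) by (metis rangeI subsetD)
    then have "Cstar_seminorm A (r i)" for i
      using Cstar_seminorm_0 PC by (metis insertE)
    then show "Cstar_seminorm A (p n)" for n
      unfolding p_def by (intro Cstar_seminorm_Max) auto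
    show "p m x \<le> p n x" if "m \<le> n" for m n x
      unfolding p_def using that by (intro Max_mono) auto
  qed (use K open_iff in \<open>simp_all add: Kstar_algebra_def\<close>)
  then show thesis by (rule that)
qed

section \<open>The space of characters and its compact pieces\<close>

text \<open>The value 0 off the carrier makes each character one definite total function, so that
  the characters form a subspace of the product \<open>'a \<Rightarrow> complex\<close>.\<close>

definition characters :: "'a star_algebra \<Rightarrow> ('a \<Rightarrow> complex) set" where
  "characters A = {\<phi> \<in> continuous_hermitian_characters A. \<forall>x. x \<notin> carrier A \<longrightarrow> \<phi> x = 0}"

text \<open>Continuity is replaced by a bound, which is a closed condition on \<phi>; for q = p n
  the bound implies continuity.\<close>

definition characters_below :: "'a star_algebra \<Rightarrow> ('a \<Rightarrow> real) \<Rightarrow> ('a \<Rightarrow> complex) set" where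
  "characters_below A q = {\<phi>. hermitian_character A \<phi> \<and> (\<forall>x\<in>carrier A. cmod (\<phi> x) \<le> q x) \<and>
    (\<forall>x. x \<notin> carrier A \<longrightarrow> \<phi> x = 0)}"

lemma continuous_on_apply: "continuous_on S (\<lambda>f :: 'a \<Rightarrow> 'b :: topological_space. f x)"
  by (rule continuous_on_subset[OF continuous_on_product_coordinates subset_UNIV])

lemma closed_Collect_ball: "(\<And>x. x \<in> S \<Longrightarrow> closed {f. Q f x}) \<Longrightarrow> closed {f. \<forall>x\<in>S. Q f x}"
  by (subst Collect_ball_eq) (rule closed_INT, simp)

text \<open>As in the Banach-Alaoglu theorem, this is a closed subset of a product of discs, compact
  by Tychonoff's theorem. Nothing is assumed of \<open>q\<close>, hence the absolute value in the
  radius.\<close>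

lemma compact_characters_below: "compact (characters_below A q)"
proof -
  let ?B = "Pi\<^sub>E UNIV (\<lambda>x. cball (0::complex) (\<bar>q x\<bar>))"
  have "compactin (product_topology (\<lambda>_. euclidean) UNIV) ?B"
    by (subst compactin_PiE) simp
  then have B: "compact ?B" by (simp add: euclidean_product_topology)
  have eq: "characters_below A q =
    {\<phi>. (\<forall>x\<in>carrier A. \<forall>y\<in>carrier A. \<phi> (x \<otimes>\<^bsub>A\<^esub> y) = \<phi> x * \<phi> y) \<and>
      (\<forall>x\<in>carrier A. \<forall>y\<in>carrier A. \<phi> (x \<oplus>\<^bsub>A\<^esub> y) = \<phi> x + \<phi> y) \<and> \<phi> \<one>\<^bsub>A\<^esub> = 1 \<and>
      (\<forall>c. \<forall>x\<in>carrier A. \<phi> (c \<odot>\<^bsub>A\<^esub> x) = c * \<phi> x) \<and> (\<forall>x\<in>carrier A. \<phi> (star A x) = cnj (\<phi> x)) \<and>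
      (\<forall>x\<in>carrier A. cmod (\<phi> x) \<le> q x) \<and> (\<forall>x\<in>-carrier A. \<phi> x = 0)}"
    by (auto simp: characters_below_def hermitian_character_def ring_hom_def complex_ring_def)
  have "closed (characters_below A q)"
    unfolding eq
    by (intro closed_Collect_conj closed_Collect_ball closed_Collect_all closed_Collect_eq
        closed_Collect_le continuous_intros continuous_on_apply)
  moreover have "characters_below A q \<subseteq> ?B"
  proof
    fix \<phi> assume \<phi>: "\<phi> \<in> characters_below A q"
    have "cmod (\<phi> x) \<le> \<bar>q x\<bar>" for x
      using \<phi> by (cases "x \<in> carrier A") (auto simp: characters_below_def intro: order_trans)
    then show "\<phi> \<in> ?B" by (simp add: PiE_iff)
  qed
  ultimately show ?thesis using compact_Int_closed[OF B, of "characters_below A q"] by (simp add: Int_absorb1)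
qed

context seq_Kstar_algebra
begin

lemmas seminorm_p = Cstar_seminormD(1)[OF Cstar_p]

lemma topspace_alg: "topspace (alg_topology A) = carrier A"
proof -
  have "openin (alg_topology A) (carrier A)"
    unfolding openin_iff by (auto intro: exI[of _ 1])
  then show ?thesis
    using openin_iff[of "topspace (alg_topology A)"] openin_subset by blast
qed

text \<open>A neighbourhood on which \<open>q\<close> is below 1 contains a ball of some
  \<open>p n\<close>; scaling gives a bound with a constant, which \<open>Cstar_le_of_bound\<close>
  removes. The neighbourhood is a premise so that continuous seminorms and moduli of continuous
  characters are covered alike.\<close>

lemma Cstar_bounded:
  assumes q: "Cstar_seminorm A q" and U: "openin (alg_topology A) U" "\<zero> \<in> U"
    and qU: "\<And>x. x \<in> U \<Longrightarrow> q x < 1"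
  obtains n where "\<And>x. x \<in> carrier A \<Longrightarrow> q x \<le> p n x"
proof -
  obtain n e where e: "0 < e" "{y \<in> carrier A. p n (y \<ominus> \<zero>) < e} \<subseteq> U"
    using open_nbhd[OF U] .
  have "q x \<le> 1 / e * p n x" if x: "x \<in> carrier A" for x
  proof -
    \<comment> \<open>An arbitrary \<open>s\<close> above \<open>p n x\<close> replaces it, since
      \<open>p n x\<close> may be 0 and could not be divided by.\<close>
    have *: "q x \<le> s / e" if s: "p n x < s" for s
    proof -
      have spos: "0 < s" using s seminorm_nonneg[OF seminorm_p x, of n] by linarith
      let ?y = "complex_of_real (e / s) \<odot> x"
      have "p n ?y < e"
        using x s spos e(1) by (simp add: seminorm_smult[OF seminorm_p] norm_divide field_simps)
      then have "?y \<in> U" using e(2) x by (auto simp: minus_eq)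
      then have "q ?y < 1" by (rule qU)
      then show ?thesis
        using x spos e(1) by (simp add: seminorm_smult[OF Cstar_seminormD(1)[OF q]] norm_divide field_simps)
    qed
    show ?thesis
    proof (rule field_le_epsilon)
      fix d :: real assume "0 < d"
      then have "q x \<le> (p n x + d * e) / e" using e(1) by (intro *) simp
      then show "q x \<le> 1 / e * p n x + d" using e(1) by (simp add: add_divide_distrib)
    qed
  qed
  then have "q x \<le> p n x" if "x \<in> carrier A" for x
    using Cstar_le_of_bound[OF q Cstar_p] that by blast
  then show thesis by (rule that)
qed

lemma continuous_seminorm_bounded:
  assumes q: "Cstar_seminorm A q" and cont: "continuous_map (alg_topology A) euclidean q"
  obtains n where "\<And>x. x \<in> carrier A \<Longrightarrow> q x \<le> p n x"
proof (rule Cstar_bounded[OF q])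
  show "openin (alg_topology A) {x \<in> topspace (alg_topology A). q x \<in> {..<1}}"
    using cont by (rule openin_continuous_map_preimage) simp
qed (auto simp: topspace_alg seminorm_zero[OF Cstar_seminormD(1)[OF q]])

lemma continuous_character_iff:
  assumes \<phi>: "hermitian_character A \<phi>"
  shows "continuous_map (alg_topology A) euclidean \<phi> \<longleftrightarrow> (\<exists>n. \<forall>x\<in>carrier A. cmod (\<phi> x) \<le> p n x)"
proof
  assume cont: "continuous_map (alg_topology A) euclidean \<phi>"
  show "\<exists>n. \<forall>x\<in>carrier A. cmod (\<phi> x) \<le> p n x"
  proof (rule Cstar_bounded[OF Cstar_seminorm_character[OF \<phi>]])
    show "openin (alg_topology A) {x \<in> topspace (alg_topology A). \<phi> x \<in> ball 0 1}"
      using cont by (rule openin_continuous_map_preimage) simp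
  qed (auto simp: topspace_alg character_zero[OF \<phi>])
next
  assume "\<exists>n. \<forall>x\<in>carrier A. cmod (\<phi> x) \<le> p n x"
  then obtain n where n: "\<And>x. x \<in> carrier A \<Longrightarrow> cmod (\<phi> x) \<le> p n x" by blast
  show "continuous_map (alg_topology A) euclidean \<phi>"
    unfolding continuous_map_def openin_iff topspace_alg
  proof (intro conjI allI impI ballI)
    fix V and x assume V: "openin euclidean V" and x: "x \<in> {x \<in> carrier A. \<phi> x \<in> V}"
    then have "open V" "\<phi> x \<in> V" by auto
    then obtain e where e: "0 < e" "ball (\<phi> x) e \<subseteq> V" by (rule openE)
    have "{y \<in> carrier A. p n (y \<ominus> x) < e} \<subseteq> {x \<in> carrier A. \<phi> x \<in> V}"
    proof
      fix y assume y: "y \<in> {y \<in> carrier A. p n (y \<ominus> x) < e}"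
      then have "cmod (\<phi> y - \<phi> x) < e"
        using n[of "y \<ominus> x"] x by (simp add: character_minus[OF \<phi>])
      then have "\<phi> y \<in> ball (\<phi> x) e" by (simp add: dist_norm norm_minus_commute)
      with e y show "y \<in> {x \<in> carrier A. \<phi> x \<in> V}" by auto
    qed
    with e(1) show "\<exists>n. \<exists>e>0. {y \<in> carrier A. p n (y \<ominus> x) < e} \<subseteq> {x \<in> carrier A. \<phi> x \<in> V}" by blast
  qed auto
qed

text \<open>Together with \<open>compact_characters_below\<close> this is the source of
  sigma-compactness of the spectrum.\<close>

lemma characters_eq: "characters A = (\<Union>n. characters_below A (p n))"
  by (rule Set.set_eqI) (simp add: characters_def continuous_hermitian_characters_eq
      characters_below_def continuous_character_iff cong: conj_cong)

lemma characters_hermitian: "\<phi> \<in> characters A \<Longrightarrow> hermitian_character A \<phi>"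
  by (simp add: characters_def continuous_hermitian_characters_eq)

lemma characters_below_mono: "m \<le> n \<Longrightarrow> characters_below A (p m) \<subseteq> characters_below A (p n)"
  unfolding characters_below_def using p_mono by (auto intro: order_trans)

lemma ex_character:
  assumes q: "Cstar_seminorm A q" and x: "x \<in> carrier A" and qx: "q x \<noteq> 0"
  obtains \<phi> where "\<phi> \<in> characters_below A q" "cmod (\<phi> x) = q x"
proof -
  obtain \<phi> where \<phi>: "hermitian_character A \<phi>" "\<And>y. y \<in> carrier A \<Longrightarrow> cmod (\<phi> y) \<le> q y" "cmod (\<phi> x) = q x"
    using ex_hermitian_character[OF q x qx] by blast
  let ?\<psi> = "\<lambda>y. if y \<in> carrier A then \<phi> y else 0"
  have "hermitian_character A ?\<psi>"
    using \<phi>(1) by (intro hermitian_characterI) (simp_all add: character_simps)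
  then have "?\<psi> \<in> characters_below A q" using \<phi>(2) by (simp add: characters_below_def)
  moreover have "cmod (?\<psi> x) = q x" using x \<phi>(3) by simp
  ultimately show thesis by (rule that)
qed

text \<open>A non-zero value of \<open>q\<close> is attained by some character below
  \<open>q\<close>. If \<open>q\<close> vanishes identically there is no such character, hence the
  premise 0 \<le> B.\<close>

lemma seminorm_le_of_characters:
  assumes q: "Cstar_seminorm A q" and x: "x \<in> carrier A"
    and le: "\<And>\<phi>. \<phi> \<in> characters_below A q \<Longrightarrow> cmod (\<phi> x) \<le> B" and B: "0 \<le> B"
  shows "q x \<le> B"
proof (cases "q x = 0")
  case False
  then obtain \<phi> where "\<phi> \<in> characters_below A q" "cmod (\<phi> x) = q x"
    by (rule ex_character[OF q x])
  with le show ?thesis by metis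
qed (use B in simp)

lemma eq_zero_of_p:
  assumes x: "x \<in> carrier A" and 0: "\<And>n. p n x = 0"
  shows "x = \<zero>"
proof (rule ccontr)
  assume "x \<noteq> \<zero>"
  then obtain U V where UV: "openin (alg_topology A) U" "\<zero> \<in> U" "x \<in> V" "disjnt U V"
    using Hausdorff x zero_closed unfolding Hausdorff_space_def topspace_alg by metis
  obtain n e where "0 < e" "{y \<in> carrier A. p n (y \<ominus> \<zero>) < e} \<subseteq> U"
    using open_nbhd[OF UV(1,2)] .
  then have "x \<in> U" using x 0 by (auto simp: minus_eq)
  with UV show False by (auto simp: disjnt_def)
qed

lemma characters_separate:
  assumes a: "a \<in> carrier A" and b: "b \<in> carrier A"
    and eq: "\<And>\<phi>. \<phi> \<in> characters A \<Longrightarrow> \<phi> a = \<phi> b"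
  shows "a = b"
proof -
  have "p n (a \<ominus> b) \<le> 0" for n
  proof (rule seminorm_le_of_characters[OF Cstar_p])
    fix \<phi> assume "\<phi> \<in> characters_below A (p n)"
    then have "\<phi> \<in> characters A" using characters_eq by blast
    then show "cmod (\<phi> (a \<ominus> b)) \<le> 0"
      using a b eq by (simp add: character_minus[OF characters_hermitian])
  qed (use a b in auto)
  then have "p n (a \<ominus> b) = 0" for n
    using seminorm_nonneg[OF seminorm_p, of "a \<ominus> b" n] a b by (simp add: antisym)
  then have "a \<ominus> b = \<zero>" using a b by (intro eq_zero_of_p) auto
  moreover have "a = (a \<ominus> b) \<oplus> b" using a b by algebra
  ultimately show ?thesis using b by simp
qed

text \<open>Completeness is formulated with filters, so the sequence is turned into the image filter
  of \<open>sequentially\<close>. Of its limit only the values under characters are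
  recorded.\<close>

lemma Cauchy_sequence_limit:
  assumes s: "\<And>n. s n \<in> carrier A"
    and Cauchy: "\<And>k e. 0 < e \<Longrightarrow> \<exists>N. \<forall>m\<ge>N. \<forall>n\<ge>N. p k (s m \<ominus> s n) < e"
  shows "\<exists>l\<in>carrier A. \<forall>\<phi>\<in>characters A. (\<lambda>n. \<phi> (s n)) \<longlonglongrightarrow> \<phi> l"
proof -
  let ?F = "filtermap s sequentially"
  have "cauchy_filter_on A ?F"
    unfolding cauchy_filter_on_def
  proof (intro conjI allI impI)
    show "?F \<noteq> bot" by (simp add: filtermap_bot_iff)
    show "eventually (\<lambda>x. x \<in> carrier A) ?F" using s by (simp add: eventually_filtermap)
    fix U assume U: "openin (alg_topology A) U \<and> \<zero> \<in> U"
    obtain k e where e: "0 < e" "{y \<in> carrier A. p k (y \<ominus> \<zero>) < e} \<subseteq> U"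
      using open_nbhd[OF conjunct1[OF U] conjunct2[OF U]] .
    obtain N where N: "\<And>m n. m \<ge> N \<Longrightarrow> n \<ge> N \<Longrightarrow> p k (s m \<ominus> s n) < e"
      using Cauchy[OF e(1)] by blast
    show "\<exists>S\<subseteq>carrier A. eventually (\<lambda>x. x \<in> S) ?F \<and> (\<forall>x\<in>S. \<forall>y\<in>S. x \<ominus> y \<in> U)"
    proof (intro exI[of _ "s ` {N..}"] conjI ballI)
      show "s ` {N..} \<subseteq> carrier A" using s by auto
      show "eventually (\<lambda>x. x \<in> s ` {N..}) ?F"
        unfolding eventually_filtermap eventually_sequentially by auto
      fix x y assume "x \<in> s ` {N..}" "y \<in> s ` {N..}"
      then obtain i j where ij: "x = s i" "y = s j" "i \<ge> N" "j \<ge> N" by auto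
      have "(x \<ominus> y) \<ominus> \<zero> = x \<ominus> y" using s ij by (simp add: minus_eq)
      then have "x \<ominus> y \<in> {y \<in> carrier A. p k (y \<ominus> \<zero>) < e}" using s N ij by simp
      with e(2) show "x \<ominus> y \<in> U" by blast
    qed
  qed
  then obtain l where l: "limitin (alg_topology A) (\<lambda>x. x) l ?F"
    using complete unfolding complete_algebra_def by blast
  have "(\<lambda>n. \<phi> (s n)) \<longlonglongrightarrow> \<phi> l" if "\<phi> \<in> characters A" for \<phi>
  proof -
    have "continuous_map (alg_topology A) euclidean \<phi>"
      using that by (simp add: characters_def continuous_hermitian_characters_eq)
    then have "limitin euclidean (\<phi> \<circ> (\<lambda>x. x)) (\<phi> l) ?F" using l by (rule continuous_map_limit)
    then show ?thesis by (simp add: filterlim_filtermap)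
  qed
  moreover have "l \<in> carrier A" using l by (simp add: limitin_def topspace_alg)
  ultimately show ?thesis by (intro bexI[of _ l] ballI)
qed

section \<open>The Gelfand representation\<close>

text \<open>The real functions that agree on the compact set with some element of \<open>A\<close>
  form a ring, to which the real Stone-Weierstrass theorem applies. Hermitian elements supply such
  functions, because hermitian characters are real on them.\<close>

lemma approximate_real:
  fixes g :: "('a \<Rightarrow> complex) \<Rightarrow> real"
  assumes g: "continuous_on (characters_below A (p n)) g" and e: "0 < e"
  obtains a where "a \<in> carrier A"
    "\<And>\<phi>. \<phi> \<in> characters_below A (p n) \<Longrightarrow> cmod (\<phi> a - of_real (g \<phi>)) < e"
proof -
  let ?K = "characters_below A (p n)"
  define R where "R = {f :: ('a \<Rightarrow> complex) \<Rightarrow> real. continuous_on ?K f \<and>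
    (\<exists>a\<in>carrier A. \<forall>\<phi>\<in>?K. \<phi> a = of_real (f \<phi>))}"
  have herm: "hermitian_character A \<phi>" if "\<phi> \<in> ?K" for \<phi>
    using that by (simp add: characters_below_def)
  have hermitian_in_R: "(\<lambda>\<phi>. Re (\<phi> a)) \<in> R" if a: "a \<in> carrier A" "star A a = a" for a
  proof -
    have "\<phi> a = of_real (Re (\<phi> a))" if "\<phi> \<in> ?K" for \<phi>
    proof -
      have "cnj (\<phi> a) = \<phi> a" using character_star[OF herm[OF that] a(1)] a(2) by simp
      then show ?thesis by (simp add: complex_eq_iff)
    qed
    then show ?thesis
      unfolding R_def using a(1) by (auto intro!: continuous_intros continuous_on_apply)
  qed
  interpret function_ring_on R ?K
  proof
    show "compact ?K" by (rule compact_characters_below)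
    show "continuous_on ?K f" if "f \<in> R" for f using that by (simp add: R_def)
  next
    fix f g assume "f \<in> R" "g \<in> R"
    then obtain a b where ab: "a \<in> carrier A" "b \<in> carrier A" "\<forall>\<phi>\<in>?K. \<phi> a = of_real (f \<phi>)"
      "\<forall>\<phi>\<in>?K. \<phi> b = of_real (g \<phi>)" and c: "continuous_on ?K f" "continuous_on ?K g"
      by (auto simp: R_def)
    show "(\<lambda>x. f x + g x) \<in> R"
      unfolding R_def using ab c herm
      by (auto intro!: continuous_intros bexI[of _ "a \<oplus> b"] simp: character_simps)
    show "(\<lambda>x. f x * g x) \<in> R"
      unfolding R_def using ab c herm
      by (auto intro!: continuous_intros bexI[of _ "a \<otimes> b"] simp: character_simps)
  next
    fix c show "(\<lambda>_. c) \<in> R"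
      unfolding R_def using herm
      by (auto intro!: bexI[of _ "of_real c \<odot> \<one>"] simp: character_simps)
  next
    fix \<phi> \<psi> assume \<phi>\<psi>: "\<phi> \<in> ?K" "\<psi> \<in> ?K" "\<phi> \<noteq> \<psi>"
    then obtain x where x: "\<phi> x \<noteq> \<psi> x" by (auto simp: fun_eq_iff)
    then have xc: "x \<in> carrier A" using \<phi>\<psi> by (auto simp: characters_below_def)
    \<comment> \<open>On these hermitian elements a character takes the values 2 Re and -2 Im of its
      value at \<open>x\<close>, so one of them separates whenever \<open>x\<close> does.\<close>
    let ?u = "x \<oplus> star A x" and ?v = "\<i> \<odot> (x \<ominus> star A x)"
    have u: "?u \<in> carrier A" "star A ?u = ?u" using xc by (simp_all add: star_add a_comm)
    have v: "?v \<in> carrier A" "star A ?v = ?v"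
    proof -
      have "star A x \<ominus> x = \<ominus> (x \<ominus> star A x)" using xc star_closed[OF xc] by algebra
      then show "star A ?v = ?v"
        using xc by (simp add: star_smult star_minus smult_minus_1 smult_smult)
    qed (use xc in simp)
    have "Re (\<phi> ?u) \<noteq> Re (\<psi> ?u) \<or> Re (\<phi> ?v) \<noteq> Re (\<psi> ?v)"
      using x xc \<phi>\<psi> herm by (auto simp: character_simps complex_eq_iff)
    then show "\<exists>f\<in>R. f \<phi> \<noteq> f \<psi>"
      by (elim disjE) (rule bexI[OF _ hermitian_in_R[OF u]] bexI[OF _ hermitian_in_R[OF v]], assumption)+
  qed
  obtain f where f: "f \<in> R" "\<And>\<phi>. \<phi> \<in> ?K \<Longrightarrow> \<bar>g \<phi> - f \<phi>\<bar> < e"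
    using bexE[OF Stone_Weierstrass_basic[OF g e]] by metis
  then obtain a where a: "a \<in> carrier A" "\<forall>\<phi>\<in>?K. \<phi> a = of_real (f \<phi>)"
    unfolding R_def by auto
  have "cmod (\<phi> a - of_real (g \<phi>)) < e" if "\<phi> \<in> ?K" for \<phi>
    using a(2) f(2)[OF that] that norm_of_real[of "f \<phi> - g \<phi>", where 'a = complex]
    by (simp add: abs_minus_commute)
  with a(1) show thesis by (rule that)
qed

lemma approximate_complex:
  fixes g :: "('a \<Rightarrow> complex) \<Rightarrow> complex"
  assumes g: "continuous_on (characters_below A (p n)) g" and e: "0 < e"
  obtains a where "a \<in> carrier A" "\<And>\<phi>. \<phi> \<in> characters_below A (p n) \<Longrightarrow> cmod (\<phi> a - g \<phi>) < e"
proof -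
  let ?K = "characters_below A (p n)"
  obtain a where a: "a \<in> carrier A" "\<And>\<phi>. \<phi> \<in> ?K \<Longrightarrow> cmod (\<phi> a - of_real (Re (g \<phi>))) < e / 2"
    using approximate_real[of n "\<lambda>\<phi>. Re (g \<phi>)" "e / 2"] g e by (auto intro: continuous_intros)
  obtain b where b: "b \<in> carrier A" "\<And>\<phi>. \<phi> \<in> ?K \<Longrightarrow> cmod (\<phi> b - of_real (Im (g \<phi>))) < e / 2"
    using approximate_real[of n "\<lambda>\<phi>. Im (g \<phi>)" "e / 2"] g e by (auto intro: continuous_intros)
  have "cmod (\<phi> (a \<oplus> \<i> \<odot> b) - g \<phi>) < e" if \<phi>: "\<phi> \<in> ?K" for \<phi>
  proof -
    have "\<phi> (a \<oplus> \<i> \<odot> b) - g \<phi> = (\<phi> a - of_real (Re (g \<phi>))) + \<i> * (\<phi> b - of_real (Im (g \<phi>)))"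
      using a(1) b(1) \<phi> complex_eq[of "g \<phi>"]
      by (simp add: characters_below_def character_simps algebra_simps)
    also have "cmod \<dots> \<le> cmod (\<phi> a - of_real (Re (g \<phi>))) + cmod (\<phi> b - of_real (Im (g \<phi>)))"
      using norm_triangle_ineq by (metis mult_1 norm_ii norm_mult)
    finally show ?thesis using a(2)[OF \<phi>] b(2)[OF \<phi>] by linarith
  qed
  then show thesis using a(1) b(1) by (intro that[of "a \<oplus> \<i> \<odot> b"]) auto
qed

text \<open>The n-th approximant is within 1 / (n + 1) of \<open>g\<close> on the n-th compact set.
  Each \<open>p k\<close> is controlled by the characters below it, so approximants that are close
  on \<open>characters_below A (p k)\<close> are close in \<open>p k\<close>. Hence the sequence is
  Cauchy, and its limit represents \<open>g\<close>.\<close>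

theorem Gelfand_surjective:
  fixes g :: "('a \<Rightarrow> complex) \<Rightarrow> complex"
  assumes g: "continuous_on (characters A) g"
  shows "\<exists>a\<in>carrier A. \<forall>\<phi>\<in>characters A. \<phi> a = g \<phi>"
proof -
  have "\<exists>a. a \<in> carrier A \<and> (\<forall>\<phi>\<in>characters_below A (p n). cmod (\<phi> a - g \<phi>) < 1 / Suc n)" for n
  proof (rule approximate_complex[of n g "1 / Suc n"])
    show "continuous_on (characters_below A (p n)) g"
      using g by (rule continuous_on_subset) (auto simp: characters_eq)
  qed auto
  then obtain s where
    "\<forall>n. s n \<in> carrier A \<and> (\<forall>\<phi>\<in>characters_below A (p n). cmod (\<phi> (s n) - g \<phi>) < 1 / Suc n)"
    using choice[of "\<lambda>n a. a \<in> carrier A \<and>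
      (\<forall>\<phi>\<in>characters_below A (p n). cmod (\<phi> a - g \<phi>) < 1 / Suc n)"] by auto
  then have s: "\<And>n. s n \<in> carrier A"
    "\<And>n \<phi>. \<phi> \<in> characters_below A (p n) \<Longrightarrow> cmod (\<phi> (s n) - g \<phi>) < 1 / Suc n"
    by simp_all
  have near: "cmod (\<phi> (s m) - g \<phi>) < 1 / Suc N" if "\<phi> \<in> characters_below A (p k)" "k \<le> m" "N \<le> m" for \<phi> k m N
  proof -
    have "cmod (\<phi> (s m) - g \<phi>) < 1 / Suc m" using that characters_below_mono by (intro s(2)) blast
    also have "\<dots> \<le> 1 / Suc N" using that(3) by (simp add: frac_le)
    finally show ?thesis .
  qed
  have Cauchy: "\<exists>N. \<forall>m\<ge>N. \<forall>n\<ge>N. p k (s m \<ominus> s n) < e" if e: "0 < e" for k e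
  proof -
    obtain N where N: "1 / Suc N < e / 3" using nat_approx_posE[of "e / 3"] e by auto
    have "p k (s m \<ominus> s n) < e" if "m \<ge> max k N" "n \<ge> max k N" for m n
    proof -
      have "p k (s m \<ominus> s n) \<le> 2 * (1 / Suc N)"
      proof (rule seminorm_le_of_characters[OF Cstar_p])
        fix \<phi> assume \<phi>: "\<phi> \<in> characters_below A (p k)"
        have "cmod (\<phi> (s m \<ominus> s n)) = cmod ((\<phi> (s m) - g \<phi>) - (\<phi> (s n) - g \<phi>))"
          using \<phi> s(1) by (simp add: characters_below_def character_simps)
        also have "\<dots> \<le> cmod (\<phi> (s m) - g \<phi>) + cmod (\<phi> (s n) - g \<phi>)" by (rule norm_triangle_ineq4)
        finally show "cmod (\<phi> (s m \<ominus> s n)) \<le> 2 * (1 / Suc N)"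
          using near[OF \<phi>, of m N] near[OF \<phi>, of n N] that by simp
      qed (use s(1) in auto)
      with N e show ?thesis by linarith
    qed
    then show ?thesis by blast
  qed
  obtain l where l: "l \<in> carrier A" "\<And>\<phi>. \<phi> \<in> characters A \<Longrightarrow> (\<lambda>n. \<phi> (s n)) \<longlonglongrightarrow> \<phi> l"
    using Cauchy_sequence_limit[of s, OF s(1) Cauchy] by auto
  have "\<phi> l = g \<phi>" if \<phi>: "\<phi> \<in> characters A" for \<phi>
  proof (rule LIMSEQ_unique[OF l(2)[OF \<phi>]])
    obtain k where k: "\<phi> \<in> characters_below A (p k)" using \<phi> characters_eq by blast
    show "(\<lambda>n. \<phi> (s n)) \<longlonglongrightarrow> g \<phi>"
      unfolding LIMSEQ_iff
    proof (intro allI impI)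
      fix e :: real assume "0 < e"
      then obtain N where N: "1 / Suc N < e" using nat_approx_posE by blast
      have "cmod (\<phi> (s n) - g \<phi>) < e" if "n \<ge> max k N" for n
        using near[OF k, of n N] that N by simp
      then show "\<exists>no. \<forall>n\<ge>no. cmod (\<phi> (s n) - g \<phi>) < e" by blast
    qed
  qed
  with l(1) show ?thesis by (intro bexI[of _ l] ballI)
qed

end

section \<open>Spaces\<close>

text \<open>Transport of a topology along an injection; it will carry the space of characters to the
  set of their kernels.\<close>

lemma homeomorphic_maps_pullback_topology:
  assumes "inj_on f (topspace X)"
  shows "homeomorphic_maps X (pullback_topology (f ` topspace X) (inv_into (topspace X) f) X)
    f (inv_into (topspace X) f)"
proof -
  let ?g = "inv_into (topspace X) f"
  let ?Y = "pullback_topology (f ` topspace X) ?g X"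
  have gf: "?g (f x) = x" if "x \<in> topspace X" for x using assms that by simp
  have topY: "topspace ?Y = f ` topspace X"
    by (auto simp: topspace_pullback_topology gf)
  have "continuous_map X ?Y f"
    unfolding continuous_map_def topY openin_pullback_topology
  proof (intro conjI allI impI)
    fix V assume "\<exists>U. openin X U \<and> V = ?g -` U \<inter> f ` topspace X"
    then obtain U where U: "openin X U" "V = ?g -` U \<inter> f ` topspace X" by blast
    then have "{x \<in> topspace X. f x \<in> V} = U"
      using openin_subset[OF U(1)] by (auto simp: gf dest: inj_onD[OF assms])
    then show "openin X {x \<in> topspace X. f x \<in> V}" using U by simp
  qed auto
  moreover have "continuous_map ?Y X ?g"
    unfolding continuous_map_def topY openin_pullback_topology
  proof (intro conjI allI impI)
    fix U assume "openin X U"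
    then show "\<exists>W. openin X W \<and> {x \<in> f ` topspace X. ?g x \<in> U} = ?g -` W \<inter> f ` topspace X"
      by (intro exI[of _ U]) auto
  qed (auto simp: gf)
  ultimately show ?thesis
    by (auto simp: homeomorphic_maps_def topY gf f_inv_into_f)
qed

lemma Hausdorff_space_t2: "Hausdorff_space (euclidean :: 'a :: t2_space topology)"
  unfolding Hausdorff_space_def disjnt_def using hausdorff[where 'a = 'a] by simp

lemma homeomorphic_sigma_compact_space:
  assumes hom: "homeomorphic_maps X Y f g" and X: "sigma_compact_space X"
  shows "sigma_compact_space Y"
proof -
  obtain \<K> where \<K>: "countable \<K>" "\<And>K. K \<in> \<K> \<Longrightarrow> compactin X K" "topspace X = \<Union>\<K>"
    using X unfolding sigma_compact_space_def by (elim exE conjE) (rule that, simp_all)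
  have cont: "continuous_map X Y f" using hom by (simp add: homeomorphic_maps_def)
  have "f ` topspace X = topspace Y"
    using hom by (metis homeomorphic_imp_surjective_map homeomorphic_maps_map)
  then have "topspace Y = \<Union>((`) f ` \<K>)" using \<K>(3) by (simp add: image_Union)
  then show ?thesis
    unfolding sigma_compact_space_def using \<K> image_compactin[OF _ cont]
    by (intro exI[of _ "(`) f ` \<K>"]) auto
qed

lemma sigma_compact_imp_compact_sequence:
  assumes "sigma_compact_space X"
  shows "\<exists>K :: nat \<Rightarrow> 'a set. (\<forall>n. compactin X (K n)) \<and> topspace X = (\<Union>n. K n)"
proof -
  obtain \<K> where \<K>: "countable \<K>" "\<And>K. K \<in> \<K> \<Longrightarrow> compactin X K" "topspace X = \<Union>\<K>"
    using assms unfolding sigma_compact_space_def by (elim exE conjE) (rule that, simp_all)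
  \<comment> \<open>The added empty set provides something to enumerate even if the family is empty,
    as it may be for the empty space.\<close>
  let ?K = "from_nat_into (insert {} \<K>)"
  have r: "range ?K = insert {} \<K>" using \<K>(1) by (intro range_from_nat_into) auto
  show ?thesis
  proof (intro exI[of _ ?K] conjI allI)
    fix n
    show "compactin X (?K n)"
    proof -
      have "?K n \<in> insert {} \<K>" using r by blast
      then show ?thesis using \<K>(2) by auto
    qed
    show "topspace X = (\<Union>n. ?K n)" using \<K>(3) r by auto
  qed
qed

lemma hemicompact_imp_sigma_compact: "hemicompact_space X \<Longrightarrow> sigma_compact_space X"
  unfolding hemicompact_space_def sigma_compact_space_def by blast

text \<open>Each \<open>K n\<close> lies in an open \<open>U n\<close> inside a compact
  \<open>L n\<close>. Finitely many of the \<open>U n\<close> cover a given compact set, so the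
  finite unions of the \<open>L n\<close> absorb all compact sets.\<close>

lemma sigma_compact_exhaustion:
  assumes X: "Hausdorff_space X" "locally_compact_space X" "sigma_compact_space X"
  shows "\<exists>L :: nat \<Rightarrow> 'a set. (\<forall>n. compactin X (L n)) \<and> (\<forall>m n. m \<le> n \<longrightarrow> L m \<subseteq> L n) \<and>
    topspace X = (\<Union>n. L n) \<and> (\<forall>C. compactin X C \<longrightarrow> (\<exists>n. C \<subseteq> L n))"
proof -
  obtain K :: "nat \<Rightarrow> 'a set" where K: "\<And>n. compactin X (K n)" "topspace X = (\<Union>n. K n)"
    using sigma_compact_imp_compact_sequence[OF X(3)] by auto
  have "\<forall>C. compactin X C \<longrightarrow> (\<exists>U L. openin X U \<and> compactin X L \<and> closedin X L \<and> C \<subseteq> U \<and> U \<subseteq> L)"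
    using X(1,2) locally_compact_space_compact_closed_compact[of X] by simp
  then have "\<forall>n. \<exists>U L. openin X U \<and> compactin X L \<and> closedin X L \<and> K n \<subseteq> U \<and> U \<subseteq> L"
    using K(1) by simp
  then obtain U L where UL: "\<And>n. openin X (U n)" "\<And>n. compactin X (L n)"
    "\<And>n. K n \<subseteq> U n" "\<And>n. U n \<subseteq> L n" by metis
  let ?L = "\<lambda>n. \<Union>i\<le>n. L i"
  have comp: "compactin X (?L n)" for n by (intro compactin_Union) (use UL(2) in auto)
  show ?thesis
  proof (intro exI[of _ ?L] conjI allI impI comp)
    show "?L m \<subseteq> ?L n" if "m \<le> n" for m n using that by force
    show "topspace X = (\<Union>n. ?L n)"
    proof
      show "topspace X \<subseteq> (\<Union>n. ?L n)"
      proof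
        fix x assume "x \<in> topspace X"
        then obtain n where "x \<in> K n" using K(2) by auto
        then have "x \<in> L n" using UL(3,4)[of n] by blast
        then show "x \<in> (\<Union>n. ?L n)" by auto
      qed
      show "(\<Union>n. ?L n) \<subseteq> topspace X" using compactin_subset_topspace[OF comp] by (rule UN_least)
    qed
    fix C assume C: "compactin X C"
    have "C \<subseteq> \<Union>(range U)"
    proof
      fix x assume "x \<in> C"
      then obtain n where "x \<in> K n" using compactin_subset_topspace[OF C] K(2) by auto
      then have "x \<in> U n" using UL(3)[of n] by blast
      then show "x \<in> \<Union>(range U)" by blast
    qed
    moreover have "\<forall>V\<in>range U. openin X V" using UL(1) by auto
    ultimately obtain \<F> where \<F>: "finite \<F>" "\<F> \<subseteq> range U" "C \<subseteq> \<Union>\<F>"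
      using C unfolding compactin_def by meson
    obtain I where I: "finite I" "\<F> = U ` I"
      using finite_subset_image[OF \<F>(1,2)] by metis
    obtain n where n: "\<forall>i\<in>I. i \<le> n" using I(1) finite_nat_set_iff_bounded_le[of I] by auto
    have "C \<subseteq> ?L n"
    proof
      fix x assume "x \<in> C"
      then obtain i where "i \<in> I" "x \<in> U i" using \<F>(3) I(2) by auto
      then show "x \<in> ?L n" using n UL(4)[of i] by auto
    qed
    then show "\<exists>n. C \<subseteq> ?L n" ..
  qed
qed

lemma sigma_compact_imp_hemicompact:
  assumes "Hausdorff_space X" "locally_compact_space X" "sigma_compact_space X"
  shows "hemicompact_space X"
proof -
  obtain L :: "nat \<Rightarrow> 'a set" where L: "\<forall>n. compactin X (L n)" "topspace X = (\<Union>n. L n)"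
    "\<forall>C. compactin X C \<longrightarrow> (\<exists>n. C \<subseteq> L n)"
    using sigma_compact_exhaustion[OF assms] by (elim exE conjE)
  show ?thesis
    unfolding hemicompact_space_def using L by (intro exI[of _ "range L"]) auto
qed

text \<open>The two categories are equal and not merely equivalent, so the duality has to be proved
  only once.\<close>

lemma hemicompact_lc_category_eq:
  fixes \<U> :: "'u set set"
  shows "hemicompact_lc_category \<U> = sigma_compact_lc_category \<U>"
proof -
  have "{X :: 'u set topology. small_space \<U> X \<and> Hausdorff_space X \<and> locally_compact_space X \<and> hemicompact_space X} =
      {X. small_space \<U> X \<and> Hausdorff_space X \<and> locally_compact_space X \<and> sigma_compact_space X}"
    using hemicompact_imp_sigma_compact sigma_compact_imp_hemicompact by blast
  then show ?thesis by (simp add: hemicompact_lc_category_def sigma_compact_lc_category_def)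
qed

section \<open>The spectrum of a metrizable lc*-algebra\<close>

definition character_kernel :: "'a star_algebra \<Rightarrow> ('a \<Rightarrow> complex) \<Rightarrow> 'a set" where
  "character_kernel A \<phi> = {x \<in> carrier A. \<phi> x = 0}"

definition character_of :: "'a star_algebra \<Rightarrow> 'a set \<Rightarrow> 'a \<Rightarrow> complex" where
  "character_of A = inv_into (characters A) (character_kernel A)"

text \<open>A character is determined by its kernel, so that characters of an algebra on \<open>'u\<close> can be
  encoded as elements of \<open>'u set\<close>.\<close>

definition spectrum :: "'a star_algebra \<Rightarrow> 'a set topology" where
  "spectrum A = pullback_topology (character_kernel A ` characters A) (character_of A)
    (top_of_set (characters A))"

text \<open>Subtracting the scalar \<open>\<phi> x\<close> from \<open>x\<close> gives an element of
  the kernel of \<open>\<phi>\<close>; if \<open>\<psi>\<close> vanishes on it too, then \<psi> x =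
  \<phi> x.\<close>

lemma (in star_alg) inj_on_character_kernel: "inj_on (character_kernel A) (characters A)"
proof (rule inj_onI)
  fix \<phi> \<psi> assume \<phi>: "\<phi> \<in> characters A" and \<psi>: "\<psi> \<in> characters A"
    and eq: "character_kernel A \<phi> = character_kernel A \<psi>"
  have h: "hermitian_character A \<phi>" "hermitian_character A \<psi>"
    using \<phi> \<psi> by (simp_all add: characters_def continuous_hermitian_characters_eq)
  show "\<phi> = \<psi>"
  proof
    fix x
    show "\<phi> x = \<psi> x"
    proof (cases "x \<in> carrier A")
      case True
      then have "x \<ominus> \<phi> x \<odot> \<one> \<in> character_kernel A \<phi>"
        by (simp add: character_kernel_def character_simps[OF h(1)])
      then have "x \<ominus> \<phi> x \<odot> \<one> \<in> character_kernel A \<psi>" by (simp add: eq)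
      with True show ?thesis by (simp add: character_kernel_def character_simps[OF h(2)])
    next
      case False
      with \<phi> \<psi> show ?thesis by (simp add: characters_def)
    qed
  qed
qed

lemma (in star_alg) homeomorphic_spectrum:
  "homeomorphic_maps (top_of_set (characters A)) (spectrum A) (character_kernel A) (character_of A)"
  using homeomorphic_maps_pullback_topology[of "character_kernel A" "top_of_set (characters A)"]
    inj_on_character_kernel
  by (simp add: spectrum_def character_of_def)

context star_alg
begin

lemma character_of_kernel:
  "\<phi> \<in> characters A \<Longrightarrow> character_of A (character_kernel A \<phi>) = \<phi>"
  unfolding character_of_def using inj_on_character_kernel by simp

lemma topspace_spectrum: "topspace (spectrum A) = character_kernel A ` characters A"
  using homeomorphic_spectrum
  by (metis homeomorphic_imp_surjective_map homeomorphic_maps_map topspace_euclidean_subtopology)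

lemma character_of_in: "m \<in> topspace (spectrum A) \<Longrightarrow> character_of A m \<in> characters A"
  by (auto simp: topspace_spectrum character_of_kernel)

lemma kernel_character_of:
  "m \<in> topspace (spectrum A) \<Longrightarrow> character_kernel A (character_of A m) = m"
  by (auto simp: topspace_spectrum character_of_kernel)

lemma homeomorphic_space_spectrum: "top_of_set (characters A) homeomorphic_space spectrum A"
  using homeomorphic_spectrum by (auto simp: homeomorphic_space_def)

lemma Hausdorff_spectrum: "Hausdorff_space (spectrum A)"
proof -
  have "Hausdorff_space (top_of_set (characters A))"
    by (rule Hausdorff_space_subtopology[OF Hausdorff_space_t2])
  then show ?thesis using homeomorphic_Hausdorff_space[OF homeomorphic_space_spectrum] by blast
qed

section \<open>A base of the spectrum indexed by the algebra\<close>

text \<open>A single element controls finitely many coordinates: \<open>b\<close> is a sum of terms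
  c star c, where \<open>c\<close> measures the deviation of one coordinate from its value at
  \<open>\<phi>\<close> in units of an admissible radius.\<close>

lemma characters_base_finite:
  assumes J: "finite J" and U: "\<And>i. i \<in> J \<Longrightarrow> open (U i)" and \<phi>: "\<phi> \<in> characters A" "\<And>i. i \<in> J \<Longrightarrow> \<phi> i \<in> U i"
  shows "\<exists>b\<in>carrier A. \<phi> b = 0 \<and> (\<forall>\<psi>\<in>characters A. cmod (\<psi> b) < 1 \<longrightarrow> (\<forall>i\<in>J. \<psi> i \<in> U i))"
  using J U \<phi>(2)
proof (induction J rule: finite_induct)
  case empty
  have "hermitian_character A \<phi>"
    using \<phi> by (simp add: characters_def continuous_hermitian_characters_eq)
  then show ?case by (intro bexI[of _ \<zero>]) (auto simp: character_zero)
next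
  case (insert i J)
  have herm: "hermitian_character A \<psi>" if "\<psi> \<in> characters A" for \<psi>
    using that by (simp add: characters_def continuous_hermitian_characters_eq)
  have off: "\<psi> x = 0" if "\<psi> \<in> characters A" "x \<notin> carrier A" for \<psi> x
    using that by (simp add: characters_def)
  obtain b where b: "b \<in> carrier A" "\<phi> b = 0"
    "\<forall>\<psi>\<in>characters A. cmod (\<psi> b) < 1 \<longrightarrow> (\<forall>j\<in>J. \<psi> j \<in> U j)"
    using insert.IH insert.prems by auto
  have "\<exists>c\<in>carrier A. \<phi> c = 0 \<and> (\<forall>\<psi>\<in>characters A. cmod (\<psi> c) < 1 \<longrightarrow> \<psi> i \<in> U i)"
  proof (cases "i \<in> carrier A")
    case True
    have "open (U i)" "\<phi> i \<in> U i" using insert.prems by auto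
    then obtain e where e: "0 < e" "ball (\<phi> i) e \<subseteq> U i" by (rule openE)
    let ?c = "complex_of_real (1 / e) \<odot> (i \<ominus> \<phi> i \<odot> \<one>)"
    have "\<psi> i \<in> U i" if \<psi>: "\<psi> \<in> characters A" "cmod (\<psi> ?c) < 1" for \<psi>
    proof -
      have "cmod (\<psi> ?c) = cmod (\<psi> i - \<phi> i) / e"
        using True e(1) by (simp add: character_simps[OF herm[OF \<psi>(1)]] norm_mult norm_divide)
      then have "\<psi> i \<in> ball (\<phi> i) e" using \<psi>(2) e(1) by (simp add: dist_norm norm_minus_commute)
      with e(2) show ?thesis by blast
    qed
    then show ?thesis
      using True by (intro bexI[of _ ?c]) (auto simp: character_simps[OF herm[OF \<phi>(1)]])
  next
    case False
    \<comment> \<open>At a coordinate off the carrier all characters are 0, so the condition holds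
      for each \<open>\<psi>\<close> and \<zero> is a suitable witness.\<close>
    then have "\<psi> i \<in> U i" if "\<psi> \<in> characters A" for \<psi>
      using insert.prems(2)[of i] off[OF that False] off[OF \<phi>(1) False] by simp
    then show ?thesis
      by (intro bexI[of _ \<zero>]) (auto simp: character_zero[OF herm[OF \<phi>(1)]])
  qed
  then obtain c where c: "c \<in> carrier A" "\<phi> c = 0" "\<forall>\<psi>\<in>characters A. cmod (\<psi> c) < 1 \<longrightarrow> \<psi> i \<in> U i"
    by (elim bexE conjE)
  \<comment> \<open>Its value at a character is |\<psi> b|^2 + |\<psi> c|^2, so that a value below 1
    bounds both summands.\<close>
  let ?d = "b \<otimes> star A b \<oplus> c \<otimes> star A c"
  have d: "\<psi> ?d = of_real ((cmod (\<psi> b))\<^sup>2 + (cmod (\<psi> c))\<^sup>2)" if "\<psi> \<in> characters A" for \<psi>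
    using b(1) c(1) by (simp add: character_simps[OF herm[OF that]] complex_norm_square del: of_real_power)
  show ?case
  proof (intro bexI[of _ ?d] conjI ballI impI)
    show "\<phi> ?d = 0" using d[OF \<phi>(1)] b(2) c(2) by simp
    fix \<psi> j assume \<psi>: "\<psi> \<in> characters A" "cmod (\<psi> ?d) < 1" and j: "j \<in> insert i J"
    have "(cmod (\<psi> b))\<^sup>2 + (cmod (\<psi> c))\<^sup>2 < 1"
      using \<psi>(2) unfolding d[OF \<psi>(1)] norm_of_real by linarith
    then have "(cmod (\<psi> b))\<^sup>2 < 1" "(cmod (\<psi> c))\<^sup>2 < 1"
      using zero_le_power2[of "cmod (\<psi> b)"] zero_le_power2[of "cmod (\<psi> c)"] by linarith+
    then have "cmod (\<psi> b) < 1" "cmod (\<psi> c) < 1" by (simp_all add: power_less_one_iff abs_square_less_1)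
    then show "\<psi> j \<in> U j" using b(3) c(3) \<psi>(1) j by auto
  qed (use b(1) c(1) in auto)
qed

lemma characters_base:
  assumes W: "open W" and \<phi>: "\<phi> \<in> characters A" "\<phi> \<in> W"
  shows "\<exists>b\<in>carrier A. \<phi> b = 0 \<and> (\<forall>\<psi>\<in>characters A. cmod (\<psi> b) < 1 \<longrightarrow> \<psi> \<in> W)"
proof -
  have "openin (product_topology (\<lambda>_. euclidean) UNIV) W"
    using W by (simp add: euclidean_product_topology)
  then have "\<exists>U. finite {i \<in> UNIV. U i \<noteq> topspace euclidean} \<and> (\<forall>i\<in>UNIV. openin euclidean (U i)) \<and>
      \<phi> \<in> Pi\<^sub>E UNIV U \<and> Pi\<^sub>E UNIV U \<subseteq> W"
    using \<phi>(2) unfolding openin_product_topology_alt by auto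
  then obtain U where U: "finite {i. U i \<noteq> UNIV}" "\<forall>i. open (U i)" "\<phi> \<in> Pi\<^sub>E UNIV U" "Pi\<^sub>E UNIV U \<subseteq> W"
    by auto
  obtain b where b: "b \<in> carrier A" "\<phi> b = 0"
    "\<forall>\<psi>\<in>characters A. cmod (\<psi> b) < 1 \<longrightarrow> (\<forall>i\<in>{i. U i \<noteq> UNIV}. \<psi> i \<in> U i)"
    using characters_base_finite[OF U(1) _ \<phi>(1), of U] U(2,3) by (auto simp: PiE_iff)
  have "\<psi> \<in> W" if "\<psi> \<in> characters A" "cmod (\<psi> b) < 1" for \<psi>
  proof -
    have "\<psi> i \<in> U i" for i using b(3) that by (cases "U i = UNIV") auto
    then show ?thesis using U(4) by (auto simp: PiE_iff)
  qed
  with b(1,2) show ?thesis by blast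
qed

text \<open>Base sets are indexed by elements of the carrier, so the smallness of the algebra bounds
  the base; no bound on the number of characters is involved.\<close>

lemma small_spectrum:
  assumes small: "carrier A \<in> \<U>"
  shows "small_space \<U> (spectrum A)"
proof -
  define V where "V b = character_kernel A ` {\<psi> \<in> characters A. cmod (\<psi> b) < 1}" for b
  have hom: "homeomorphic_map (top_of_set (characters A)) (spectrum A) (character_kernel A)"
    using homeomorphic_spectrum by (auto simp: homeomorphic_maps_map)
  show ?thesis
    unfolding small_space_def
  proof (intro exI[of _ "V ` carrier A"] conjI ballI allI impI)
    show "\<exists>S\<in>\<U>. V ` carrier A \<lesssim> S"
      using small image_lepoll by blast
  next
    fix W assume "W \<in> V ` carrier A"
    then obtain b where b: "W = V b" by blast
    have "open {f :: 'a \<Rightarrow> complex. cmod (f b) < 1}"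
      by (intro open_Collect_less continuous_intros continuous_on_apply)
    then have "openin (top_of_set (characters A)) (characters A \<inter> {\<psi>. cmod (\<psi> b) < 1})"
      by (rule openin_open_Int)
    moreover have "characters A \<inter> {\<psi>. cmod (\<psi> b) < 1} = {\<psi> \<in> characters A. cmod (\<psi> b) < 1}" by auto
    ultimately show "openin (spectrum A) W"
      unfolding b V_def using homeomorphic_map_openness[OF hom] by auto
  next
    fix W m assume "openin (spectrum A) W \<and> m \<in> W"
    then have W: "openin (spectrum A) W" and m: "m \<in> W" by auto
    have mt: "m \<in> topspace (spectrum A)" using openin_subset[OF W] m by blast
    have cont: "continuous_map (top_of_set (characters A)) (spectrum A) (character_kernel A)"
      using hom by (rule homeomorphic_imp_continuous_map)
    obtain O' where O': "open O'" "{\<psi> \<in> characters A. character_kernel A \<psi> \<in> W} = characters A \<inter> O'"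
      using openin_continuous_map_preimage[OF cont W] by (auto simp: openin_open)
    let ?\<phi> = "character_of A m"
    have \<phi>: "?\<phi> \<in> characters A" "character_kernel A ?\<phi> = m"
      using mt by (simp_all add: character_of_in kernel_character_of)
    have \<phi>O: "?\<phi> \<in> O'" using O'(2) m \<phi> by auto
    obtain b where b: "b \<in> carrier A" "?\<phi> b = 0" "\<forall>\<psi>\<in>characters A. cmod (\<psi> b) < 1 \<longrightarrow> \<psi> \<in> O'"
      using characters_base[OF O'(1) \<phi>(1) \<phi>O] by (elim bexE conjE)
    have "m \<in> V b" unfolding V_def using \<phi> b(2) by (intro image_eqI[of _ _ ?\<phi>]) auto
    moreover have "V b \<subseteq> W"
    proof
      fix k assume "k \<in> V b"
      then obtain \<psi> where \<psi>: "\<psi> \<in> characters A" "cmod (\<psi> b) < 1" "k = character_kernel A \<psi>"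
        unfolding V_def by auto
      then have "\<psi> \<in> characters A \<inter> O'" using b(3) by simp
      then show "k \<in> W" unfolding O'(2)[symmetric] \<psi>(3) by simp
    qed
    ultimately show "\<exists>V'\<in>V ` carrier A. m \<in> V' \<and> V' \<subseteq> W" using b(1) by blast
  qed
qed

end

locale seq_lcstar_algebra = seq_Kstar_algebra +
  assumes lcstar: "lcstar_algebra A"

lemma metrizable_lcstar_algebra:
  assumes lc: "lcstar_algebra A" and met: "metrizable_space (alg_topology A)"
  obtains p where "seq_lcstar_algebra A p"
proof -
  have "Kstar_algebra A" using lc by (simp add: lcstar_algebra_def)
  then obtain p where "seq_Kstar_algebra A p" using met by (rule metrizable_Kstar_algebra)
  then have "seq_lcstar_algebra A p"
    using lc by (simp add: seq_lcstar_algebra_def seq_lcstar_algebra_axioms_def)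
  then show thesis by (rule that)
qed

context seq_lcstar_algebra
begin

text \<open>If \<open>a\<close> annihilates the kernel of \<open>q\<close>, then a character \<open>\<psi>\<close> with \<open>\<psi> a \<noteq> 0\<close> is bounded by \<open>q\<close>:
  otherwise \<open>\<bar>\<psi> x\<bar> > q x\<close> for some \<open>x\<close>, and by \<open>Gelfand_surjective\<close> the function
  \<open>max 0 (\<bar>\<phi> x\<bar> - q x)\<close> of \<open>\<phi>\<close> is given by an element of that kernel on which \<open>\<psi>\<close> does not vanish.\<close>

lemma annihilator_support:
  assumes q: "Cstar_seminorm A q" "\<And>x. x \<in> carrier A \<Longrightarrow> q x \<le> p n x"
    and a: "a \<in> carrier A" "\<And>b. b \<in> carrier A \<Longrightarrow> q b = 0 \<Longrightarrow> a \<otimes> b = \<zero>"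
    and \<psi>: "\<psi> \<in> characters A" "\<psi> a \<noteq> 0"
  shows "\<psi> \<in> characters_below A (p n)"
proof -
  have "cmod (\<psi> x) \<le> q x" if x: "x \<in> carrier A" for x
  proof (rule ccontr)
    assume gt: "\<not> cmod (\<psi> x) \<le> q x"
    define g where "g \<omega> = complex_of_real (max 0 (cmod (\<omega> x) - q x))" for \<omega> :: "'a \<Rightarrow> complex"
    have cont: "continuous_on (characters A) g"
      unfolding g_def by (intro continuous_intros continuous_on_apply)
    obtain b where b: "b \<in> carrier A" "\<forall>\<phi>\<in>characters A. \<phi> b = g \<phi>"
      using Gelfand_surjective[OF cont] by (elim bexE)
    have "q b \<le> 0"
    proof (rule seminorm_le_of_characters[OF q(1) b(1)])
      fix \<omega> assume \<omega>: "\<omega> \<in> characters_below A q"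
      then have "\<omega> \<in> characters_below A (p n)"
        using q(2) by (auto simp: characters_below_def intro: order_trans)
      then have "\<omega> \<in> characters A" unfolding characters_eq by blast
      then have "\<omega> b = g \<omega>" using b(2) by simp
      also have "\<dots> = 0" using \<omega> x by (simp add: g_def characters_below_def)
      finally show "cmod (\<omega> b) \<le> 0" by simp
    qed simp
    then have "q b = 0" using seminorm_nonneg[OF Cstar_seminormD(1)[OF q(1)] b(1)] by simp
    then have "\<psi> (a \<otimes> b) = 0"
      using a(2)[OF b(1)] character_zero[OF characters_hermitian[OF \<psi>(1)]] by simp
    then have "\<psi> b = 0"
      using \<psi>(2) a(1) b(1) by (simp add: character_mult[OF characters_hermitian[OF \<psi>(1)]])
    moreover have "\<psi> b = g \<psi>" using b(2) \<psi>(1) by simp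
    ultimately show False using gt by (simp add: g_def max_def split: if_splits)
  qed
  then show ?thesis
    using \<psi>(1) q(2) characters_hermitian[OF \<psi>(1)]
    by (auto simp: characters_below_def characters_def intro: order_trans)
qed

text \<open>The lc*-condition at \<open>\<phi>\<close> supplies an \<open>a\<close> whose
  non-vanishing set is an open neighbourhood of \<open>\<phi>\<close> inside a compact set. The
  index \<open>n\<close> comes from the continuity of the seminorm in that condition.\<close>

lemma locally_bounded:
  assumes \<phi>: "\<phi> \<in> characters A"
  obtains a n where "a \<in> carrier A" "\<phi> a \<noteq> 0" "{\<psi> \<in> characters A. \<psi> a \<noteq> 0} \<subseteq> characters_below A (p n)"
proof -
  have "\<phi> \<in> continuous_hermitian_characters A" using \<phi> by (simp add: characters_def)
  then obtain a q where a: "a \<in> carrier A" "Cstar_seminorm A q" "continuous_map (alg_topology A) euclidean q"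
    "\<phi> a = 1" "(\<lambda>x. a \<otimes> x) ` seminorm_kernel A q = {\<zero>}"
    using lcstar unfolding lcstar_algebra_def by metis
  have ann: "a \<otimes> b = \<zero>" if "b \<in> carrier A" "q b = 0" for b
    using a(5) that unfolding seminorm_kernel_def by blast
  obtain n where n: "\<And>x. x \<in> carrier A \<Longrightarrow> q x \<le> p n x"
    using continuous_seminorm_bounded[OF a(2,3)] by metis
  have sub: "{\<psi> \<in> characters A. \<psi> a \<noteq> 0} \<subseteq> characters_below A (p n)"
  proof
    fix \<psi> assume "\<psi> \<in> {\<psi> \<in> characters A. \<psi> a \<noteq> 0}"
    then show "\<psi> \<in> characters_below A (p n)"
      by (intro annihilator_support[OF a(2) n a(1) ann]) simp_all
  qed
  show thesis
    by (rule that[OF a(1) _ sub]) (simp add: a(4))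
qed

lemma open_nonzero: "open {f :: 'a \<Rightarrow> complex. f a \<noteq> 0}"
  by (intro open_Collect_neq continuous_on_apply continuous_intros)

text \<open>The open sets of \<open>locally_bounded\<close> cover \<open>C\<close>; a finite
  subcover and monotonicity in \<open>n\<close> leave one bound. This is the input for the
  continuity of a morphism induced by a map of spectra.\<close>

lemma compact_bounded:
  assumes C: "compact C" "C \<subseteq> characters A"
  obtains n where "C \<subseteq> characters_below A (p n)"
proof -
  define W where "W n = (\<Union>a\<in>{a. {\<psi> \<in> characters A. \<psi> a \<noteq> 0} \<subseteq> characters_below A (p n)}.
    {f :: 'a \<Rightarrow> complex. f a \<noteq> 0})" for n
  have W: "open (W n)" for n unfolding W_def using open_nonzero by blast
  have cover: "C \<subseteq> (\<Union>n\<in>UNIV. W n)"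
  proof
    fix \<phi> assume \<phi>: "\<phi> \<in> C"
    obtain a n where a: "\<phi> a \<noteq> 0" "{\<psi> \<in> characters A. \<psi> a \<noteq> 0} \<subseteq> characters_below A (p n)"
      using locally_bounded[OF subsetD[OF C(2) \<phi>]] .
    then have "\<phi> \<in> W n" unfolding W_def by blast
    then show "\<phi> \<in> (\<Union>n\<in>UNIV. W n)" by blast
  qed
  obtain I where I: "I \<subseteq> UNIV" "finite I" "C \<subseteq> (\<Union>n\<in>I. W n)"
    by (rule compactE_image[OF C(1) W cover])
  obtain N where N: "\<forall>i\<in>I. i \<le> N" using I(2) finite_nat_set_iff_bounded_le[of I] by auto
  have "C \<subseteq> characters_below A (p N)"
  proof
    fix \<phi> assume \<phi>: "\<phi> \<in> C"
    then obtain i where i: "i \<in> I" "\<phi> \<in> W i" using I(3) by blast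
    then have "\<phi> \<in> characters_below A (p i)" using \<phi> C(2) unfolding W_def by blast
    then show "\<phi> \<in> characters_below A (p N)" using characters_below_mono[of i N] N i(1) by blast
  qed
  then show thesis by (rule that)
qed

lemma locally_compact_spectrum: "locally_compact_space (spectrum A)"
proof -
  have "locally_compact_space (top_of_set (characters A))"
    unfolding locally_compact_space_def
  proof
    fix \<phi> assume "\<phi> \<in> topspace (top_of_set (characters A))"
    then have \<phi>: "\<phi> \<in> characters A" by simp
    obtain a n where a: "\<phi> a \<noteq> 0" "{\<psi> \<in> characters A. \<psi> a \<noteq> 0} \<subseteq> characters_below A (p n)"
      using locally_bounded[OF \<phi>] .
    have "openin (top_of_set (characters A)) (characters A \<inter> {\<psi>. \<psi> a \<noteq> 0})"
      using open_nonzero by (rule openin_open_Int)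
    moreover have "compactin (top_of_set (characters A)) (characters_below A (p n))"
      using characters_eq by (auto simp: compactin_subtopology compact_characters_below)
    ultimately show "\<exists>U K. openin (top_of_set (characters A)) U \<and>
        compactin (top_of_set (characters A)) K \<and> \<phi> \<in> U \<and> U \<subseteq> K"
      using \<phi> a by (intro exI[of _ "characters A \<inter> {\<psi>. \<psi> a \<noteq> 0}"]
          exI[of _ "characters_below A (p n)"]) auto
  qed
  then show ?thesis using homeomorphic_locally_compact_space[OF homeomorphic_space_spectrum] by blast
qed

lemma sigma_compact_spectrum: "sigma_compact_space (spectrum A)"
proof (rule homeomorphic_sigma_compact_space[OF homeomorphic_spectrum])
  show "sigma_compact_space (top_of_set (characters A))"
    unfolding sigma_compact_space_def
    by (rule exI[of _ "range (\<lambda>n. characters_below A (p n))"])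
      (auto simp: compactin_subtopology compact_characters_below characters_eq)
qed

end

section \<open>The spectrum functor\<close>

lemma is_category_dual:
  assumes "is_category C"
  shows "is_category (dual_category C)"
  using assms unfolding is_category_def dual_category_def by simp

lemma is_category_space_category:
  fixes \<X> :: "'p topology set"
  shows "is_category (space_category \<X>)"
proof -
  let ?C = "space_category \<X>"
  have sel: "Arr ?C = (\<lambda>X Y. {f \<in> extensional (topspace X). continuous_map X Y f})"
    "Comp ?C = (\<lambda>X Y Z g f. compose (topspace X) g f)" "Ident ?C = (\<lambda>X. \<lambda>x\<in>topspace X. x)"
    by (simp_all add: space_category_def)
  have im: "f x \<in> topspace Y" if "f \<in> Arr ?C X Y" "x \<in> topspace X" for f X Y x
    using that continuous_map_image_subset_topspace[of X Y f] by (auto simp: sel)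
  show ?thesis
    unfolding is_category_def
  proof (intro conjI ballI)
    fix X :: "'p topology"
    have "continuous_map X X (\<lambda>x\<in>topspace X. x)"
      by (rule continuous_map_eq[OF continuous_map_id]) simp
    then show "Ident ?C X \<in> Arr ?C X X" by (simp add: sel)
    fix Y f assume f: "f \<in> Arr ?C X Y"
    then have "f \<in> extensional (topspace X)" by (simp add: sel)
    then show "Comp ?C X X Y f (Ident ?C X) = f" "Comp ?C X Y Y (Ident ?C Y) f = f"
      using im[OF f] by (auto simp: sel compose_def fun_eq_iff extensional_def)
  next
    fix X Y Z f g assume "f \<in> Arr ?C X Y" "g \<in> Arr ?C Y Z"
    then have "continuous_map X Z (g \<circ> f)" by (auto simp: sel intro: continuous_map_compose)
    then have "continuous_map X Z (compose (topspace X) g f)"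
      by (rule continuous_map_eq) (simp add: compose_def)
    then show "Comp ?C X Y Z g f \<in> Arr ?C X Z" by (simp add: sel)
  next
    fix W X Y Z f g h assume "f \<in> Arr ?C W X"
    from im[OF this] show "Comp ?C W Y Z h (Comp ?C W X Y g f) = Comp ?C W X Z (Comp ?C X Y Z h g) f"
      by (auto simp: sel compose_def fun_eq_iff)
  qed
qed

lemma morphismD:
  assumes "u \<in> star_algebra_morphisms A B"
  shows "u \<in> ring_hom A B" "u \<in> extensional (carrier A)"
    "\<And>c x. x \<in> carrier A \<Longrightarrow> u (c \<odot>\<^bsub>A\<^esub> x) = c \<odot>\<^bsub>B\<^esub> u x"
    "\<And>x. x \<in> carrier A \<Longrightarrow> u (star A x) = star B (u x)"
    "continuous_map (alg_topology A) (alg_topology B) u"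
    "\<And>x. x \<in> carrier A \<Longrightarrow> u x \<in> carrier B"
  using assms by (auto simp: star_algebra_morphisms_def ring_hom_def)

lemma compose_morphism:
  assumes u: "u \<in> star_algebra_morphisms A B" and v: "v \<in> star_algebra_morphisms B C"
    and A: "star_alg A" and topA: "topspace (alg_topology A) = carrier A"
  shows "compose (carrier A) v u \<in> star_algebra_morphisms A C"
proof -
  interpret star_alg A by (rule A)
  note u' = morphismD[OF u] and v' = morphismD[OF v]
  have hom: "u x \<in> carrier B" "u (x \<otimes>\<^bsub>A\<^esub> y) = u x \<otimes>\<^bsub>B\<^esub> u y" "u (x \<oplus>\<^bsub>A\<^esub> y) = u x \<oplus>\<^bsub>B\<^esub> u y"
    if "x \<in> carrier A" "y \<in> carrier A" for x y
    using u'(1) that by (auto simp: ring_hom_def)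
  have hom': "v x \<in> carrier C" "v (x \<otimes>\<^bsub>B\<^esub> y) = v x \<otimes>\<^bsub>C\<^esub> v y" "v (x \<oplus>\<^bsub>B\<^esub> y) = v x \<oplus>\<^bsub>C\<^esub> v y"
    if "x \<in> carrier B" "y \<in> carrier B" for x y
    using v'(1) that by (auto simp: ring_hom_def)
  have one: "u \<one>\<^bsub>A\<^esub> = \<one>\<^bsub>B\<^esub>" "v \<one>\<^bsub>B\<^esub> = \<one>\<^bsub>C\<^esub>" using u'(1) v'(1) by (auto simp: ring_hom_def)
  have "continuous_map (alg_topology A) (alg_topology C) (v \<circ> u)"
    using u'(5) v'(5) by (rule continuous_map_compose)
  then have "continuous_map (alg_topology A) (alg_topology C) (compose (carrier A) v u)"
    by (rule continuous_map_eq) (simp add: compose_def topA)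
  then show ?thesis
    using hom hom' one u'(3,4,6) v'(3,4,6)
    by (simp add: star_algebra_morphisms_def ring_hom_def compose_def)
qed

lemma identity_morphism:
  assumes A: "star_alg A" and topA: "topspace (alg_topology A) = carrier A"
  shows "(\<lambda>x\<in>carrier A. x) \<in> star_algebra_morphisms A A"
proof -
  interpret star_alg A by (rule A)
  have "continuous_map (alg_topology A) (alg_topology A) (\<lambda>x\<in>carrier A. x)"
    by (rule continuous_map_eq[OF continuous_map_id]) (simp add: topA)
  then show ?thesis
    by (simp add: star_algebra_morphisms_def ring_hom_def)
qed

lemma metrizable_lcstar_Obj:
  assumes "A \<in> Obj (metrizable_lcstar_category \<U>)"
  obtains p where "seq_lcstar_algebra A p"
  using assms metrizable_lcstar_algebra[of A] by (auto simp: metrizable_lcstar_category_def)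

lemma metrizable_lcstar_Obj_star_alg:
  assumes "A \<in> Obj (metrizable_lcstar_category \<U>)"
  shows "star_alg A" "topspace (alg_topology A) = carrier A"
proof -
  obtain p where "seq_lcstar_algebra A p" using metrizable_lcstar_Obj[OF assms] .
  then interpret seq_lcstar_algebra A p .
  show "star_alg A" by (rule star_alg_axioms)
  show "topspace (alg_topology A) = carrier A" by (rule topspace_alg)
qed

lemma is_category_metrizable_lcstar: "is_category (metrizable_lcstar_category \<U>)"
  unfolding is_category_def
proof (intro conjI ballI)
  let ?C = "metrizable_lcstar_category \<U>"
  have sel: "Arr ?C = star_algebra_morphisms" "Comp ?C = (\<lambda>A B C v u. compose (carrier A) v u)"
    "Ident ?C = (\<lambda>A. \<lambda>x\<in>carrier A. x)"
    by (simp_all add: metrizable_lcstar_category_def)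
  note alg = metrizable_lcstar_Obj_star_alg
  fix X assume X: "X \<in> Obj ?C"
  show "Ident ?C X \<in> Arr ?C X X" unfolding sel by (rule identity_morphism[OF alg[OF X]])
  fix Y assume Y: "Y \<in> Obj ?C"
  fix f assume f: "f \<in> Arr ?C X Y"
  then have f': "f \<in> star_algebra_morphisms X Y" by (simp add: sel)
  note fD = morphismD(2,6)[OF f']
  show "Comp ?C X X Y f (Ident ?C X) = f" "Comp ?C X Y Y (Ident ?C Y) f = f"
    using fD by (auto simp: sel compose_def fun_eq_iff extensional_def)
next
  let ?C = "metrizable_lcstar_category \<U>"
  have sel: "Arr ?C = star_algebra_morphisms" "Comp ?C = (\<lambda>A B C v u. compose (carrier A) v u)"
    by (simp_all add: metrizable_lcstar_category_def)
  fix X Y Z f g assume a: "X \<in> Obj ?C" "f \<in> Arr ?C X Y" "g \<in> Arr ?C Y Z"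
  show "Comp ?C X Y Z g f \<in> Arr ?C X Z"
    using a(2,3) unfolding sel by (rule compose_morphism[OF _ _ metrizable_lcstar_Obj_star_alg[OF a(1)]])
next
  let ?C = "metrizable_lcstar_category \<U>"
  have sel: "Arr ?C = star_algebra_morphisms" "Comp ?C = (\<lambda>A B C v u. compose (carrier A) v u)"
    by (simp_all add: metrizable_lcstar_category_def)
  fix W X Y Z f g h assume "f \<in> Arr ?C W X"
  then have "f \<in> star_algebra_morphisms W X" by (simp add: sel)
  note fD = morphismD(6)[OF this]
  show "Comp ?C W Y Z h (Comp ?C W X Y g f) = Comp ?C W X Z (Comp ?C X Y Z h g) f"
    using fD by (auto simp: sel compose_def fun_eq_iff)
qed

text \<open>The preimage under \<open>u\<close> of the kernel of \<phi> is the kernel of \<phi>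
  composed with \<open>u\<close>. The map runs from A to B since a morphism from B to A is an arrow
  from A to B of the dual category.\<close>

definition spectrum_map :: "'a star_algebra \<Rightarrow> 'b star_algebra \<Rightarrow> ('b \<Rightarrow> 'a) \<Rightarrow> 'a set \<Rightarrow> 'b set" where
  "spectrum_map A B u = (\<lambda>m\<in>topspace (spectrum A). {b \<in> carrier B. u b \<in> m})"

text \<open>Composition with \<open>u\<close>, set to 0 off the carrier as membership in
  \<open>characters B\<close> requires.\<close>

definition pull_character :: "'b star_algebra \<Rightarrow> ('b \<Rightarrow> 'a) \<Rightarrow> ('a \<Rightarrow> complex) \<Rightarrow> 'b \<Rightarrow> complex" where
  "pull_character B u \<phi> = (\<lambda>b. if b \<in> carrier B then \<phi> (u b) else 0)"

lemma pull_character: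
  assumes A: "star_alg A" and B: "star_alg B" "topspace (alg_topology B) = carrier B"
    and u: "u \<in> star_algebra_morphisms B A" and \<phi>: "\<phi> \<in> characters A"
  shows "pull_character B u \<phi> \<in> characters B"
    "character_kernel B (pull_character B u \<phi>) = {b \<in> carrier B. u b \<in> character_kernel A \<phi>}"
proof -
  interpret A: star_alg A by (rule A)
  interpret B: star_alg B by (rule B(1))
  note uD = morphismD[OF u]
  have h: "hermitian_character A \<phi>" and c: "continuous_map (alg_topology A) euclidean \<phi>"
    using \<phi> by (simp_all add: characters_def continuous_hermitian_characters_eq)
  have hom: "u (x \<otimes>\<^bsub>B\<^esub> y) = u x \<otimes>\<^bsub>A\<^esub> u y" "u (x \<oplus>\<^bsub>B\<^esub> y) = u x \<oplus>\<^bsub>A\<^esub> u y" "u \<one>\<^bsub>B\<^esub> = \<one>\<^bsub>A\<^esub>"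
    if "x \<in> carrier B" "y \<in> carrier B" for x y
    using uD(1) that by (auto simp: ring_hom_def)
  have one: "u \<one>\<^bsub>B\<^esub> = \<one>\<^bsub>A\<^esub>" using uD(1) by (auto simp: ring_hom_def)
  have "hermitian_character B (pull_character B u \<phi>)"
    by (rule B.hermitian_characterI)
      (simp_all add: pull_character_def hom one uD(3,4,6) A.character_simps[OF h])
  moreover have "continuous_map (alg_topology B) euclidean (\<phi> \<circ> u)"
    using uD(5) c by (rule continuous_map_compose)
  then have "continuous_map (alg_topology B) euclidean (pull_character B u \<phi>)"
    by (rule continuous_map_eq) (simp add: pull_character_def B(2))
  ultimately show "pull_character B u \<phi> \<in> characters B"
    by (simp add: characters_def continuous_hermitian_characters_eq pull_character_def)
  show "character_kernel B (pull_character B u \<phi>) = {b \<in> carrier B. u b \<in> character_kernel A \<phi>}"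
    using uD(6) by (auto simp: character_kernel_def pull_character_def)
qed

lemma spectrum_map_kernel:
  assumes A: "star_alg A" and B: "star_alg B" "topspace (alg_topology B) = carrier B"
    and u: "u \<in> star_algebra_morphisms B A" and \<phi>: "\<phi> \<in> characters A"
  shows "spectrum_map A B u (character_kernel A \<phi>) = character_kernel B (pull_character B u \<phi>)"
  using pull_character[OF A B u \<phi>] \<phi> star_alg.topspace_spectrum[OF A]
  by (simp add: spectrum_map_def)

text \<open>Coordinate \<open>b\<close> of the pulled-back character is coordinate
  \<open>u b\<close> of the original one, hence continuous for the product topology.\<close>

lemma continuous_spectrum_map:
  assumes A: "star_alg A" and B: "star_alg B" "topspace (alg_topology B) = carrier B"
    and u: "u \<in> star_algebra_morphisms B A"
  shows "continuous_map (spectrum A) (spectrum B) (spectrum_map A B u)"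
proof -
  interpret A: star_alg A by (rule A)
  interpret B: star_alg B by (rule B(1))
  have c: "continuous_map (spectrum A) (top_of_set (characters A)) (character_of A)"
    "continuous_map (top_of_set (characters B)) (spectrum B) (character_kernel B)"
    using A.homeomorphic_spectrum B.homeomorphic_spectrum by (auto simp: homeomorphic_maps_def)
  have "continuous_on (characters A) (pull_character B u)"
  proof (rule continuous_on_coordinatewise_then_product)
    fix b
    show "continuous_on (characters A) (\<lambda>\<phi>. pull_character B u \<phi> b)"
      by (cases "b \<in> carrier B") (auto simp: pull_character_def intro: continuous_on_apply)
  qed
  then have "continuous_map (top_of_set (characters A)) (top_of_set (characters B)) (pull_character B u)"
    using pull_character(1)[OF A B u] by (auto simp: continuous_map_in_subtopology)
  then have "continuous_map (spectrum A) (spectrum B)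
      (character_kernel B \<circ> (pull_character B u \<circ> character_of A))"
    using c by (intro continuous_map_compose)
  then show ?thesis
  proof (rule continuous_map_eq)
    fix m assume m: "m \<in> topspace (spectrum A)"
    have "spectrum_map A B u (character_kernel A (character_of A m)) =
        character_kernel B (pull_character B u (character_of A m))"
      by (rule spectrum_map_kernel[OF A B u A.character_of_in[OF m]])
    then show "(character_kernel B \<circ> (pull_character B u \<circ> character_of A)) m = spectrum_map A B u m"
      using A.kernel_character_of[OF m] by simp
  qed
qed

lemma spectrum_Obj:
  assumes "A \<in> Obj (metrizable_lcstar_category \<U>)"
  shows "spectrum A \<in> Obj (sigma_compact_lc_category \<U>)"
proof -
  obtain p where "seq_lcstar_algebra A p" using metrizable_lcstar_Obj[OF assms] .
  then interpret seq_lcstar_algebra A p .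
  show ?thesis
    using assms small_spectrum Hausdorff_spectrum locally_compact_spectrum sigma_compact_spectrum
    by (simp add: sigma_compact_lc_category_def space_category_def metrizable_lcstar_category_def)
qed

lemma is_functor_spectrum:
  "is_functor (dual_category (metrizable_lcstar_category \<U>)) (sigma_compact_lc_category \<U>)
    spectrum spectrum_map"
  unfolding is_functor_def
proof (intro conjI ballI)
  let ?M = "metrizable_lcstar_category \<U>" let ?C = "dual_category ?M"
  let ?D = "sigma_compact_lc_category \<U>"
  have selC: "Obj ?C = Obj ?M" "Arr ?C = (\<lambda>X Y. star_algebra_morphisms Y X)"
    "Ident ?C = (\<lambda>A. \<lambda>x\<in>carrier A. x)"
    by (simp_all add: dual_category_def metrizable_lcstar_category_def)
  have selD: "Arr ?D = (\<lambda>X Y. {f \<in> extensional (topspace X). continuous_map X Y f})"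
    "Ident ?D = (\<lambda>X. \<lambda>x\<in>topspace X. x)"
    by (simp_all add: sigma_compact_lc_category_def space_category_def)
  fix X assume "X \<in> Obj ?C"
  then have X: "X \<in> Obj ?M" by (simp add: selC)
  note X' = metrizable_lcstar_Obj_star_alg[OF X]
  show "spectrum X \<in> Obj ?D" using spectrum_Obj[OF X] .
  have "{b \<in> carrier X. (\<lambda>x\<in>carrier X. x) b \<in> m} = m" if "m \<in> topspace (spectrum X)" for m
    using that by (auto simp: star_alg.topspace_spectrum[OF X'(1)] character_kernel_def)
  then show "spectrum_map X X (Ident ?C X) = Ident ?D (spectrum X)"
    by (auto simp: spectrum_map_def selC selD fun_eq_iff)
  fix Y f assume "Y \<in> Obj ?C" and f: "f \<in> Arr ?C X Y"
  then have Y: "Y \<in> Obj ?M" by (simp add: selC)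
  note Y' = metrizable_lcstar_Obj_star_alg[OF Y]
  show "spectrum_map X Y f \<in> Arr ?D (spectrum X) (spectrum Y)"
    using continuous_spectrum_map[OF X'(1) Y'] f
    by (simp add: selC selD) (simp add: spectrum_map_def)
next
  let ?M = "metrizable_lcstar_category \<U>" let ?C = "dual_category ?M"
  let ?D = "sigma_compact_lc_category \<U>"
  have selC: "Obj ?C = Obj ?M" "Arr ?C = (\<lambda>X Y. star_algebra_morphisms Y X)"
    "Comp ?C = (\<lambda>X Y Z g f. compose (carrier Z) f g)"
    by (simp_all add: dual_category_def metrizable_lcstar_category_def)
  have selD: "Comp ?D = (\<lambda>X Y Z g f. compose (topspace X) g f)"
    by (simp add: sigma_compact_lc_category_def space_category_def)
  fix X Y Z f g
  assume "X \<in> Obj ?C" "Y \<in> Obj ?C" "Z \<in> Obj ?C" and f: "f \<in> Arr ?C X Y" and g: "g \<in> Arr ?C Y Z"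
  then have X: "X \<in> Obj ?M" and Y: "Y \<in> Obj ?M" by (simp_all add: selC)
  have f': "f \<in> star_algebra_morphisms Y X" and g': "g \<in> star_algebra_morphisms Z Y"
    using f g by (simp_all add: selC)
  have "spectrum_map X Y f m \<in> topspace (spectrum Y)" if "m \<in> topspace (spectrum X)" for m
    using continuous_map_image_subset_topspace[OF continuous_spectrum_map[OF
        metrizable_lcstar_Obj_star_alg(1)[OF X] metrizable_lcstar_Obj_star_alg[OF Y] f']] that
    by auto
  then show "spectrum_map X Z (Comp ?C X Y Z g f) =
      Comp ?D (spectrum X) (spectrum Y) (spectrum Z) (spectrum_map Y Z g) (spectrum_map X Y f)"
    using morphismD(6)[OF g'] unfolding selC selD
    by (auto simp: fun_eq_iff compose_def spectrum_map_def)
qed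

section \<open>Full faithfulness of the spectrum functor\<close>

text \<open>Equal maps of spectra give \<phi> (u b) = \<phi> (v b) for every character \<phi> of A,
  and characters separate the elements of A.\<close>

lemma spectrum_map_inj:
  assumes A: "seq_lcstar_algebra A p" and B: "seq_lcstar_algebra B q"
    and u: "u \<in> star_algebra_morphisms B A" and v: "v \<in> star_algebra_morphisms B A"
    and eq: "spectrum_map A B u = spectrum_map A B v"
  shows "u = v"
proof -
  interpret A: seq_lcstar_algebra A p by (rule A)
  interpret B: seq_lcstar_algebra B q by (rule B)
  note pc = pull_character[OF A.star_alg_axioms B.star_alg_axioms B.topspace_alg]
  note k = spectrum_map_kernel[OF A.star_alg_axioms B.star_alg_axioms B.topspace_alg]
  have "u b = v b" if b: "b \<in> carrier B" for b
  proof (rule A.characters_separate)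
    show "u b \<in> carrier A" "v b \<in> carrier A" using morphismD(6)[OF u b] morphismD(6)[OF v b] .
    fix \<phi> assume \<phi>: "\<phi> \<in> characters A"
    have "pull_character B u \<phi> = pull_character B v \<phi>"
      using inj_onD[OF B.inj_on_character_kernel _ pc(1)[OF u \<phi>] pc(1)[OF v \<phi>]]
        k[OF u \<phi>] k[OF v \<phi>] eq by simp
    then show "\<phi> (u b) = \<phi> (v b)" using b by (auto simp: pull_character_def fun_eq_iff split: if_splits)
  qed
  then show ?thesis
    using morphismD(2)[OF u] morphismD(2)[OF v] by (auto intro: extensionalityI)
qed

text \<open>For fixed \<open>b\<close>, the value at \<open>b\<close> of the image character depends
  continuously on the character of A, hence is given by an element \<open>u b\<close>. The algebraic
  laws hold because characters separate elements; continuity holds because a compact set of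
  characters has its image bounded by one seminorm of B.\<close>

lemma spectrum_map_surj:
  assumes A: "seq_lcstar_algebra A p" and B: "seq_lcstar_algebra B q"
    and f: "continuous_map (spectrum A) (spectrum B) f" "f \<in> extensional (topspace (spectrum A))"
  shows "\<exists>u\<in>star_algebra_morphisms B A. spectrum_map A B u = f"
proof -
  interpret A: seq_lcstar_algebra A p by (rule A)
  interpret B: seq_lcstar_algebra B q by (rule B)
  \<comment> \<open>The map \<open>f\<close> read on characters instead of kernels.\<close>
  define h where "h \<phi> = character_of B (f (character_kernel A \<phi>))" for \<phi>
  have "continuous_map (top_of_set (characters A)) (top_of_set (characters B))
      (character_of B \<circ> (f \<circ> character_kernel A))"
    using A.homeomorphic_spectrum B.homeomorphic_spectrum f(1)
    by (intro continuous_map_compose) (auto simp: homeomorphic_maps_def)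
  then have h: "continuous_on (characters A) h" "\<And>\<phi>. \<phi> \<in> characters A \<Longrightarrow> h \<phi> \<in> characters B"
    by (auto simp: continuous_map_in_subtopology h_def o_def)
  have f_in: "f m \<in> topspace (spectrum B)" if "m \<in> topspace (spectrum A)" for m
    using continuous_map_image_subset_topspace[OF f(1)] that by auto
  have "\<exists>a. a \<in> carrier A \<and> (\<forall>\<phi>\<in>characters A. \<phi> a = h \<phi> b)" for b
    using A.Gelfand_surjective[OF continuous_on_product_then_coordinatewise[OF h(1)], of b]
    by (simp add: Bex_def)
  then obtain w where w: "\<forall>b. w b \<in> carrier A \<and> (\<forall>\<phi>\<in>characters A. \<phi> (w b) = h \<phi> b)"
    using choice[of "\<lambda>b a. a \<in> carrier A \<and> (\<forall>\<phi>\<in>characters A. \<phi> a = h \<phi> b)"] by auto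
  define u where "u = (\<lambda>b\<in>carrier B. w b)"
  have u_in: "u b \<in> carrier A" if "b \<in> carrier B" for b using w that by (simp add: u_def)
  have \<phi>u: "\<phi> (u b) = h \<phi> b" if "\<phi> \<in> characters A" "b \<in> carrier B" for \<phi> b
    using w that by (simp add: u_def)
  note herm = A.characters_hermitian and hermB = B.characters_hermitian[OF h(2)]
  have alg: "u (x \<otimes>\<^bsub>B\<^esub> y) = u x \<otimes>\<^bsub>A\<^esub> u y" "u (x \<oplus>\<^bsub>B\<^esub> y) = u x \<oplus>\<^bsub>A\<^esub> u y" "u (c \<odot>\<^bsub>B\<^esub> x) = c \<odot>\<^bsub>A\<^esub> u x"
    "u (star B x) = star A (u x)" "u (x \<ominus>\<^bsub>B\<^esub> y) = u x \<ominus>\<^bsub>A\<^esub> u y"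
    if "x \<in> carrier B" "y \<in> carrier B" for x y c
    using that
    by (auto intro!: A.characters_separate
        simp: u_in \<phi>u A.character_simps[OF herm] B.character_simps[OF hermB])
  have one: "u \<one>\<^bsub>B\<^esub> = \<one>\<^bsub>A\<^esub>"
    by (auto intro!: A.characters_separate
        simp: u_in \<phi>u A.character_simps[OF herm] B.character_simps[OF hermB])
  have "continuous_map (alg_topology B) (alg_topology A) u"
    unfolding continuous_map_def B.topspace_alg A.topspace_alg
  proof (intro conjI allI impI)
    fix U assume U: "openin (alg_topology A) U"
    show "openin (alg_topology B) {x \<in> carrier B. u x \<in> U}"
      unfolding B.openin_iff
    proof (intro conjI ballI)
      fix x assume x: "x \<in> {x \<in> carrier B. u x \<in> U}"
      then have xB: "x \<in> carrier B" and "u x \<in> U" by auto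
      then obtain n e where e: "0 < e" "{y \<in> carrier A. p n (y \<ominus>\<^bsub>A\<^esub> u x) < e} \<subseteq> U"
        using A.open_nbhd[OF U] by metis
      have sub: "characters_below A (p n) \<subseteq> characters A" using A.characters_eq by auto
      have "compact (h ` characters_below A (p n))"
        using compact_characters_below continuous_on_subset[OF h(1) sub]
        by (intro compact_continuous_image)
      moreover have "h ` characters_below A (p n) \<subseteq> characters B" using h(2) sub by auto
      ultimately obtain m where m: "h ` characters_below A (p n) \<subseteq> characters_below B (q m)"
        by (rule B.compact_bounded)
      have "{y \<in> carrier B. q m (y \<ominus>\<^bsub>B\<^esub> x) < e} \<subseteq> {x \<in> carrier B. u x \<in> U}"
      proof
        fix y assume "y \<in> {y \<in> carrier B. q m (y \<ominus>\<^bsub>B\<^esub> x) < e}"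
        then have y: "y \<in> carrier B" "q m (y \<ominus>\<^bsub>B\<^esub> x) < e" by auto
        \<comment> \<open>The comparison goes through characters: \<open>\<phi>\<close> below
          \<open>p n\<close> composed with \<open>u\<close> is h \<phi>, which lies below
          \<open>q m\<close>.\<close>
        have "p n (u y \<ominus>\<^bsub>A\<^esub> u x) \<le> q m (y \<ominus>\<^bsub>B\<^esub> x)"
        proof (rule A.seminorm_le_of_characters[OF A.Cstar_p])
          fix \<phi> assume \<phi>: "\<phi> \<in> characters_below A (p n)"
          have "\<phi> (u y \<ominus>\<^bsub>A\<^esub> u x) = h \<phi> (y \<ominus>\<^bsub>B\<^esub> x)"
            using \<phi>u[OF subsetD[OF sub \<phi>], of "y \<ominus>\<^bsub>B\<^esub> x"] xB y(1) by (simp add: alg)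
          moreover have "h \<phi> \<in> characters_below B (q m)" using m \<phi> by auto
          ultimately show "cmod (\<phi> (u y \<ominus>\<^bsub>A\<^esub> u x)) \<le> q m (y \<ominus>\<^bsub>B\<^esub> x)"
            using xB y(1) by (simp add: characters_below_def)
        qed (use xB y u_in B.seminorm_nonneg[OF B.seminorm_p] in auto)
        then have "u y \<in> {y \<in> carrier A. p n (y \<ominus>\<^bsub>A\<^esub> u x) < e}" using y u_in by simp
        with e(2) y(1) show "y \<in> {x \<in> carrier B. u x \<in> U}" by auto
      qed
      with e(1) show "\<exists>n. \<exists>e>0. {y \<in> carrier B. q n (y \<ominus>\<^bsub>B\<^esub> x) < e} \<subseteq> {x \<in> carrier B. u x \<in> U}"
        by (intro exI[of _ m] exI[of _ e] conjI)
    qed auto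
  qed (use u_in in auto)
  then have u: "u \<in> star_algebra_morphisms B A"
    using alg one u_in by (simp add: star_algebra_morphisms_def ring_hom_def) (simp add: u_def)
  have "spectrum_map A B u m = f m" if m: "m \<in> topspace (spectrum A)" for m
  proof -
    obtain \<phi> where \<phi>: "\<phi> \<in> characters A" "m = character_kernel A \<phi>"
      using m A.topspace_spectrum by auto
    have "pull_character B u \<phi> = h \<phi>"
    proof
      fix b show "pull_character B u \<phi> b = h \<phi> b"
        using \<phi>u[OF \<phi>(1)] h(2)[OF \<phi>(1)] by (auto simp: pull_character_def characters_def)
    qed
    then have "spectrum_map A B u m = character_kernel B (h \<phi>)"
      using spectrum_map_kernel[OF A.star_alg_axioms B.star_alg_axioms B.topspace_alg u \<phi>(1)] \<phi>(2)
      by simp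
    also have "\<dots> = f m" unfolding h_def \<phi>(2)[symmetric]
      by (rule B.kernel_character_of[OF f_in[OF m]])
    finally show ?thesis .
  qed
  moreover have "spectrum_map A B u \<in> extensional (topspace (spectrum A))"
    by (simp add: spectrum_map_def)
  ultimately have "spectrum_map A B u = f" using f(2) by (intro extensionalityI)
  with u show ?thesis by blast
qed

lemma spectrum_fully_faithful:
  assumes A: "A \<in> Obj (dual_category (metrizable_lcstar_category \<U>))"
    and B: "B \<in> Obj (dual_category (metrizable_lcstar_category \<U>))"
  shows "bij_betw (spectrum_map A B) (Arr (dual_category (metrizable_lcstar_category \<U>)) A B)
    (Arr (sigma_compact_lc_category \<U>) (spectrum A) (spectrum B))"
proof -
  let ?C = "dual_category (metrizable_lcstar_category \<U>)" let ?D = "sigma_compact_lc_category \<U>"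
  have selC: "Arr ?C A B = star_algebra_morphisms B A" "Obj ?C = Obj (metrizable_lcstar_category \<U>)"
    by (simp_all add: dual_category_def metrizable_lcstar_category_def)
  have selD: "Arr ?D (spectrum A) (spectrum B) =
      {f \<in> extensional (topspace (spectrum A)). continuous_map (spectrum A) (spectrum B) f}"
    by (simp add: sigma_compact_lc_category_def space_category_def)
  obtain p where p: "seq_lcstar_algebra A p" using metrizable_lcstar_Obj A unfolding selC by blast
  obtain q where q: "seq_lcstar_algebra B q" using metrizable_lcstar_Obj B unfolding selC by blast
  have "inj_on (spectrum_map A B) (Arr ?C A B)"
    unfolding selC using spectrum_map_inj[OF p q] by (auto intro: inj_onI)
  moreover have "spectrum_map A B ` Arr ?C A B \<subseteq> Arr ?D (spectrum A) (spectrum B)"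
    using is_functor_spectrum A B unfolding is_functor_def by blast
  moreover have "Arr ?D (spectrum A) (spectrum B) \<subseteq> spectrum_map A B ` Arr ?C A B"
    unfolding selC selD using spectrum_map_surj[OF p q] by blast
  ultimately show ?thesis unfolding bij_betw_def by blast
qed

section \<open>Algebras of continuous functions\<close>

text \<open>The metric is a supremum of truncated seminorms. The truncation at 1 / (n + 1) makes all
  but finitely many terms small, so metric balls and seminorm balls generate the same
  topology.\<close>

lemma (in seq_Kstar_algebra) metrizable_alg_topology: "metrizable_space (alg_topology A)"
proof -
  \<comment> \<open>The default 0 off the carrier keeps \<open>d\<close> symmetric and non-negative
    on the whole type, as \<open>Metric_space\<close> demands.\<close>
  define t where "t n x y =
    (if x \<in> carrier A \<and> y \<in> carrier A then min (1 / Suc n) (p n (x \<ominus> y)) else 0)" for n x y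
  define d where "d x y = (SUP n. t n x y)" for x y
  have t_le: "t n x y \<le> 1 / Suc n" for n x y by (simp add: t_def)
  have t_le_p: "t n x y \<le> p n (x \<ominus> y)" if "x \<in> carrier A" "y \<in> carrier A" for n x y
    using that by (simp add: t_def)
  have t_le1: "t n x y \<le> 1" for n x y
    using t_le[of n x y] by (rule order_trans) simp
  have bdd: "bdd_above (range (\<lambda>n. t n x y))" for x y
    by (rule bdd_aboveI2[of _ _ 1]) (rule t_le1)
  have t_d: "t n x y \<le> d x y" for n x y
    unfolding d_def by (rule cSUP_upper[OF _ bdd]) simp
  have d_le: "d x y \<le> B" if "\<And>n. t n x y \<le> B" for x y B
    unfolding d_def by (rule cSUP_least) (use that in auto)
  have t_nonneg: "0 \<le> t n x y" for n x y
    using seminorm_nonneg[OF seminorm_p, of "x \<ominus> y" n] by (simp add: t_def)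
  \<comment> \<open>Terms up to index \<open>n\<close> are bounded by \<open>p n\<close>, the later
    ones by their truncation.\<close>
  have d_small: "d x y < e" if "p n (x \<ominus> y) < e" "1 / Suc n < e" "x \<in> carrier A" "y \<in> carrier A" for n x y e
  proof -
    have "t m x y \<le> max (p n (x \<ominus> y)) (1 / Suc n)" for m
    proof (cases "m \<le> n")
      case True
      then show ?thesis using t_le_p[OF that(3,4), of m] p_mono[of "x \<ominus> y" m n] that(3,4) by simp
    next
      case False
      then have "1 / Suc m \<le> 1 / Suc n" by (intro divide_left_mono) auto
      then show ?thesis using t_le[of m x y] by simp
    qed
    then have "d x y \<le> max (p n (x \<ominus> y)) (1 / Suc n)" by (rule d_le)
    then show ?thesis using that(1,2) by simp
  qed
  have small_d: "p n (x \<ominus> y) \<le> d x y" if "d x y < 1 / Suc n" "x \<in> carrier A" "y \<in> carrier A" for n x y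
    using t_d[of n x y] that by (simp add: t_def)
  have t_commute: "t n x y = t n y x" for n x y
    using seminorm_minus_commute[OF seminorm_p, of x y n] by (simp add: t_def)
  interpret M: Metric_space "carrier A" d
  proof
    show "0 \<le> d x y" for x y using t_nonneg[of 0 x y] t_d[of 0 x y] by linarith
    show "d x y = d y x" for x y by (simp add: d_def t_commute)
    show "d x y = 0 \<longleftrightarrow> x = y" if xy: "x \<in> carrier A" "y \<in> carrier A" for x y
    proof
      assume "d x y = 0"
      then have "p n (x \<ominus> y) \<le> 0" for n using small_d[of x y n] xy by simp
      then have "p n (x \<ominus> y) = 0" for n
        using seminorm_nonneg[OF seminorm_p, of "x \<ominus> y" n] xy by (simp add: antisym)
      then have "x \<ominus> y = \<zero>" using xy by (intro eq_zero_of_p) auto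
      moreover have "x = (x \<ominus> y) \<oplus> y" using xy by algebra
      ultimately show "x = y" using xy by simp
    next
      assume "x = y"
      then have "t n x y = 0" for n using xy by (simp add: t_def minus_eq r_neg seminorm_zero[OF seminorm_p])
      then show "d x y = 0" by (simp add: d_def)
    qed
    show "d x z \<le> d x y + d y z" if xyz: "x \<in> carrier A" "y \<in> carrier A" "z \<in> carrier A" for x y z
    proof (rule d_le)
      fix n
      have "p n (x \<ominus> z) \<le> p n (x \<ominus> y) + p n (y \<ominus> z)"
        using xyz by (rule seminorm_triangle[OF seminorm_p])
      moreover have "0 \<le> p n (x \<ominus> y)" "0 \<le> p n (y \<ominus> z)"
        using xyz by (simp_all add: seminorm_nonneg[OF seminorm_p])
      ultimately have "min c (p n (x \<ominus> z)) \<le> min c (p n (x \<ominus> y)) + min c (p n (y \<ominus> z))"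
        if "0 \<le> c" for c using that by linarith
      from this[of "1 / Suc n"] have "t n x z \<le> t n x y + t n y z" using xyz by (simp add: t_def)
      then show "t n x z \<le> d x y + d y z" using t_d[of n x y] t_d[of n y z] by linarith
    qed
  qed
  have "alg_topology A = M.mtopology"
    unfolding topology_eq
  proof
    fix U
    have "(\<exists>r>0. M.mball x r \<subseteq> U) \<longleftrightarrow> (\<exists>n. \<exists>e>0. {y \<in> carrier A. p n (y \<ominus> x) < e} \<subseteq> U)"
      if x: "x \<in> carrier A" for x
    proof
      assume "\<exists>r>0. M.mball x r \<subseteq> U"
      then obtain r where r: "0 < r" "M.mball x r \<subseteq> U" by (elim exE conjE)
      obtain n where n: "1 / Suc n < r" using nat_approx_posE[OF r(1)] .
      have "{y \<in> carrier A. p n (y \<ominus> x) < r} \<subseteq> M.mball x r"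
        using d_small[OF _ n] x M.commute by (auto simp: M.in_mball)
      with r show "\<exists>n. \<exists>e>0. {y \<in> carrier A. p n (y \<ominus> x) < e} \<subseteq> U"
        by (intro exI[of _ n] exI[of _ r] conjI) auto
    next
      assume "\<exists>n. \<exists>e>0. {y \<in> carrier A. p n (y \<ominus> x) < e} \<subseteq> U"
      then obtain n e where e: "0 < e" "{y \<in> carrier A. p n (y \<ominus> x) < e} \<subseteq> U" by (elim exE conjE)
      have "M.mball x (min e (1 / Suc n)) \<subseteq> {y \<in> carrier A. p n (y \<ominus> x) < e}"
      proof
        fix y assume "y \<in> M.mball x (min e (1 / Suc n))"
        then have "y \<in> carrier A" "d y x < e" "d y x < 1 / Suc n"
          using M.commute[of x y] by (auto simp: M.in_mball)
        with small_d[of y x n] x show "y \<in> {y \<in> carrier A. p n (y \<ominus> x) < e}" by simp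
      qed
      with e show "\<exists>r>0. M.mball x r \<subseteq> U"
        by (intro exI[of _ "min e (1 / Suc n)"] conjI) auto
    qed
    then show "openin (alg_topology A) U \<longleftrightarrow> openin M.mtopology U"
      unfolding openin_iff M.openin_mtopology by (meson subsetD)
  qed
  then show ?thesis unfolding metrizable_space_def using M.Metric_space_axioms by metis
qed

text \<open>The elements of \<open>A\<close> need not be functions: \<open>ev x\<close> is the function on \<open>X\<close> represented by \<open>x\<close>.\<close>

locale function_algebra =
  fixes X :: "'p topology" and A :: "'a star_algebra" (structure) and ev :: "'a \<Rightarrow> 'p \<Rightarrow> complex"
    and nm :: "'p set \<Rightarrow> 'a \<Rightarrow> real"
  assumes Hausdorff_X: "Hausdorff_space X"
    and locally_compact_X: "locally_compact_space X"
    and sigma_compact_X: "sigma_compact_space X"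
    and ev_continuous: "x \<in> carrier A \<Longrightarrow> continuous_map X euclidean (ev x)"
    and ev_eqI: "x \<in> carrier A \<Longrightarrow> y \<in> carrier A \<Longrightarrow>
      (\<And>s. s \<in> topspace X \<Longrightarrow> ev x s = ev y s) \<Longrightarrow> x = y"
    and ev_ex: "continuous_map X euclidean f \<Longrightarrow> \<exists>x\<in>carrier A. \<forall>s\<in>topspace X. ev x s = f s"
    and mult_closed: "x \<in> carrier A \<Longrightarrow> y \<in> carrier A \<Longrightarrow> x \<otimes> y \<in> carrier A"
    and ev_mult: "x \<in> carrier A \<Longrightarrow> y \<in> carrier A \<Longrightarrow> s \<in> topspace X \<Longrightarrow> ev (x \<otimes> y) s = ev x s * ev y s"
    and add_closed: "x \<in> carrier A \<Longrightarrow> y \<in> carrier A \<Longrightarrow> x \<oplus> y \<in> carrier A"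
    and ev_add: "x \<in> carrier A \<Longrightarrow> y \<in> carrier A \<Longrightarrow> s \<in> topspace X \<Longrightarrow> ev (x \<oplus> y) s = ev x s + ev y s"
    and unit_closed: "\<one> \<in> carrier A" and ev_one: "s \<in> topspace X \<Longrightarrow> ev \<one> s = 1"
    and null_closed: "\<zero> \<in> carrier A" and ev_zero: "s \<in> topspace X \<Longrightarrow> ev \<zero> s = 0"
    and scal_closed: "x \<in> carrier A \<Longrightarrow> c \<odot> x \<in> carrier A"
    and ev_smult: "x \<in> carrier A \<Longrightarrow> s \<in> topspace X \<Longrightarrow> ev (c \<odot> x) s = c * ev x s"
    and conj_closed: "x \<in> carrier A \<Longrightarrow> star A x \<in> carrier A"
    and ev_star: "x \<in> carrier A \<Longrightarrow> s \<in> topspace X \<Longrightarrow> ev (star A x) s = cnj (ev x s)"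
    and nm_def: "nm K x = Sup (insert 0 ((\<lambda>s. cmod (ev x s)) ` K))"
    and topology: "alg_topology A = seminorm_topology A (nm ` {K. compactin X K})"
begin

lemmas closed = mult_closed add_closed unit_closed null_closed scal_closed conj_closed
lemmas ev_simps = ev_mult ev_add ev_one ev_zero ev_smult ev_star

text \<open>All laws hold pointwise, and \<open>ev_eqI\<close> reflects them to the carrier.\<close>

lemma cring_A: "cring A"
proof (rule cringI)
  show "abelian_group A"
  proof (rule abelian_groupI)
    show "\<exists>y\<in>carrier A. y \<oplus> x = \<zero>" if "x \<in> carrier A" for x
      by (intro bexI[of _ "(-1) \<odot> x"] ev_eqI) (use that in \<open>simp_all add: closed ev_simps\<close>)
  qed (auto intro!: ev_eqI simp: closed ev_simps)
  show "comm_monoid A"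
    by (rule comm_monoidI) (auto intro!: ev_eqI simp: closed ev_simps)
qed (auto intro!: ev_eqI simp: closed ev_simps algebra_simps)

lemma cring_complex_ring: "cring complex_ring"
proof (rule cringI)
  show "abelian_group complex_ring"
  proof (rule abelian_groupI)
    show "\<exists>y\<in>carrier complex_ring. y \<oplus>\<^bsub>complex_ring\<^esub> x = \<zero>\<^bsub>complex_ring\<^esub>" for x
      by (intro bexI[of _ "- x"]) (simp_all add: complex_ring_def)
  qed (simp_all add: complex_ring_def)
  show "comm_monoid complex_ring"
    by (rule comm_monoidI) (simp_all add: complex_ring_def)
qed (simp add: complex_ring_def algebra_simps)

lemma involutive_A: "involutive_algebra A"
proof -
  have "algebra complex_ring A"
    by (rule algebraI[OF cring_complex_ring cring_A])
      (auto intro!: ev_eqI simp: closed ev_simps complex_ring_def algebra_simps)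
  then show ?thesis
    by (auto simp: involutive_algebra_def closed intro!: ev_eqI) (simp_all add: closed ev_simps)
qed

end

sublocale function_algebra \<subseteq> star_alg A
  using involutive_A by (rule star_algI)

context function_algebra
begin

lemma ev_minus: "x \<in> carrier A \<Longrightarrow> y \<in> carrier A \<Longrightarrow> s \<in> topspace X \<Longrightarrow> ev (x \<ominus> y) s = ev x s - ev y s"
  by (simp add: minus_eq smult_minus_1 ev_simps)

lemma compactin_in_topspace: "compactin X K \<Longrightarrow> s \<in> K \<Longrightarrow> s \<in> topspace X"
  using compactin_subset_topspace by blast

section \<open>Uniform convergence on compact sets\<close>

lemma continuous_norm_ev: "x \<in> carrier A \<Longrightarrow> continuous_map X euclidean (\<lambda>s. cmod (ev x s))"
  using continuous_map_compose[OF ev_continuous, of x euclidean cmod]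
  by (simp add: o_def continuous_on_norm_id)

text \<open>Compactness bounds the values. The 0 inserted in \<open>nm_def\<close> makes the
  supremum meaningful for the empty compact set, where it is 0.\<close>

lemma nm_bdd: "x \<in> carrier A \<Longrightarrow> compactin X K \<Longrightarrow> bdd_above (insert 0 ((\<lambda>s. cmod (ev x s)) ` K))"
  using image_compactin[OF _ continuous_norm_ev, of K x]
  by (simp add: bounded_imp_bdd_above compact_imp_bounded)

lemma ev_le_nm: "x \<in> carrier A \<Longrightarrow> compactin X K \<Longrightarrow> s \<in> K \<Longrightarrow> cmod (ev x s) \<le> nm K x"
  unfolding nm_def by (rule cSup_upper[OF _ nm_bdd]) auto

lemma nm_nonneg: "x \<in> carrier A \<Longrightarrow> compactin X K \<Longrightarrow> 0 \<le> nm K x"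
  unfolding nm_def by (rule cSup_upper[OF _ nm_bdd]) auto

lemma nm_le: "(\<And>s. s \<in> K \<Longrightarrow> cmod (ev x s) \<le> B) \<Longrightarrow> 0 \<le> B \<Longrightarrow> nm K x \<le> B"
  unfolding nm_def by (rule cSup_least) auto

lemma Cstar_nm:
  assumes K: "compactin X K"
  shows "Cstar_seminorm A (nm K)"
  unfolding Cstar_seminorm_def seminorm_def
proof (intro conjI ballI allI nm_nonneg K)
  note top = compactin_in_topspace[OF K]
  fix x assume x: "x \<in> carrier A"
  show "nm K (x \<oplus> y) \<le> nm K x + nm K y" if y: "y \<in> carrier A" for y
  proof (rule nm_le)
    fix s assume s: "s \<in> K"
    have "cmod (ev (x \<oplus> y) s) \<le> cmod (ev x s) + cmod (ev y s)"
      using x y top[OF s] by (simp add: ev_simps norm_triangle_ineq)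
    then show "cmod (ev (x \<oplus> y) s) \<le> nm K x + nm K y"
      using ev_le_nm[OF x K s] ev_le_nm[OF y K s] by linarith
  qed (use nm_nonneg[OF x K] nm_nonneg[OF y K] in simp)
  have smult_le: "nm K (c \<odot> x) \<le> cmod c * nm K x" if x: "x \<in> carrier A" for c x
    by (rule nm_le)
      (use x ev_le_nm[OF x K] nm_nonneg[OF x K] top in \<open>auto simp: ev_simps norm_mult mult_left_mono\<close>)
  show "nm K (c \<odot> x) = cmod c * nm K x" for c
  proof (cases "c = 0")
    case True
    then show ?thesis using smult_le[OF x, of c] nm_nonneg[OF scal_closed[OF x] K, of c] by simp
  next
    case False
    \<comment> \<open>The reverse inequality is \<open>smult_le\<close> for the inverse
      scalar.\<close>
    have "nm K (inverse c \<odot> (c \<odot> x)) \<le> cmod (inverse c) * nm K (c \<odot> x)"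
      using x by (intro smult_le) simp
    then have "nm K x \<le> nm K (c \<odot> x) / cmod c"
      using False x by (simp add: smult_smult norm_inverse divide_inverse mult.commute)
    then have "cmod c * nm K x \<le> nm K (c \<odot> x)"
      using False by (simp add: pos_le_divide_eq mult.commute)
    then show ?thesis using smult_le[OF x, of c] by simp
  qed
  have xx: "cmod (ev (x \<otimes> star A x) s) = (cmod (ev x s))\<^sup>2" if "s \<in> K" for s
    using x top[OF that] by (simp add: ev_simps norm_mult power2_eq_square)
  have xxc: "x \<otimes> star A x \<in> carrier A" using x by simp
  show "nm K (x \<otimes> star A x) = (nm K x)\<^sup>2"
  proof (rule antisym)
    show "nm K (x \<otimes> star A x) \<le> (nm K x)\<^sup>2"
      by (rule nm_le) (use xx ev_le_nm[OF x K] in \<open>simp_all add: power_mono\<close>)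
    have "nm K x \<le> sqrt (nm K (x \<otimes> star A x))"
    proof (rule nm_le)
      fix s assume "s \<in> K"
      then show "cmod (ev x s) \<le> sqrt (nm K (x \<otimes> star A x))"
        using ev_le_nm[OF xxc K, of s] xx by (intro real_le_rsqrt) simp
    qed (use nm_nonneg[OF xxc K] in simp)
    then have "(nm K x)\<^sup>2 \<le> (sqrt (nm K (x \<otimes> star A x)))\<^sup>2"
      using nm_nonneg[OF x K] by (rule power_mono)
    then show "(nm K x)\<^sup>2 \<le> nm K (x \<otimes> star A x)" using nm_nonneg[OF xxc K] by simp
  qed
qed

lemma nm_mono: "K \<subseteq> L \<Longrightarrow> compactin X L \<Longrightarrow> x \<in> carrier A \<Longrightarrow> nm K x \<le> nm L x"
  by (rule nm_le) (auto intro: ev_le_nm nm_nonneg)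

lemma open_nm_ball:
  assumes K: "compactin X K" and x: "x \<in> carrier A" and e: "0 < e"
  shows "openin (alg_topology A) {y \<in> carrier A. nm K (y \<ominus> x) < e}"
  using openin_seminorm_ball[of "{nm K}" "nm ` {K. compactin X K}" x e] K x e
  unfolding topology by simp

text \<open>The family of seminorms is directed: finitely many compact sets are replaced by their
  union, so a single seminorm suffices.\<close>

lemma nm_open_nbhd:
  assumes U: "openin (alg_topology A) U" "x \<in> U"
  shows "\<exists>K e. compactin X K \<and> 0 < e \<and> {y \<in> carrier A. nm K (y \<ominus> x) < e} \<subseteq> U"
proof -
  let ?P = "nm ` {K. compactin X K}"
  have "seminorm A q" if "q \<in> ?P" for q
    using that Cstar_seminormD(1)[OF Cstar_nm] by auto
  then have op: "U \<subseteq> carrier A \<and> (\<forall>x\<in>U. \<exists>F e. finite F \<and> F \<subseteq> ?P \<and> 0 < e \<and>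
      {y \<in> carrier A. \<forall>q\<in>F. q (y \<ominus> x) < e} \<subseteq> U)"
    using U(1) openin_seminorm_topology[of ?P U] unfolding topology by blast
  then obtain F e where F: "finite F" "F \<subseteq> ?P" "0 < e" "{y \<in> carrier A. \<forall>q\<in>F. q (y \<ominus> x) < e} \<subseteq> U"
    using bspec[OF conjunct2[OF op] U(2)] by (elim exE conjE)
  obtain \<K> where \<K>: "finite \<K>" "\<K> \<subseteq> {K. compactin X K}" "F = nm ` \<K>"
    using finite_subset_image[OF F(1,2)] by (elim exE conjE)
  have comp: "compactin X (\<Union>\<K>)" using \<K>(1,2) by (intro compactin_Union) auto
  have xc: "x \<in> carrier A" using op U(2) by blast
  have "{y \<in> carrier A. nm (\<Union>\<K>) (y \<ominus> x) < e} \<subseteq> {y \<in> carrier A. \<forall>q\<in>F. q (y \<ominus> x) < e}"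
  proof
    fix y assume y: "y \<in> {y \<in> carrier A. nm (\<Union>\<K>) (y \<ominus> x) < e}"
    have "nm K (y \<ominus> x) < e" if "K \<in> \<K>" for K
      using nm_mono[OF Union_upper[OF that] comp, of "y \<ominus> x"] y xc by simp
    then show "y \<in> {y \<in> carrier A. \<forall>q\<in>F. q (y \<ominus> x) < e}" using y by (simp add: \<K>(3))
  qed
  with F(3,4) comp show ?thesis by (intro exI[of _ "\<Union>\<K>"] exI[of _ e] conjI) auto
qed

lemma openin_nm_iff:
  "openin (alg_topology A) U \<longleftrightarrow> U \<subseteq> carrier A \<and>
    (\<forall>x\<in>U. \<exists>K e. compactin X K \<and> 0 < e \<and> {y \<in> carrier A. nm K (y \<ominus> x) < e} \<subseteq> U)"
proof (intro iffI conjI ballI nm_open_nbhd)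
  show "U \<subseteq> carrier A" if "openin (alg_topology A) U"
    using openin_subset[OF that] unfolding topology topspace_seminorm_topology .
next
  assume U: "U \<subseteq> carrier A \<and>
    (\<forall>x\<in>U. \<exists>K e. compactin X K \<and> 0 < e \<and> {y \<in> carrier A. nm K (y \<ominus> x) < e} \<subseteq> U)"
  show "openin (alg_topology A) U"
  proof (subst openin_subopen, intro ballI)
    fix x assume x: "x \<in> U"
    obtain K e where K: "compactin X K" "0 < e" "{y \<in> carrier A. nm K (y \<ominus> x) < e} \<subseteq> U"
      using bspec[OF conjunct2[OF U] x] by (elim exE conjE)
    have xc: "x \<in> carrier A" using U x by blast
    then have "x \<ominus> x = \<zero>" by (simp add: minus_eq r_neg)
    then have "nm K (x \<ominus> x) = 0" using seminorm_zero[OF Cstar_seminormD(1)[OF Cstar_nm[OF K(1)]]] by simp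
    with xc K(2) have "x \<in> {y \<in> carrier A. nm K (y \<ominus> x) < e}" by simp
    then show "\<exists>T. openin (alg_topology A) T \<and> x \<in> T \<and> T \<subseteq> U"
      using open_nm_ball[OF K(1) xc K(2)] K(3) by (intro exI conjI)
  qed
qed auto

lemma topspace_A: "topspace (alg_topology A) = carrier A"
  unfolding topology by (rule topspace_seminorm_topology)

lemma Hausdorff_A: "Hausdorff_space (alg_topology A)"
  unfolding Hausdorff_space_def topspace_A
proof (intro allI impI)
  fix x y assume xy: "x \<in> carrier A \<and> y \<in> carrier A \<and> x \<noteq> y"
  then obtain s where s: "s \<in> topspace X" "ev x s \<noteq> ev y s" using ev_eqI[of x y] by blast
  define e where "e = cmod (ev x s - ev y s) / 2"
  have e: "0 < e" using s by (simp add: e_def)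
  have K: "compactin X {s}" using s(1) by simp
  let ?B = "\<lambda>x. {z \<in> carrier A. nm {s} (z \<ominus> x) < e}"
  have zero: "nm {s} (z \<ominus> z) = 0" if "z \<in> carrier A" for z
    using that seminorm_zero[OF Cstar_seminormD(1)[OF Cstar_nm[OF K]]] by (simp add: minus_eq r_neg)
  have "z \<notin> ?B y" if z: "z \<in> ?B x" for z
  proof
    assume z': "z \<in> ?B y"
    have "cmod (ev z s - ev x s) < e" "cmod (ev z s - ev y s) < e"
      using ev_le_nm[OF _ K, of "z \<ominus> x" s] ev_le_nm[OF _ K, of "z \<ominus> y" s] z z' xy s(1)
      by (auto simp: ev_minus)
    then have "cmod (ev x s - ev y s) < e + e"
      using norm_triangle_lt[of "ev x s - ev z s" "ev z s - ev y s" "e + e"]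
      by (simp add: norm_minus_commute)
    then show False by (simp add: e_def)
  qed
  then have "disjnt (?B x) (?B y)" unfolding disjnt_def by blast
  then show "\<exists>U V. openin (alg_topology A) U \<and> openin (alg_topology A) V \<and> x \<in> U \<and> y \<in> V \<and> disjnt U V"
    using xy e by (intro exI[of _ "?B x"] exI[of _ "?B y"] conjI open_nm_ball K) (auto simp: zero)
qed

text \<open>A Cauchy filter converges pointwise because \<complex> is complete, and the convergence
  is uniform on compact sets. Local compactness makes the limit continuous, so \<open>ev_ex\<close>
  yields an element that represents it.\<close>

lemma complete_A: "complete_algebra A"
  unfolding complete_algebra_def
proof (intro allI impI)
  fix F assume F: "cauchy_filter_on A F"
  then have nb: "F \<noteq> bot" by (simp add: cauchy_filter_on_def)
  have small: "\<exists>S\<subseteq>carrier A. eventually (\<lambda>x. x \<in> S) F \<and> (\<forall>x\<in>S. \<forall>y\<in>S. nm K (x \<ominus> y) < e)"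
    if K: "compactin X K" and e: "0 < e" for K e
  proof -
    let ?U = "{y \<in> carrier A. nm K (y \<ominus> \<zero>) < e}"
    have "nm K (\<zero> \<ominus> \<zero>) = 0"
      using seminorm_zero[OF Cstar_seminormD(1)[OF Cstar_nm[OF K]]] by (simp add: minus_eq)
    then have "\<zero> \<in> ?U" using e by simp
    then obtain S where S: "S \<subseteq> carrier A" "eventually (\<lambda>x. x \<in> S) F" "\<forall>x\<in>S. \<forall>y\<in>S. x \<ominus> y \<in> ?U"
      using F open_nm_ball[OF K zero_closed e] unfolding cauchy_filter_on_def by meson
    have "nm K (x \<ominus> y) < e" if "x \<in> S" "y \<in> S" for x y
    proof -
      have "x \<in> carrier A" "y \<in> carrier A" using S(1) that by auto
      then have "(x \<ominus> y) \<ominus> \<zero> = x \<ominus> y" by (simp add: minus_eq)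
      moreover have "nm K ((x \<ominus> y) \<ominus> \<zero>) < e" using S(3) that by blast
      ultimately show ?thesis by simp
    qed
    with S show ?thesis by (intro exI[of _ S] conjI ballI)
  qed
  have "\<exists>l. ((\<lambda>x. ev x s) \<longlongrightarrow> l) F" if s: "s \<in> topspace X" for s
  proof -
    let ?G = "filtermap (\<lambda>x. ev x s) F"
    have "cauchy_filter ?G"
      unfolding cauchy_filter_metric_filtermap
    proof (intro allI impI)
      fix e :: real assume e: "0 < e"
      have K: "compactin X {s}" using s by simp
      obtain S where S: "S \<subseteq> carrier A" "eventually (\<lambda>x. x \<in> S) F"
        "\<forall>x\<in>S. \<forall>y\<in>S. nm {s} (x \<ominus> y) < e" using small[OF K e] by (elim exE conjE)
      have "dist (ev x s) (ev y s) < e" if xy: "x \<in> S" "y \<in> S" for x y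
      proof -
        have c: "x \<in> carrier A" "y \<in> carrier A" using S(1) xy by auto
        have "cmod (ev (x \<ominus> y) s) \<le> nm {s} (x \<ominus> y)" using c by (intro ev_le_nm K) auto
        also have "\<dots> < e" using S(3) xy by blast
        finally show ?thesis using c s by (simp add: ev_minus dist_norm)
      qed
      with S(2) show "\<exists>P. eventually P F \<and> (\<forall>x y. P x \<and> P y \<longrightarrow> dist (ev x s) (ev y s) < e)"
        by (intro exI[of _ "\<lambda>x. x \<in> S"]) auto
    qed
    moreover have "?G \<noteq> bot" using nb by (simp add: filtermap_bot_iff)
    ultimately obtain l where "?G \<le> nhds l"
      using complete_UNIV[where 'a = complex] unfolding complete_uniform by auto
    then show ?thesis by (auto simp: filterlim_def)
  qed
  then obtain g where g: "\<And>s. s \<in> topspace X \<Longrightarrow> ((\<lambda>x. ev x s) \<longlongrightarrow> g s) F" by metis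
  have unif: "\<exists>S\<subseteq>carrier A. eventually (\<lambda>x. x \<in> S) F \<and> (\<forall>x\<in>S. \<forall>s\<in>K. cmod (ev x s - g s) \<le> e)"
    if K: "compactin X K" and e: "0 < e" for K e
  proof -
    obtain S where S: "S \<subseteq> carrier A" "eventually (\<lambda>x. x \<in> S) F"
      "\<forall>x\<in>S. \<forall>y\<in>S. nm K (x \<ominus> y) < e" using small[OF K e] by (elim exE conjE)
    have "cmod (ev x s - g s) \<le> e" if x: "x \<in> S" and s: "s \<in> K" for x s
    \<comment> \<open>The Cauchy estimate for \<open>x\<close> and \<open>y\<close> passes to the
      limit in \<open>y\<close>.\<close>
    proof (rule tendsto_upperbound)
      have sX: "s \<in> topspace X" using compactin_in_topspace[OF K s] .
      show "((\<lambda>y. cmod (ev x s - ev y s)) \<longlongrightarrow> cmod (ev x s - g s)) F"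
        by (intro tendsto_intros g sX)
      show "eventually (\<lambda>y. cmod (ev x s - ev y s) \<le> e) F"
      proof (rule eventually_mono[OF S(2)])
        fix y assume y: "y \<in> S"
        have c: "x \<in> carrier A" "y \<in> carrier A" using S(1) x y by auto
        have "cmod (ev (x \<ominus> y) s) \<le> nm K (x \<ominus> y)" using c by (intro ev_le_nm K s) auto
        also have "\<dots> < e" using S(3) x y by blast
        finally show "cmod (ev x s - ev y s) \<le> e" using c sX by (simp add: ev_minus)
      qed
    qed (rule nb)
    with S(1,2) show ?thesis by (intro exI[of _ S] conjI ballI)
  qed
  have "continuous_map X euclidean g"
    unfolding continuous_map_def
  proof (intro conjI allI impI)
    fix V :: "complex set" assume "openin euclidean V"
    then have V: "open V" by simp
    show "openin X {s \<in> topspace X. g s \<in> V}"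
    proof (subst openin_subopen, intro ballI)
      fix s assume "s \<in> {s \<in> topspace X. g s \<in> V}"
      then have s: "s \<in> topspace X" "g s \<in> V" by auto
      obtain e where e: "0 < e" "ball (g s) e \<subseteq> V" using openE[OF V s(2)] .
      obtain U K where UK: "openin X U" "compactin X K" "s \<in> U" "U \<subseteq> K"
        using locally_compact_X s(1) unfolding locally_compact_space_def by meson
      \<comment> \<open>One third for each passage between \<open>g\<close> and \<open>ev x\<close>,
        uniform on the compact neighbourhood \<open>K\<close>, and one for the oscillation of
        \<open>ev x\<close>.\<close>
      have e3: "0 < e / 3" using e(1) by simp
      obtain S where S: "S \<subseteq> carrier A" "eventually (\<lambda>x. x \<in> S) F"
        "\<forall>x\<in>S. \<forall>s\<in>K. cmod (ev x s - g s) \<le> e / 3"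
        using unif[OF UK(2) e3] by (elim exE conjE)
      obtain x where x: "x \<in> S" using eventually_happens'[OF nb S(2)] by blast
      have xc: "x \<in> carrier A" using S(1) x by blast
      let ?W = "U \<inter> {t \<in> topspace X. ev x t \<in> ball (ev x s) (e / 3)}"
      have "openin X {t \<in> topspace X. ev x t \<in> ball (ev x s) (e / 3)}"
        using ev_continuous[OF xc] by (rule openin_continuous_map_preimage) simp
      then have W: "openin X ?W" using UK(1) by (intro openin_Int)
      have "?W \<subseteq> {s \<in> topspace X. g s \<in> V}"
      proof
        fix t assume t: "t \<in> ?W"
        have "cmod (ev x s - g s) \<le> e / 3" "cmod (ev x t - g t) \<le> e / 3"
          using S(3) x UK(3,4) t by auto
        moreover have "dist (ev x s) (ev x t) < e / 3" using t by simp
        moreover have "dist (g s) (g t) \<le> dist (g s) (ev x s) + (dist (ev x s) (ev x t) + dist (ev x t) (g t))"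
          by (meson add_left_mono dist_triangle order_trans)
        ultimately have "g t \<in> ball (g s) e" by (simp add: dist_norm norm_minus_commute)
        with e(2) t show "t \<in> {s \<in> topspace X. g s \<in> V}" by auto
      qed
      then show "\<exists>T. openin X T \<and> s \<in> T \<and> T \<subseteq> {s \<in> topspace X. g s \<in> V}"
        using W UK(3) s(1) e(1) by (intro exI[of _ ?W] conjI) auto
    qed
  qed simp
  then obtain l where l: "l \<in> carrier A" "\<forall>s\<in>topspace X. ev l s = g s"
    using ev_ex[of g] by blast
  have "limitin (alg_topology A) (\<lambda>x. x) l F"
    unfolding limitin_def topspace_A
  proof (intro conjI l(1) allI impI)
    fix U assume U: "openin (alg_topology A) U \<and> l \<in> U"
    obtain K e where K: "compactin X K" "0 < e" "{y \<in> carrier A. nm K (y \<ominus> l) < e} \<subseteq> U"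
      using nm_open_nbhd[OF conjunct1[OF U] conjunct2[OF U]] by (elim exE conjE)
    have e2: "0 < e / 2" using K(2) by simp
    obtain S where S: "S \<subseteq> carrier A" "eventually (\<lambda>x. x \<in> S) F"
      "\<forall>x\<in>S. \<forall>s\<in>K. cmod (ev x s - g s) \<le> e / 2"
      using unif[OF K(1) e2] by (elim exE conjE)
    show "eventually (\<lambda>x. x \<in> U) F"
    proof (rule eventually_mono[OF S(2)])
      fix x assume x: "x \<in> S"
      have "nm K (x \<ominus> l) \<le> e / 2"
      proof (rule nm_le)
        fix s assume s: "s \<in> K"
        then show "cmod (ev (x \<ominus> l) s) \<le> e / 2"
          using S(1,3) x l compactin_in_topspace[OF K(1) s] by (auto simp: ev_minus)
      qed (use K(2) in simp)
      then show "x \<in> U" using K(2) S(1) x by (intro subsetD[OF K(3)]) auto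
    qed
  qed
  then show "\<exists>l. limitin (alg_topology A) (\<lambda>x. x) l F" ..
qed

lemma Kstar_A: "Kstar_algebra A"
  unfolding Kstar_algebra_def
proof (intro conjI involutive_A Hausdorff_A complete_A exI[of _ "nm ` {K. compactin X K}"])
  show "\<forall>q\<in>nm ` {K. compactin X K}. Cstar_seminorm A q" using Cstar_nm by auto
qed (rule topology)

text \<open>Every compact set lies in some member of the exhaustion \<open>L\<close>, so the
  countably many seminorms \<open>nm (L n)\<close> generate the topology.\<close>

lemma metrizable_A: "metrizable_space (alg_topology A)"
proof -
  obtain L :: "nat \<Rightarrow> 'p set" where L: "\<forall>n. compactin X (L n)" "\<forall>m n. m \<le> n \<longrightarrow> L m \<subseteq> L n"
    "\<forall>C. compactin X C \<longrightarrow> (\<exists>n. C \<subseteq> L n)"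
    using sigma_compact_exhaustion[OF Hausdorff_X locally_compact_X sigma_compact_X] by (elim exE conjE)
  interpret seq_Kstar_algebra A "\<lambda>n. nm (L n)"
  proof
    show "Cstar_seminorm A (nm (L n))" for n using L(1) Cstar_nm by simp
    show "nm (L m) x \<le> nm (L n) x" if "x \<in> carrier A" "m \<le> n" for x m n
      using that L(1,2) by (intro nm_mono) auto
    show "openin (alg_topology A) U \<longleftrightarrow> U \<subseteq> carrier A \<and>
        (\<forall>x\<in>U. \<exists>n. \<exists>e>0. {y \<in> carrier A. nm (L n) (y \<ominus> x) < e} \<subseteq> U)" for U
    proof
      assume U: "openin (alg_topology A) U"
      then have Uc: "U \<subseteq> carrier A" using openin_subset topspace_A by metis
      have "\<exists>n. \<exists>e>0. {y \<in> carrier A. nm (L n) (y \<ominus> x) < e} \<subseteq> U" if x: "x \<in> U" for x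
      proof -
        obtain K e where K: "compactin X K" "0 < e" "{y \<in> carrier A. nm K (y \<ominus> x) < e} \<subseteq> U"
          using nm_open_nbhd[OF U x] by (elim exE conjE)
        obtain n where n: "K \<subseteq> L n" using L(3) K(1) by blast
        have "{y \<in> carrier A. nm (L n) (y \<ominus> x) < e} \<subseteq> {y \<in> carrier A. nm K (y \<ominus> x) < e}"
        proof
          fix y assume y: "y \<in> {y \<in> carrier A. nm (L n) (y \<ominus> x) < e}"
          have "nm K (y \<ominus> x) \<le> nm (L n) (y \<ominus> x)" using y x Uc n L(1) by (intro nm_mono) auto
          with y show "y \<in> {y \<in> carrier A. nm K (y \<ominus> x) < e}" by simp
        qed
        with K(2,3) show ?thesis by (intro exI[of _ n] exI[of _ e] conjI) auto
      qed
      with Uc show "U \<subseteq> carrier A \<and>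
        (\<forall>x\<in>U. \<exists>n. \<exists>e>0. {y \<in> carrier A. nm (L n) (y \<ominus> x) < e} \<subseteq> U)" by (intro conjI ballI)
    next
      assume U: "U \<subseteq> carrier A \<and>
        (\<forall>x\<in>U. \<exists>n. \<exists>e>0. {y \<in> carrier A. nm (L n) (y \<ominus> x) < e} \<subseteq> U)"
      show "openin (alg_topology A) U"
        unfolding openin_nm_iff
      proof (intro conjI ballI)
        fix x assume x: "x \<in> U"
        obtain n e where "0 < e" "{y \<in> carrier A. nm (L n) (y \<ominus> x) < e} \<subseteq> U"
          using bspec[OF conjunct2[OF U] x] by (elim exE conjE)
        with L(1) show "\<exists>K e. compactin X K \<and> 0 < e \<and> {y \<in> carrier A. nm K (y \<ominus> x) < e} \<subseteq> U"
          by (intro exI[of _ "L n"] exI[of _ e] conjI) auto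
      qed (use U in blast)
    qed
  qed (rule Hausdorff_A complete_A)+
  show ?thesis by (rule metrizable_alg_topology)
qed

end

section \<open>Characters of a function algebra\<close>

context function_algebra
begin

definition point_character :: "'p \<Rightarrow> 'a \<Rightarrow> complex" where
  "point_character s = (\<lambda>x. if x \<in> carrier A then ev x s else 0)"

lemma hermitian_point_character:
  "s \<in> topspace X \<Longrightarrow> hermitian_character A (point_character s)"
  by (rule hermitian_characterI) (simp_all add: point_character_def ev_simps)

lemma continuous_point_character:
  assumes s: "s \<in> topspace X"
  shows "continuous_map (alg_topology A) euclidean (point_character s)"
  unfolding continuous_map_def topspace_A
proof (intro conjI allI impI)
  fix V :: "complex set" assume "openin euclidean V"
  then have V: "open V" by simp
  have K: "compactin X {s}" using s by simp
  show "openin (alg_topology A) {x \<in> carrier A. point_character s x \<in> V}"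
    unfolding openin_nm_iff
  proof (intro conjI ballI)
    fix x assume "x \<in> {x \<in> carrier A. point_character s x \<in> V}"
    then have x: "x \<in> carrier A" "ev x s \<in> V" by (auto simp: point_character_def)
    obtain e where e: "0 < e" "ball (ev x s) e \<subseteq> V" using openE[OF V x(2)] .
    have "{y \<in> carrier A. nm {s} (y \<ominus> x) < e} \<subseteq> {x \<in> carrier A. point_character s x \<in> V}"
    proof
      fix y assume y: "y \<in> {y \<in> carrier A. nm {s} (y \<ominus> x) < e}"
      then have yc: "y \<in> carrier A" by simp
      have "cmod (ev (y \<ominus> x) s) \<le> nm {s} (y \<ominus> x)" using x yc by (intro ev_le_nm K) auto
      also have "\<dots> < e" using y by simp
      finally have "ev y s \<in> ball (ev x s) e"
        using x yc s by (simp add: ev_minus dist_norm norm_minus_commute)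
      with e(2) yc show "y \<in> {x \<in> carrier A. point_character s x \<in> V}"
        by (auto simp: point_character_def)
    qed
    with e(1) K show "\<exists>K e. compactin X K \<and> 0 < e \<and>
        {y \<in> carrier A. nm K (y \<ominus> x) < e} \<subseteq> {x \<in> carrier A. point_character s x \<in> V}"
      by (intro exI[of _ "{s}"] exI[of _ e] conjI)
  qed auto
qed simp

lemma point_character_in: "s \<in> topspace X \<Longrightarrow> point_character s \<in> characters A"
  using hermitian_point_character continuous_point_character
  by (simp add: characters_def continuous_hermitian_characters_eq point_character_def)

text \<open>The sum of all y star y stays in the kernel of \<open>\<phi>\<close> and dominates each
  |y|^2, so finitely many kernel elements are replaced by one that is positive where any of them is
  non-zero.\<close>

lemma character_vanishing:
  assumes \<phi>: "hermitian_character A \<phi>" and D: "finite D" "D \<subseteq> carrier A" "\<And>y. y \<in> D \<Longrightarrow> \<phi> y = 0"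
  shows "\<exists>z\<in>carrier A. \<phi> z = 0 \<and>
    (\<forall>s\<in>topspace X. Im (ev z s) = 0 \<and> 0 \<le> Re (ev z s) \<and> (\<forall>y\<in>D. (cmod (ev y s))\<^sup>2 \<le> Re (ev z s)))"
  using D
proof (induction D rule: finite_induct)
  case empty
  show ?case by (intro bexI[of _ \<zero>]) (simp_all add: character_zero[OF \<phi>] ev_zero)
next
  case (insert y D)
  obtain z where z: "z \<in> carrier A" "\<phi> z = 0"
    "\<forall>s\<in>topspace X. Im (ev z s) = 0 \<and> 0 \<le> Re (ev z s) \<and> (\<forall>y\<in>D. (cmod (ev y s))\<^sup>2 \<le> Re (ev z s))"
    using insert.IH insert.prems by (auto simp del: zero_closed)
  let ?z = "z \<oplus> y \<otimes> star A y"
  have y: "y \<in> carrier A" "\<phi> y = 0" using insert.prems by auto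
  have ev_z: "ev ?z s = ev z s + of_real ((cmod (ev y s))\<^sup>2)" if "s \<in> topspace X" for s
    using z(1) y(1) that by (simp add: ev_simps complex_norm_square del: of_real_power)
  show ?case
  proof (intro bexI[of _ ?z] conjI ballI)
    show "\<phi> ?z = 0" using z(1,2) y by (simp add: character_simps[OF \<phi>])
    fix s assume s: "s \<in> topspace X"
    have zs: "Im (ev z s) = 0" "0 \<le> Re (ev z s)" "\<forall>y\<in>D. (cmod (ev y s))\<^sup>2 \<le> Re (ev z s)"
      using bspec[OF z(3) s] by auto
    have Re: "Re (ev ?z s) = Re (ev z s) + (cmod (ev y s))\<^sup>2"
      unfolding ev_z[OF s] plus_complex.sel Re_complex_of_real ..
    show "Im (ev ?z s) = 0"
      unfolding ev_z[OF s] plus_complex.sel Im_complex_of_real using zs(1) by simp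
    show "0 \<le> Re (ev ?z s)" unfolding Re using zs(2) by simp
    fix y' assume "y' \<in> insert y D"
    then show "(cmod (ev y' s))\<^sup>2 \<le> Re (ev ?z s)"
      unfolding Re using zs by (auto intro: add_increasing2)
  qed (use z(1) y(1) in simp)
qed

text \<open>Let \<open>K\<close> be a compact set whose seminorm controls \<open>\<phi>\<close>. If
  \<open>\<phi>\<close> differs from every evaluation, some element of its kernel is positive on
  \<open>K\<close>. Altered outside \<open>K\<close> it becomes invertible without leaving the
  kernel, which is impossible.\<close>

lemma characters_are_points:
  assumes \<phi>: "\<phi> \<in> characters A"
  shows "\<exists>s\<in>topspace X. \<phi> = point_character s"
proof (rule ccontr)
  assume neg: "\<not> (\<exists>s\<in>topspace X. \<phi> = point_character s)"
  have h: "hermitian_character A \<phi>" and cont: "continuous_map (alg_topology A) euclidean \<phi>"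
    using \<phi> by (simp_all add: characters_def continuous_hermitian_characters_eq)
  have off: "\<phi> x = 0" if "x \<notin> carrier A" for x using \<phi> that by (simp add: characters_def)
  let ?U = "{x \<in> topspace (alg_topology A). \<phi> x \<in> ball 0 1}"
  have "openin (alg_topology A) ?U" using cont by (rule openin_continuous_map_preimage) simp
  moreover have "\<zero> \<in> ?U" by (simp add: topspace_A character_zero[OF h])
  ultimately obtain K e where K: "compactin X K" and e: "0 < e" "{y \<in> carrier A. nm K (y \<ominus> \<zero>) < e} \<subseteq> ?U"
    using nm_open_nbhd by meson
  \<comment> \<open>An \<open>x\<close> that vanishes on \<open>K\<close> with \<phi> x \<noteq> 0
    could be rescaled to \<phi> x = 1 and would still lie in the neighbourhood where |\<phi>| <
    1.\<close>
  have vanish: "\<phi> x = 0" if x: "x \<in> carrier A" "nm K x = 0" for x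
  proof (rule ccontr)
    assume nz: "\<phi> x \<noteq> 0"
    let ?y = "inverse (\<phi> x) \<odot> x"
    have "nm K ?y = 0" using x Cstar_seminormD(1)[OF Cstar_nm[OF K]] by (simp add: seminorm_smult)
    then have "?y \<in> {y \<in> carrier A. nm K (y \<ominus> \<zero>) < e}" using x e(1) by (simp add: minus_eq)
    then have "\<phi> ?y \<in> ball 0 1" using e(2) by blast
    then show False using nz x by (simp add: character_smult[OF h])
  qed
  have "\<exists>y. y \<in> carrier A \<and> \<phi> y = 0 \<and> ev y s \<noteq> 0" if s: "s \<in> K" for s
  proof -
    have sX: "s \<in> topspace X" using compactin_in_topspace[OF K s] .
    then have "\<phi> \<noteq> point_character s" using neg by blast
    then obtain x where x: "\<phi> x \<noteq> point_character s x" by (auto simp: fun_eq_iff)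
    then have xc: "x \<in> carrier A"
      using off[of x] by (cases "x \<in> carrier A") (simp_all add: point_character_def)
    have "ev (x \<ominus> \<phi> x \<odot> \<one>) s \<noteq> 0"
      using x xc sX by (simp add: ev_minus ev_simps point_character_def)
    moreover have "\<phi> (x \<ominus> \<phi> x \<odot> \<one>) = 0" using xc by (simp add: character_simps[OF h])
    ultimately show ?thesis using xc by (intro exI[of _ "x \<ominus> \<phi> x \<odot> \<one>"]) simp
  qed
  then obtain w where w: "\<forall>s\<in>K. w s \<in> carrier A \<and> \<phi> (w s) = 0 \<and> ev (w s) s \<noteq> 0"
    using bchoice[of K "\<lambda>s y. y \<in> carrier A \<and> \<phi> y = 0 \<and> ev y s \<noteq> 0"] by blast
  define O' where "O' s = {t \<in> topspace X. ev (w s) t \<in> - {0}}" for s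
  have "openin X (O' s)" if "s \<in> K" for s
    unfolding O'_def
    by (rule openin_continuous_map_preimage[OF ev_continuous]) (use w that in auto)
  then have "\<forall>V\<in>O' ` K. openin X V" by simp
  moreover have "K \<subseteq> \<Union>(O' ` K)"
    unfolding O'_def using w compactin_in_topspace[OF K] by auto
  ultimately obtain \<F> where \<F>: "finite \<F>" "\<F> \<subseteq> O' ` K" "K \<subseteq> \<Union>\<F>"
    using K unfolding compactin_def by meson
  obtain I where I: "I \<subseteq> K" "finite I" "\<F> = O' ` I"
    using finite_subset_image[OF \<F>(1,2)] by (elim exE conjE)
  obtain z where z: "z \<in> carrier A" "\<phi> z = 0"
    "\<forall>s\<in>topspace X. Im (ev z s) = 0 \<and> 0 \<le> Re (ev z s) \<and> (\<forall>y\<in>w ` I. (cmod (ev y s))\<^sup>2 \<le> Re (ev z s))"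
    using character_vanishing[OF h, of "w ` I"] I w by (auto simp del: zero_closed)
  have pos: "0 < Re (ev z s)" if s: "s \<in> K" for s
  proof -
    obtain i where i: "i \<in> I" "s \<in> O' i" using \<F>(3) I(3) s by blast
    then have "0 < (cmod (ev (w i) s))\<^sup>2" by (simp add: O'_def)
    also have "\<dots> \<le> Re (ev z s)" using bspec[OF z(3) compactin_in_topspace[OF K s]] i(1) by blast
    finally show ?thesis .
  qed
  have Re_cont: "continuous_map X euclideanreal (\<lambda>s. Re (ev z s))"
    using continuous_map_compose[OF ev_continuous[OF z(1)], of euclideanreal Re]
    by (simp add: o_def continuous_on_Re)
  have "\<exists>\<delta>>0. \<forall>s\<in>K. \<delta> \<le> Re (ev z s)"
  proof (cases "K = {}")
    \<comment> \<open>\<open>K\<close> can be empty, as in the empty space; any positive constant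
      will do.\<close>
    case True
    then show ?thesis by (intro exI[of _ 1]) simp
  next
    case False
    have "compact ((\<lambda>s. Re (ev z s)) ` K)" using image_compactin[OF K Re_cont] by simp
    then obtain \<delta> where \<delta>: "\<delta> \<in> (\<lambda>s. Re (ev z s)) ` K" "\<forall>t\<in>(\<lambda>s. Re (ev z s)) ` K. \<delta> \<le> t"
      using compact_attains_inf[of "(\<lambda>s. Re (ev z s)) ` K"] False by blast
    have "0 < \<delta>" using \<delta>(1) pos by auto
    with \<delta>(2) show ?thesis by (intro exI[of _ \<delta>]) simp
  qed
  then obtain \<delta> where \<delta>: "0 < \<delta>" "\<forall>s\<in>K. \<delta> \<le> Re (ev z s)" by (elim exE conjE)
  \<comment> \<open>\<open>g\<close> agrees with \<open>z\<close> on \<open>K\<close>, where Re z is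
    at least \<delta>, and stays above \<delta> everywhere else, so its inverse is continuous
    too.\<close>
  define g where "g s = complex_of_real (max (Re (ev z s)) \<delta>)" for s
  have g0: "g s \<noteq> 0" for s using \<delta>(1) by (simp add: g_def max_def)
  have "continuous_on UNIV (\<lambda>r. complex_of_real (max r \<delta>))" by (intro continuous_intros)
  then have "continuous_map X euclidean ((\<lambda>r. complex_of_real (max r \<delta>)) \<circ> (\<lambda>s. Re (ev z s)))"
    by (intro continuous_map_compose[OF Re_cont]) simp
  then have g_cont: "continuous_map X euclidean g" by (simp add: o_def g_def[abs_def])
  have "continuous_on UNIV (\<lambda>r. inverse (complex_of_real (max r \<delta>)))"
    using \<delta>(1) by (intro continuous_intros) (auto simp: max_def)
  then have "continuous_map X euclidean ((\<lambda>r. inverse (complex_of_real (max r \<delta>))) \<circ> (\<lambda>s. Re (ev z s)))"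
    by (intro continuous_map_compose[OF Re_cont]) simp
  then have inv_cont: "continuous_map X euclidean (\<lambda>s. inverse (g s))" by (simp add: o_def g_def[abs_def])
  obtain a where a: "a \<in> carrier A" "\<forall>s\<in>topspace X. ev a s = g s" using ev_ex[OF g_cont] by (elim bexE)
  obtain b where b: "b \<in> carrier A" "\<forall>s\<in>topspace X. ev b s = inverse (g s)" using ev_ex[OF inv_cont] by (elim bexE)
  have "a \<otimes> b = \<one>"
    using a b g0 by (intro ev_eqI) (simp_all add: ev_simps)
  moreover have "\<phi> a = 0"
  proof -
    have "nm K (a \<ominus> z) \<le> 0"
    proof (rule nm_le)
      fix s assume s: "s \<in> K"
      have sX: "s \<in> topspace X" using compactin_in_topspace[OF K s] .
      have "ev a s = ev z s"
        using bspec[OF a(2) sX] bspec[OF z(3) sX] bspec[OF \<delta>(2) s]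
        by (simp add: g_def max_def complex_eq_iff)
      then show "cmod (ev (a \<ominus> z) s) \<le> 0" using a(1) z(1) sX by (simp add: ev_minus)
    qed simp
    then have "nm K (a \<ominus> z) = 0" using nm_nonneg[OF minus_closed[OF a(1) z(1)] K] by simp
    then have "\<phi> (a \<ominus> z) = 0" using a(1) z(1) by (intro vanish) auto
    then show ?thesis using a(1) z(1,2) by (simp add: character_minus[OF h])
  qed
  ultimately show False using a(1) b(1) character_mult[OF h a(1) b(1)] character_one[OF h] by simp
qed

lemma characters_A: "characters A = point_character ` topspace X"
  using point_character_in characters_are_points by blast

lemma completely_regular_X: "completely_regular_space X"
  using locally_compact_regular_imp_completely_regular_space[OF locally_compact_X] Hausdorff_X by blast

text \<open>Locally compact Hausdorff spaces are completely regular; the bump is 1 - f for a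
  function \<open>f\<close> that separates \<open>s\<close> from the complement of
  \<open>U\<close>.\<close>

lemma ex_bump:
  assumes U: "openin X U" "s \<in> U"
  shows "\<exists>a\<in>carrier A. ev a s = 1 \<and> (\<forall>t\<in>topspace X - U. ev a t = 0)"
proof -
  obtain f where f: "continuous_map X euclideanreal f" "f s = 0" "f ` (topspace X - U) \<subseteq> {1}"
    using completely_regular_X U unfolding completely_regular_space_alt' by meson
  have "continuous_on UNIV (\<lambda>r. complex_of_real (1 - r))" by (intro continuous_intros)
  then have "continuous_map X euclidean ((\<lambda>r. complex_of_real (1 - r)) \<circ> f)"
    by (intro continuous_map_compose[OF f(1)]) simp
  then obtain a where a: "a \<in> carrier A" "\<forall>t\<in>topspace X. ev a t = ((\<lambda>r. complex_of_real (1 - r)) \<circ> f) t"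
    using ev_ex by blast
  have "s \<in> topspace X" using openin_subset[OF U(1)] U(2) by blast
  with a f(2,3) show ?thesis by (intro bexI[of _ a] conjI ballI) (auto simp: image_subset_iff)
qed

text \<open>A character is the evaluation at a point \<open>s\<close>. A bump at \<open>s\<close>
  supported in a compact neighbourhood \<open>K\<close> annihilates every function that vanishes on
  \<open>K\<close>, and these form the kernel of \<open>nm K\<close>.\<close>

lemma lcstar_A: "lcstar_algebra A"
  unfolding lcstar_algebra_def
proof (intro conjI Kstar_A ballI)
  fix \<phi> assume \<phi>: "\<phi> \<in> continuous_hermitian_characters A"
  then have h: "hermitian_character A \<phi>" and c: "continuous_map (alg_topology A) euclidean \<phi>"
    by (simp_all add: continuous_hermitian_characters_eq)
  \<comment> \<open>The characters in the definition are arbitrary off the carrier;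
    \<open>characters_A\<close> applies to the normalized version.\<close>
  let ?\<psi> = "\<lambda>x. if x \<in> carrier A then \<phi> x else 0"
  have "hermitian_character A ?\<psi>" by (rule hermitian_characterI) (simp_all add: character_simps[OF h])
  moreover have "continuous_map (alg_topology A) euclidean ?\<psi>"
    using c by (rule continuous_map_eq) (simp add: topspace_A)
  ultimately have "?\<psi> \<in> characters A"
    by (simp add: characters_def continuous_hermitian_characters_eq)
  then obtain s where s: "s \<in> topspace X" "?\<psi> = point_character s"
    using characters_A by auto
  have \<phi>_ev: "\<phi> x = ev x s" if "x \<in> carrier A" for x
    using fun_cong[OF s(2), of x] that by (simp add: point_character_def)
  obtain U K where UK: "openin X U" "compactin X K" "s \<in> U" "U \<subseteq> K"
    using locally_compact_X s(1) unfolding locally_compact_space_def by meson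
  obtain a where a: "a \<in> carrier A" "ev a s = 1" "\<forall>t\<in>topspace X - U. ev a t = 0"
    using ex_bump[OF UK(1,3)] by (elim bexE conjE)
  have ann: "a \<otimes> x = \<zero>" if x: "x \<in> carrier A" "nm K x = 0" for x
  proof (rule ev_eqI)
    fix t assume t: "t \<in> topspace X"
    show "ev (a \<otimes> x) t = ev \<zero> t"
    proof (cases "t \<in> U")
      case True
      then have "cmod (ev x t) \<le> 0" using ev_le_nm[OF x(1) UK(2), of t] UK(4) x(2) by auto
      then show ?thesis using a(1) x(1) t by (simp add: ev_simps)
    next
      case False
      then show ?thesis using a x(1) t by (simp add: ev_simps)
    qed
  qed (use a x in simp_all)
  \<comment> \<open>The image of the kernel has to equal {\<zero>}, so it must be non-empty.\<close>
  have "\<zero> \<in> seminorm_kernel A (nm K)"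
    by (simp add: seminorm_kernel_def seminorm_zero[OF Cstar_seminormD(1)[OF Cstar_nm[OF UK(2)]]])
  then have ker: "(\<lambda>x. a \<otimes> x) ` seminorm_kernel A (nm K) = {\<zero>}"
    using a(1) ann by (intro equalityI image_subsetI subsetI)
      (auto simp: seminorm_kernel_def intro!: image_eqI[of _ _ \<zero>])
  have "continuous_map (alg_topology A) euclidean (nm K)"
    unfolding continuous_map_def topspace_A
  proof (intro conjI allI impI)
    fix V :: "real set" assume "openin euclidean V"
    then have V: "open V" by simp
    show "openin (alg_topology A) {x \<in> carrier A. nm K x \<in> V}"
      unfolding openin_nm_iff
    proof (intro conjI ballI)
      fix x assume "x \<in> {x \<in> carrier A. nm K x \<in> V}"
      then have x: "x \<in> carrier A" "nm K x \<in> V" by auto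
      obtain e where e: "0 < e" "ball (nm K x) e \<subseteq> V" using openE[OF V x(2)] .
      note sn = Cstar_seminormD(1)[OF Cstar_nm[OF UK(2)]]
      have "{y \<in> carrier A. nm K (y \<ominus> x) < e} \<subseteq> {x \<in> carrier A. nm K x \<in> V}"
      proof
        fix y assume y: "y \<in> {y \<in> carrier A. nm K (y \<ominus> x) < e}"
        then have "\<bar>nm K x - nm K y\<bar> < e"
          using seminorm_minus_ge[OF sn, of x y] seminorm_minus_ge[OF sn, of y x] x(1)
            seminorm_minus_commute[OF sn, of x y] by auto
        then have "nm K y \<in> ball (nm K x) e" by (simp add: dist_real_def)
        with e(2) y show "y \<in> {x \<in> carrier A. nm K x \<in> V}" by auto
      qed
      with e(1) UK(2) show "\<exists>K' e. compactin X K' \<and> 0 < e \<and>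
          {y \<in> carrier A. nm K' (y \<ominus> x) < e} \<subseteq> {x \<in> carrier A. nm K x \<in> V}"
        by (intro exI[of _ K] exI[of _ e] conjI)
    qed auto
  qed simp
  then show "\<exists>a\<in>carrier A. \<exists>q. Cstar_seminorm A q \<and> continuous_map (alg_topology A) euclidean q \<and>
      \<phi> a = 1 \<and> (\<lambda>x. a \<otimes> x) ` seminorm_kernel A q = {\<zero>}"
    using Cstar_nm[OF UK(2)] \<phi>_ev[OF a(1)] a(2) ker
    by (intro bexI[OF _ a(1)] exI[of _ "nm K"] conjI) simp_all
qed

text \<open>Bump functions serve twice: they separate the points of X, and their non-vanishing sets
  show that the map is open.\<close>

lemma homeomorphic_point_character:
  "homeomorphic_map X (top_of_set (characters A)) point_character"
proof (rule bijective_open_imp_homeomorphic_map)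
  have "continuous_map X (product_topology (\<lambda>_. euclidean) UNIV) point_character"
    unfolding continuous_map_componentwise_UNIV
  proof
    fix x show "continuous_map X euclidean (\<lambda>s. point_character s x)"
      using ev_continuous[of x] by (cases "x \<in> carrier A") (simp_all add: point_character_def)
  qed
  then show "continuous_map X (top_of_set (characters A)) point_character"
    using point_character_in
    by (simp add: euclidean_product_topology continuous_map_in_subtopology image_subset_iff)
  show "point_character ` topspace X = topspace (top_of_set (characters A))"
    using characters_A by simp
  show "inj_on point_character (topspace X)"
  proof (rule inj_onI, rule ccontr)
    fix s t assume s: "s \<in> topspace X" and t: "t \<in> topspace X"
      and eq: "point_character s = point_character t" and ne: "s \<noteq> t"
    obtain U V where UV: "openin X U" "s \<in> U" "t \<in> V" "disjnt U V"
      using Hausdorff_X s t ne unfolding Hausdorff_space_def by meson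
    obtain a where a: "a \<in> carrier A" "ev a s = 1" "\<forall>t\<in>topspace X - U. ev a t = 0"
      using ex_bump[OF UV(1,2)] by (elim bexE conjE)
    have "ev a t = 0" using a(3) t UV(3,4) by (auto simp: disjnt_def)
    with a(1,2) fun_cong[OF eq, of a] show False by (simp add: point_character_def)
  qed
  show "open_map X (top_of_set (characters A)) point_character"
    unfolding open_map_def
  proof (intro allI impI)
    fix U assume U: "openin X U"
    show "openin (top_of_set (characters A)) (point_character ` U)"
    proof (subst openin_subopen, intro ballI)
      fix \<psi> assume "\<psi> \<in> point_character ` U"
      then obtain s where s: "s \<in> U" "\<psi> = point_character s" by blast
      obtain a where a: "a \<in> carrier A" "ev a s = 1" "\<forall>t\<in>topspace X - U. ev a t = 0"
        using ex_bump[OF U s(1)] by (elim bexE conjE)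
      let ?T = "characters A \<inter> {f. f a \<noteq> 0}"
      have "open {f :: 'a \<Rightarrow> complex. f a \<noteq> 0}"
        by (intro open_Collect_neq continuous_on_apply continuous_intros)
      then have "openin (top_of_set (characters A)) ?T" by (rule openin_open_Int)
      moreover have "\<psi> \<in> ?T"
        using s a(1,2) openin_subset[OF U] by (auto simp: characters_A) (simp add: point_character_def)
      moreover have "?T \<subseteq> point_character ` U"
        using a(1,3) by (auto simp: characters_A point_character_def)
      ultimately show "\<exists>T. openin (top_of_set (characters A)) T \<and> \<psi> \<in> T \<and> T \<subseteq> point_character ` U"
        by (intro exI conjI)
    qed
  qed
qed

lemma homeomorphic_space_X_spectrum: "spectrum A homeomorphic_space X"
  using homeomorphic_space_spectrum homeomorphic_point_character
  by (meson homeomorphic_map_imp_homeomorphic_space homeomorphic_space_sym homeomorphic_space_trans)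

end

section \<open>A copy of the algebra of continuous functions on a prescribed type\<close>

text \<open>Continuous functions have type \<open>'p \<Rightarrow> complex\<close>, whereas the
  algebras of the category have elements of type \<open>'u\<close>; the whole structure is
  transported along \<open>\<iota>\<close>.\<close>

lemma function_algebra_exists:
  fixes X :: "'p topology" and \<iota> :: "('p \<Rightarrow> complex) \<Rightarrow> 'u"
  assumes X: "Hausdorff_space X" "locally_compact_space X" "sigma_compact_space X"
    and inj: "inj_on \<iota> {f \<in> extensional (topspace X). continuous_map X euclidean f}"
  shows "\<exists>A ev nm. function_algebra X A ev nm \<and>
    carrier A = \<iota> ` {f \<in> extensional (topspace X). continuous_map X euclidean f}"
proof -
  let ?C = "{f \<in> extensional (topspace X). continuous_map X euclidean f}"
  let ?c = "\<lambda>f. \<iota> (restrict f (topspace X))"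
  define ev where "ev x = inv_into ?C \<iota> x" for x
  define nm where "nm K x = Sup (insert 0 ((\<lambda>s. cmod (ev x s)) ` K))" for K x
  \<comment> \<open>\<open>seminorm_topology\<close> refers to the carrier and the difference of an
    algebra, so the operations are fixed in \<open>A0\<close> and the topology is filled in
    afterwards.\<close>
  define A0 where "A0 = \<lparr>carrier = \<iota> ` ?C, mult = (\<lambda>x y. ?c (\<lambda>s. ev x s * ev y s)), one = ?c (\<lambda>_. 1),
    zero = ?c (\<lambda>_. 0), add = (\<lambda>x y. ?c (\<lambda>s. ev x s + ev y s)), smult = (\<lambda>c x. ?c (\<lambda>s. c * ev x s)),
    star = (\<lambda>x. ?c (\<lambda>s. cnj (ev x s))), alg_topology = undefined\<rparr>"
  define A where "A = A0\<lparr>alg_topology := seminorm_topology A0 (nm ` {K. compactin X K})\<rparr>"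
  have sel: "carrier A = \<iota> ` ?C" "mult A = (\<lambda>x y. ?c (\<lambda>s. ev x s * ev y s))" "one A = ?c (\<lambda>_. 1)"
    "zero A = ?c (\<lambda>_. 0)" "add A = (\<lambda>x y. ?c (\<lambda>s. ev x s + ev y s))"
    "smult A = (\<lambda>c x. ?c (\<lambda>s. c * ev x s))" "star A = (\<lambda>x. ?c (\<lambda>s. cnj (ev x s)))"
    by (simp_all add: A_def A0_def)
  have evC: "ev x \<in> ?C" if "x \<in> carrier A" for x
    using that unfolding ev_def sel by (rule inv_into_into)
  have \<iota>_ev: "\<iota> (ev x) = x" if "x \<in> carrier A" for x
    using that unfolding ev_def sel by (rule f_inv_into_f)
  have c: "?c f \<in> carrier A" and ev_c: "s \<in> topspace X \<Longrightarrow> ev (?c f) s = f s"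
    if "continuous_map X euclidean f" for f s
  proof -
    have "continuous_map X euclidean (restrict f (topspace X))"
      using that by (rule continuous_map_eq) simp
    then have fC: "restrict f (topspace X) \<in> ?C" by simp
    then show "?c f \<in> carrier A" unfolding sel by (rule imageI)
    show "ev (?c f) s = f s" if "s \<in> topspace X"
      unfolding ev_def inv_into_f_f[OF inj fC] using that by simp
  qed
  have cont: "continuous_map X euclidean (ev x)" if "x \<in> carrier A" for x using evC[OF that] by simp
  have cont2: "continuous_map X euclidean (\<lambda>s. ev x s * ev y s)"
    "continuous_map X euclidean (\<lambda>s. ev x s + ev y s)"
    if "x \<in> carrier A" "y \<in> carrier A" for x y
  proof -
    have pr: "continuous_map X euclidean (\<lambda>s. (ev x s, ev y s))"
      using cont[OF that(1)] cont[OF that(2)]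
      by (simp add: continuous_map_paired flip: prod_topology_euclidean)
    show "continuous_map X euclidean (\<lambda>s. ev x s * ev y s)"
      using continuous_map_compose[OF pr, of euclidean "\<lambda>(a, b). a * b"]
      by (simp add: o_def case_prod_unfold continuous_intros)
    show "continuous_map X euclidean (\<lambda>s. ev x s + ev y s)"
      using continuous_map_compose[OF pr, of euclidean "\<lambda>(a, b). a + b"]
      by (simp add: o_def case_prod_unfold continuous_intros)
  qed
  have cont1: "continuous_map X euclidean (\<lambda>s. c * ev x s)"
    "continuous_map X euclidean (\<lambda>s. cnj (ev x s))"
    if "x \<in> carrier A" for x c
  proof -
    show "continuous_map X euclidean (\<lambda>s. c * ev x s)"
      using continuous_map_compose[OF cont[OF that], of euclidean "\<lambda>a. c * a"]
      by (simp add: o_def continuous_intros)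
    show "continuous_map X euclidean (\<lambda>s. cnj (ev x s))"
      using continuous_map_compose[OF cont[OF that], of euclidean cnj]
      by (simp add: o_def continuous_intros)
  qed
  \<comment> \<open>Carrier and difference do not depend on the topology field, so \<open>A0\<close>
    and \<open>A\<close> have the same seminorm topology.\<close>
  have minus_eq: "x \<ominus>\<^bsub>A\<^esub> y = x \<ominus>\<^bsub>A0\<^esub> y" and carrier_eq: "carrier A = carrier A0" for x y
    by (simp_all add: A_def a_minus_def a_inv_def m_inv_def)
  have top: "alg_topology A = seminorm_topology A0 (nm ` {K. compactin X K})"
    by (simp add: A_def)
  have "function_algebra X A ev nm"
  proof
    show "x = y" if "x \<in> carrier A" "y \<in> carrier A" "\<And>s. s \<in> topspace X \<Longrightarrow> ev x s = ev y s" for x y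
    proof -
      have "ev x = ev y" using evC[OF that(1)] evC[OF that(2)] that(3)
        by (intro extensionalityI[of _ "topspace X"]) auto
      then have "\<iota> (ev x) = \<iota> (ev y)" by (rule arg_cong)
      then show ?thesis unfolding \<iota>_ev[OF that(1)] \<iota>_ev[OF that(2)] .
    qed
    show "\<exists>x\<in>carrier A. \<forall>s\<in>topspace X. ev x s = f s" if "continuous_map X euclidean f" for f
      using c[OF that] ev_c[OF that] by (intro bexI[of _ "?c f"] ballI)
    show "alg_topology A = seminorm_topology A (nm ` {K. compactin X K})"
      unfolding top seminorm_topology_def minus_eq carrier_eq ..
    fix x y s and k :: complex
    show "\<one>\<^bsub>A\<^esub> \<in> carrier A" "\<zero>\<^bsub>A\<^esub> \<in> carrier A" unfolding sel(3,4) by (rule c, simp)+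
    show "ev \<one>\<^bsub>A\<^esub> s = 1" "ev \<zero>\<^bsub>A\<^esub> s = 0" if "s \<in> topspace X"
      unfolding sel(3,4) by (subst ev_c, simp_all add: that)+
    assume x: "x \<in> carrier A"
    show "k \<odot>\<^bsub>A\<^esub> x \<in> carrier A" "star A x \<in> carrier A"
      unfolding sel(6,7) by (rule c, rule cont1[OF x])+
    show "ev (k \<odot>\<^bsub>A\<^esub> x) s = k * ev x s" "ev (star A x) s = cnj (ev x s)" if "s \<in> topspace X"
      unfolding sel(6,7) by (rule ev_c[OF cont1(1)[OF x] that], rule ev_c[OF cont1(2)[OF x] that])
    assume y: "y \<in> carrier A"
    show "x \<otimes>\<^bsub>A\<^esub> y \<in> carrier A" "x \<oplus>\<^bsub>A\<^esub> y \<in> carrier A"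
      unfolding sel(2,5) by (rule c, rule cont2[OF x y])+
    show "ev (x \<otimes>\<^bsub>A\<^esub> y) s = ev x s * ev y s" "ev (x \<oplus>\<^bsub>A\<^esub> y) s = ev x s + ev y s" if "s \<in> topspace X"
      unfolding sel(2,5) by (rule ev_c[OF cont2(1)[OF x y] that], rule ev_c[OF cont2(2)[OF x y] that])
  qed (rule X cont nm_def | assumption)+
  then show ?thesis using sel(1) by (intro exI conjI)
qed

section \<open>Cardinality of function algebras\<close>

text \<open>Open subsets of \<complex> are sigma-compact, so their preimages in X are countable
  unions of compact sets, each covered by finitely many base sets inside the preimage.\<close>

lemma open_preimage_countable_union:
  fixes f :: "'p \<Rightarrow> complex"
  assumes X: "sigma_compact_space X" and f: "continuous_map X euclidean f"
    and base: "\<And>V. V \<in> \<B> \<Longrightarrow> openin X V"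
      "\<And>U x. openin X U \<Longrightarrow> x \<in> U \<Longrightarrow> \<exists>V\<in>\<B>. x \<in> V \<and> V \<subseteq> U"
    and S: "open S"
  shows "\<exists>c :: nat \<Rightarrow> 'p set. range c \<subseteq> insert {} \<B> \<and> {x \<in> topspace X. f x \<in> S} = (\<Union>n. c n)"
proof -
  let ?W = "{x \<in> topspace X. f x \<in> S}"
  have W: "openin X ?W" using f S by (intro openin_continuous_map_preimage) auto
  obtain K :: "nat \<Rightarrow> 'p set" where K: "\<forall>n. compactin X (K n)" "topspace X = (\<Union>n. K n)"
    using sigma_compact_imp_compact_sequence[OF X] by (elim exE conjE)
  obtain C :: "nat \<Rightarrow> complex set" where C: "\<And>n. compact (C n)" "\<Union>(range C) = S"
    using open_Union_compact_subsets[OF S] by metis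
  let ?L = "\<lambda>m n. {x \<in> topspace X. f x \<in> C m} \<inter> K n"
  have "\<exists>\<F>. finite \<F> \<and> \<F> \<subseteq> \<B> \<and> ?L m n \<subseteq> \<Union>\<F> \<and> \<Union>\<F> \<subseteq> ?W" for m n
  proof -
    have "closedin X {x \<in> topspace X. f x \<in> C m}"
      using f by (rule closedin_continuous_map_preimage) (simp add: compact_imp_closed C(1))
    then have L: "compactin X (?L m n)" using K(1) by (simp add: closed_Int_compactin)
    let ?V = "{V \<in> \<B>. V \<subseteq> ?W}"
    have "?L m n \<subseteq> \<Union>?V"
    proof
      fix x assume "x \<in> ?L m n"
      then have "x \<in> ?W" using C(2) by auto
      then obtain V where "V \<in> \<B>" "x \<in> V" "V \<subseteq> ?W" using base(2)[OF W] by meson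
      then show "x \<in> \<Union>?V" by blast
    qed
    moreover have "\<forall>V\<in>?V. openin X V" using base(1) by simp
    ultimately obtain \<F> where \<F>: "finite \<F>" "\<F> \<subseteq> ?V" "?L m n \<subseteq> \<Union>\<F>"
      using L unfolding compactin_def by meson
    then show ?thesis by (intro exI[of _ \<F>] conjI) auto
  qed
  then have "\<exists>\<F>. \<forall>m n. finite (\<F> m n) \<and> \<F> m n \<subseteq> \<B> \<and> ?L m n \<subseteq> \<Union>(\<F> m n) \<and> \<Union>(\<F> m n) \<subseteq> ?W"
    by (intro choice allI)
  then obtain \<F> where \<F>: "\<forall>m n. finite (\<F> m n) \<and> \<F> m n \<subseteq> \<B> \<and> ?L m n \<subseteq> \<Union>(\<F> m n) \<and> \<Union>(\<F> m n) \<subseteq> ?W" ..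
  \<comment> \<open>The empty set ensures that there is something to enumerate when the preimage is
    empty.\<close>
  let ?G = "insert {} (\<Union>m n. \<F> m n)"
  have "countable ?G" using \<F> by (intro countable_insert countable_UN) (auto intro: countable_finite)
  then have r: "range (from_nat_into ?G) = ?G" by (intro range_from_nat_into) auto
  have "?W \<subseteq> \<Union>?G"
  proof
    fix x assume x: "x \<in> ?W"
    then have "f x \<in> \<Union>(range C)" "x \<in> (\<Union>n. K n)" using C(2) K(2) by auto
    then obtain m n where "f x \<in> C m" "x \<in> K n" by blast
    then have "x \<in> ?L m n" using x by simp
    then have "x \<in> \<Union>(\<F> m n)" using \<F> by (meson subsetD)
    then show "x \<in> \<Union>?G" by blast
  qed
  moreover have "\<Union>?G \<subseteq> ?W"
  proof (rule Union_least)
    fix V assume "V \<in> ?G"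
    then consider "V = {}" | m n where "V \<in> \<F> m n" by blast
    then show "V \<subseteq> ?W"
    proof cases
      case 2
      then have "V \<subseteq> \<Union>(\<F> m n)" by (rule Union_upper)
      also have "\<dots> \<subseteq> ?W" using \<F> by simp
      finally show ?thesis .
    qed simp
  qed
  ultimately have "?W = (\<Union>n. from_nat_into ?G n)" unfolding r by (rule equalityI)
  moreover have "range (from_nat_into ?G) \<subseteq> insert {} \<B>"
    unfolding r using \<F> by (intro insert_mono UN_least) simp
  ultimately show ?thesis by (intro exI[of _ "from_nat_into ?G"] conjI)
qed

text \<open>A function is determined by the preimages of a countable base of \<complex>, and each
  preimage by a sequence of base sets of X. Hence a countable power bounds the number of continuous
  functions.\<close>

lemma continuous_functions_lepoll:
  fixes X :: "'p topology" and T :: "'u set"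
  assumes X: "sigma_compact_space X"
    and base: "\<And>V. V \<in> \<B> \<Longrightarrow> openin X V"
      "\<And>U x. openin X U \<Longrightarrow> x \<in> U \<Longrightarrow> \<exists>V\<in>\<B>. x \<in> V \<and> V \<subseteq> U"
    and small: "insert {} \<B> \<lesssim> T"
  shows "{f :: 'p \<Rightarrow> complex. f \<in> extensional (topspace X) \<and> continuous_map X euclidean f} \<lesssim>
    {s :: nat \<Rightarrow> 'u. range s \<subseteq> T}"
proof -
  let ?C = "{f :: 'p \<Rightarrow> complex. f \<in> extensional (topspace X) \<and> continuous_map X euclidean f}"
  have "\<exists>Q :: nat \<Rightarrow> complex set. (\<forall>n. open (Q n)) \<and> (\<forall>S. open S \<longrightarrow> (\<exists>k. S = \<Union>{Q n |n. n \<in> k}))"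
  proof (rule univ_second_countable_sequence[where 'a = complex])
    fix Q :: "nat \<Rightarrow> complex set"
    assume "\<And>n. open (Q n)" "\<And>S. open S \<Longrightarrow> \<exists>k. S = \<Union>{Q n |n. n \<in> k}"
    then show ?thesis by (intro exI[of _ Q]) simp
  qed
  then obtain Q :: "nat \<Rightarrow> complex set" where Q: "\<And>n. open (Q n)"
    "\<And>S. open S \<Longrightarrow> \<exists>k. S = \<Union>{Q n |n. n \<in> k}"
    by auto
  obtain \<iota> where \<iota>: "inj_on \<iota> (insert {} \<B>)" "\<iota> ` insert {} \<B> \<subseteq> T"
    using small unfolding lepoll_def by (elim exE conjE)
  have "\<forall>f\<in>?C. \<exists>c :: nat \<Rightarrow> nat \<Rightarrow> 'p set. \<forall>i. range (c i) \<subseteq> insert {} \<B> \<and>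
      {x \<in> topspace X. f x \<in> Q i} = (\<Union>n. c i n)"
    using open_preimage_countable_union[OF X _ base Q(1)] by (intro ballI choice allI) simp
  then have "\<exists>c :: ('p \<Rightarrow> complex) \<Rightarrow> nat \<Rightarrow> nat \<Rightarrow> 'p set. \<forall>f\<in>?C. \<forall>i. range (c f i) \<subseteq> insert {} \<B> \<and>
      {x \<in> topspace X. f x \<in> Q i} = (\<Union>n. c f i n)"
    by (rule bchoice)
  then obtain c :: "('p \<Rightarrow> complex) \<Rightarrow> nat \<Rightarrow> nat \<Rightarrow> 'p set" where
    c: "\<forall>f\<in>?C. \<forall>i. range (c f i) \<subseteq> insert {} \<B> \<and> {x \<in> topspace X. f x \<in> Q i} = (\<Union>n. c f i n)" ..
  \<comment> \<open>\<open>prod_decode\<close> packs the double sequence, indexed by base set of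
    \<complex> and position, into a single one.\<close>
  define code where "code f k = \<iota> (c f (fst (prod_decode k)) (snd (prod_decode k)))" for f k
  have c_in: "c f i n \<in> insert {} \<B>" if "f \<in> ?C" for f i n
    using c that by blast
  have "inj_on code ?C"
  proof (rule inj_onI)
    fix f g assume f: "f \<in> ?C" and g: "g \<in> ?C" and eq: "code f = code g"
    have "c f i n = c g i n" for i n
      using inj_onD[OF \<iota>(1) _ c_in[OF f] c_in[OF g], of i n i n] fun_cong[OF eq, of "prod_encode (i, n)"]
      by (simp add: code_def)
    then have Weq: "{x \<in> topspace X. f x \<in> Q i} = {x \<in> topspace X. g x \<in> Q i}" for i
      using c f g by simp
    have "f x = g x" if x: "x \<in> topspace X" for x
    proof (rule ccontr)
      assume "f x \<noteq> g x"
      then obtain S where S: "open S" "f x \<in> S" "g x \<notin> S" using t1_space_class.t1_space by blast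
      obtain k where k: "S = \<Union>{Q n |n. n \<in> k}" using Q(2)[OF S(1)] ..
      then obtain n where "n \<in> k" "f x \<in> Q n" using S(2) by blast
      moreover then have "g x \<in> Q n" using Weq[of n] x by blast
      ultimately show False using S(3) k by blast
    qed
    then show "f = g" using f g by (intro extensionalityI[of f "topspace X"]) auto
  qed
  moreover have "code ` ?C \<subseteq> {s. range s \<subseteq> T}"
  proof
    fix s assume "s \<in> code ` ?C"
    then obtain f where f: "f \<in> ?C" "s = code f" by (elim imageE)
    have "code f k \<in> T" for k
      unfolding code_def by (rule subsetD[OF \<iota>(2) imageI[OF c_in[OF f(1)]]])
    then show "s \<in> {s. range s \<subseteq> T}" using f(2) by auto
  qed
  ultimately show ?thesis unfolding lepoll_def by (intro exI conjI)
qed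

text \<open>A two-element set already has infinitely many sequences. An infinite member is needed to
  make room for the empty set next to a finite base.\<close>

lemma universe_infinite:
  fixes \<U> :: "'u set set"
  assumes U: "universe \<U>"
  shows "\<exists>T\<in>\<U>. infinite T"
proof -
  obtain S x y where S: "S \<in> \<U>" "x \<in> S" "y \<in> S" "x \<noteq> y"
    using U unfolding universe_def by blast
  obtain T where T: "T \<in> \<U>" "{f :: nat \<Rightarrow> 'u. range f \<subseteq> S} \<lesssim> T"
    using U S(1) unfolding universe_def by blast
  have "inj (\<lambda>n m :: nat. if m = n then x else y)"
  proof (rule injI)
    fix n k :: nat assume "(\<lambda>m. if m = n then x else y) = (\<lambda>m. if m = k then x else y)"
    from fun_cong[OF this, of n] show "n = k" using S(4) by (simp split: if_splits)
  qed
  then have "infinite (range (\<lambda>n m :: nat. if m = n then x else y))"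
    by (simp add: finite_image_iff)
  moreover have "range (\<lambda>n m :: nat. if m = n then x else y) \<subseteq> {f. range f \<subseteq> S}" using S by auto
  ultimately have "infinite {f :: nat \<Rightarrow> 'u. range f \<subseteq> S}" by (meson finite_subset)
  then have "infinite T" using T(2) by (metis inj_on_finite lepoll_def)
  with T(1) show ?thesis by blast
qed

text \<open>This is where the closure properties of the universe are used: a countable power bounds
  the set of continuous functions, and its image under \<open>\<iota>\<close> is a smaller
  set.\<close>

lemma small_space_function_algebra:
  fixes \<U> :: "'u set set" and X :: "'p topology"
  assumes U: "universe \<U>" and small: "small_space \<U> X"
    and X: "Hausdorff_space X" "locally_compact_space X" "sigma_compact_space X"
  shows "\<exists>A :: 'u star_algebra. \<exists>ev nm. function_algebra X A ev nm \<and> carrier A \<in> \<U>"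
proof -
  let ?C = "{f :: 'p \<Rightarrow> complex. f \<in> extensional (topspace X) \<and> continuous_map X euclidean f}"
  obtain \<B> S where \<B>: "S \<in> \<U>" "\<B> \<lesssim> S" "\<forall>V\<in>\<B>. openin X V"
    "\<forall>U x. openin X U \<and> x \<in> U \<longrightarrow> (\<exists>V\<in>\<B>. x \<in> V \<and> V \<subseteq> U)"
    using small unfolding small_space_def by (elim exE conjE bexE)
  have "\<exists>T\<in>\<U>. insert {} \<B> \<lesssim> T"
  proof (cases "finite \<B>")
    case True
    obtain T where T: "T \<in> \<U>" "infinite T" using universe_infinite[OF U] by (elim bexE)
    have "insert {} \<B> \<lesssim> T" using T(2) True by (intro finite_lepoll_infinite) simp_all
    with T(1) show ?thesis by (rule bexI[rotated])
  next
    case False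
    have "insert {} \<B> \<lesssim> S" using infinite_insert_lepoll[OF False] \<B>(2) by (rule lepoll_trans)
    then show ?thesis using \<B>(1) by (rule bexI)
  qed
  then obtain T where T: "T \<in> \<U>" "insert {} \<B> \<lesssim> T" by (elim bexE)
  obtain R where R: "R \<in> \<U>" "{s :: nat \<Rightarrow> 'u. range s \<subseteq> T} \<lesssim> R"
    using U T(1) unfolding universe_def by meson
  have "?C \<lesssim> {s :: nat \<Rightarrow> 'u. range s \<subseteq> T}"
    by (rule continuous_functions_lepoll[OF X(3) _ _ T(2)]) (use \<B>(3,4) in auto)
  then have "?C \<lesssim> R" using R(2) by (rule lepoll_trans)
  then obtain \<iota> where \<iota>: "inj_on \<iota> ?C" "\<iota> ` ?C \<subseteq> R" unfolding lepoll_def by (elim exE conjE)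
  have "\<iota> ` ?C \<lesssim> R" using \<iota>(2) by (rule subset_imp_lepoll)
  then have "\<iota> ` ?C \<in> \<U>" using U R(1) unfolding universe_def by blast
  then show ?thesis using function_algebra_exists[OF X \<iota>(1)] by metis
qed

section \<open>The duality\<close>

lemma homeomorphic_space_imp_iso:
  fixes X Y :: "'p topology" and \<X> :: "'p topology set"
  assumes "X homeomorphic_space Y"
  shows "\<exists>f. is_iso (space_category \<X>) X Y f"
proof -
  obtain f g where fg: "homeomorphic_maps X Y f g" using assms by (auto simp: homeomorphic_space_def)
  then have f: "continuous_map X Y f" and g: "continuous_map Y X g"
    and gf: "\<And>x. x \<in> topspace X \<Longrightarrow> g (f x) = x" and fg: "\<And>y. y \<in> topspace Y \<Longrightarrow> f (g y) = y"
    by (simp_all add: homeomorphic_maps_def)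
  let ?f = "restrict f (topspace X)" and ?g = "restrict g (topspace Y)"
  have im: "f x \<in> topspace Y" if "x \<in> topspace X" for x
    using continuous_map_image_subset_topspace[OF f] that by auto
  have im': "g y \<in> topspace X" if "y \<in> topspace Y" for y
    using continuous_map_image_subset_topspace[OF g] that by auto
  have "continuous_map X Y ?f" by (rule continuous_map_eq[OF f]) simp
  moreover have "continuous_map Y X ?g" by (rule continuous_map_eq[OF g]) simp
  moreover have "compose (topspace X) ?g ?f = (\<lambda>x\<in>topspace X. x)"
    using im gf by (auto simp: compose_def fun_eq_iff)
  moreover have "compose (topspace Y) ?f ?g = (\<lambda>y\<in>topspace Y. y)"
    using im' fg by (auto simp: compose_def fun_eq_iff)
  ultimately have "is_iso (space_category \<X>) X Y ?f"
    unfolding is_iso_def space_category_def by (auto intro!: bexI[of _ ?g])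
  then show ?thesis by (intro exI[of _ ?f])
qed

theorem theorem4p6:
  fixes \<U> :: "'u set set"
  assumes "universe \<U>"
  shows "equivalent_categories (dual_category (metrizable_lcstar_category \<U>)) (hemicompact_lc_category \<U>)
    \<and> equivalent_categories (dual_category (metrizable_lcstar_category \<U>)) (sigma_compact_lc_category \<U>)"
proof -
  let ?C = "dual_category (metrizable_lcstar_category \<U>)" and ?D = "sigma_compact_lc_category \<U>"
  have "equivalent_categories ?C ?D"
  proof (rule equivalent_categoriesI[OF _ _ is_functor_spectrum])
    show "is_category ?C" by (rule is_category_dual[OF is_category_metrizable_lcstar])
    show "is_category ?D" unfolding sigma_compact_lc_category_def by (rule is_category_space_category)
    show "bij_betw (spectrum_map A B) (Arr ?C A B) (Arr ?D (spectrum A) (spectrum B))"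
      if "A \<in> Obj ?C" "B \<in> Obj ?C" for A B
      using that by (rule spectrum_fully_faithful)
    show "\<exists>A\<in>Obj ?C. \<exists>f. is_iso ?D (spectrum A) X f" if "X \<in> Obj ?D" for X
    proof -
      have X: "small_space \<U> X" "Hausdorff_space X" "locally_compact_space X" "sigma_compact_space X"
        using that by (simp_all add: sigma_compact_lc_category_def space_category_def)
      obtain A :: "'u star_algebra" and ev nm where A: "function_algebra X A ev nm" "carrier A \<in> \<U>"
        using small_space_function_algebra[OF assms X] by metis
      interpret function_algebra X A ev nm by (rule A(1))
      have "A \<in> Obj ?C"
        using A(2) lcstar_A metrizable_A by (simp add: dual_category_def metrizable_lcstar_category_def)
      moreover have "\<exists>f. is_iso ?D (spectrum A) X f"
        unfolding sigma_compact_lc_category_def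
        by (rule homeomorphic_space_imp_iso[OF homeomorphic_space_X_spectrum])
      ultimately show ?thesis by blast
    qed
  qed
  then show ?thesis by (simp add: hemicompact_lc_category_eq)
qed

end
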